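(* Let $n\ge 2$ be an even integer, and for each $N\ge 1$ let $X=X^{(N)}\in(\mathbb C^N)^{\otimes n}$ be a random tensor with i.i.d. standard complex Gaussian entries. For every subset $I\subseteq\{1,\dots,n\}$ with $|I|=n/2$ and every permutation $\pi\in\mathcal S_{n/2}$, let $W_{I,\pi}=P_\pi W_I P_\pi^{-1}\in\mathcal M_{N^{n/2}}(\mathbb C)$ be the corresponding permuted marginal of $XX^*$. Then the family of random matrices $$\left(N^{-n/2}\,W_{I,\pi}\right)_{I\in\binom{\{1,\dots,n\}}{n/2},\ \pi\in\mathcal S_{n/2}}$$ converges in distribution (in mixed moments), as $N\to\infty$, to a family of $\binom{n}{n/2}(n/2)!$ free random variables, each having the Marčenko–Pastur distribution of parameter $1$. At the level of moments: for every $p\ge1$, every word $\boldsymbol f=(I_1,\dots,I_p)$ of $(n/2)$-subsets of $\{1,\dots,n\}$ and every word $\boldsymbol\pi=(\pi_1,\dots,\pi_p)$ of permutations in $\mathcal S_{n/2}$, writing $W_{\boldsymbol f,\boldsymbol\pi}=W_{I_p,\pi_p}\cdots W_{I_2,\pi_2}W_{I_1,\pi_1}$, $$\lim_{N\to\infty}\mathbb E\,N^{-n(p+1)/2}\operatorname{Tr}W_{\boldsymbol f,\boldsymbol\pi}=\bigl|\mathbb M^{bal}_{\boldsymbol f,\boldsymbol\pi}\bigr|,$$ where $\mathbb M^{bal}_{\boldsymbol f,\boldsymbol\pi}$ is the set of planar maps $\mathcal M\in\mathbb M_p$ such that $\boldsymbol f$ and $\boldsymbol\pi$ are constant on the white vertices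 of $\mathcal M$ (i.e. $I_a=I_b$ and $\pi_a=\pi_b$ whenever $a,b$ lie in the same cycle of $\alpha$).
   Context: A standard complex Gaussian variable has density $\frac1\pi e^{-|z|^2}$ on $\mathbb C$. For $I\subseteq\{1,\dots,n\}$ with $|I|=n/2$, $W_I=[\mathrm{id}_I\otimes\operatorname{Tr}_{\{1,\dots,n\}\setminus I}](XX^* )$ is the partial trace of the rank one operator $XX^*$ over the tensor factors not in $I$; it is regarded as an operator on $(\mathbb C^N)^{\otimes n/2}$ by listing the elements of $I$ in increasing order. For $\pi\in\mathcal S_{n/2}$, $P_\pi$ is the unitary operator permuting the $n/2$ tensor factors of $(\mathbb C^N)^{\otimes n/2}$ according to $\pi$: $P_\pi(x_1\otimes\cdots\otimes x_{n/2})=x_{\pi^{-1}(1)}\otimes\cdots\otimes x_{\pi^{-1}(n/2)}$. Maps: $\mathbb M_p$ is the set of bicolored combinatorial maps with a single black vertex and $p$ labeled edges, i.e. pairs $\mathcal M=(\gamma,\alpha)$ where $\gamma=(1\,2\cdots p)$ is fixed and $\alpha\in\mathcal S_p$ is arbitrary; edges are the elements of $\{1,\dots,p\}$ and white vertices are the cycles of $\alpha$. Writing $\#$ for the number of cycles, $\mathcal M$ is planar if its genus $g$, defined by $1+\#\alpha+\#(\gamma\alpha)-p=2-2g$, is $0$. Convergence in distribution of random matrices $A_i^{(N)}\in\mathcal M_{d_N}(\mathbb C)$ to non-commutative random variables means convergence of all mixed moments $\mathbb E\frac1{d_N}\operatorname{Tr}(A_{i_1}\cdots A_{i_p})$. The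 Marčenko–Pastur distribution of parameter $c$ is the probability measure all of whose free cumulants equal $c$. *)

theory Defs
  imports
    "HOL-Probability.Probability"
    "HOL-Combinatorics.Combinatorics"
    "HOL-Computational_Algebra.Polynomial"
    "HOL-Library.Poly_Mapping"
    "HOL-Library.Disjoint_Sets"
begin

section \<open>Matrices with an arbitrary finite index set\<close>

text \<open>
  The space \<open>(\<complex>\<^sup>N)\<^sup>\<otimes>\<^sup>m\<close> has the orthonormal basis \<open>e\<^sub>a = e\<^bsub>a 1\<^esub> \<otimes> \<dots> \<otimes> e\<^bsub>a m\<^esub>\<close> indexed by
  the multi-indices \<open>a : {1..m} \<rightarrow> {1..N}\<close>. An operator is represented by its matrix in this basis,
  i.e. by a function of two multi-indices, of which only the values on the index set \<open>D\<close> matter.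
\<close>

type_synonym 'k matrix = "'k \<Rightarrow> 'k \<Rightarrow> complex"

definition mat_mult :: "'k set \<Rightarrow> 'k matrix \<Rightarrow> 'k matrix \<Rightarrow> 'k matrix" where
  "mat_mult D A B = (\<lambda>a b. \<Sum>c\<in>D. A a c * B c b)"

definition mat_one :: "'k matrix" where
  "mat_one = (\<lambda>a b. if a = b then 1 else 0)"

definition mat_prod :: "'k set \<Rightarrow> 'k matrix list \<Rightarrow> 'k matrix" where
  "mat_prod D As = foldr (mat_mult D) As mat_one"

definition mat_trace :: "'k set \<Rightarrow> 'k matrix \<Rightarrow> complex" where
  "mat_trace D A = (\<Sum>a\<in>D. A a a)"

section \<open>Random tensors and their marginals\<close>

type_synonym multi_index = "nat \<Rightarrow> nat"

text \<open>Basis of the tensor product of copies of \<open>\<complex>\<^sup>N\<close>, one for each element of \<open>S\<close>.\<close>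

definition multi_indices :: "nat set \<Rightarrow> nat \<Rightarrow> multi_index set" where
  "multi_indices S N = S \<rightarrow>\<^sub>E {1..N}"

definition standard_complex_gaussian :: "'w measure \<Rightarrow> ('w \<Rightarrow> complex) \<Rightarrow> bool" where
  "standard_complex_gaussian M Z \<longleftrightarrow>
     distributed M lborel Z (\<lambda>z. ennreal (1 / pi * exp (- (cmod z)\<^sup>2)))"

definition gaussian_tensor ::
    "'w measure \<Rightarrow> nat \<Rightarrow> nat \<Rightarrow> (multi_index \<Rightarrow> 'w \<Rightarrow> complex) \<Rightarrow> bool" where
  "gaussian_tensor M n N X \<longleftrightarrow>
     prob_space M \<and>
     prob_space.indep_vars M (\<lambda>_. borel) X (multi_indices {1..n} N) \<and>
     (\<forall>t\<in>multi_indices {1..n} N. standard_complex_gaussian M (X t))"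

definition rank_one :: "('k \<Rightarrow> complex) \<Rightarrow> 'k matrix" where
  "rank_one x = (\<lambda>a b. x a * cnj (x b))"

text \<open>
  \<open>[id\<^sub>I \<otimes> Tr\<^bsub>S - I\<^esub>] A\<close> for an operator \<open>A\<close> on the tensor product over \<open>S\<close>, for \<open>I \<subseteq> S\<close>; the result
  is an operator on the tensor product over \<open>I\<close>.
\<close>

definition partial_trace :: "nat \<Rightarrow> nat set \<Rightarrow> nat set \<Rightarrow> multi_index matrix \<Rightarrow> multi_index matrix" where
  "partial_trace N S I A =
     (\<lambda>a b. \<Sum>c\<in>multi_indices (S - I) N. A (merge I (S - I) (a, c)) (merge I (S - I) (b, c)))"

text \<open>
  The identification of the tensor product over \<open>{1..card I}\<close> with the one over \<open>I\<close> by listing \<open>I\<close>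
  increasingly: the element \<open>i \<in> I\<close> has position \<open>card {j \<in> I. j \<le> i}\<close> in this list.
\<close>

definition spread :: "nat set \<Rightarrow> multi_index \<Rightarrow> multi_index" where
  "spread I a = (\<lambda>i\<in>I. a (card {j\<in>I. j \<le> i}))"

definition marginal :: "nat \<Rightarrow> nat \<Rightarrow> nat set \<Rightarrow> (multi_index \<Rightarrow> complex) \<Rightarrow> multi_index matrix" where
  "marginal n N I x =
     (\<lambda>a b. partial_trace N {1..n} I (rank_one x) (spread I a) (spread I b))"

text \<open>\<open>P\<^sub>\<pi> e\<^sub>b = e\<^bsub>b \<circ> \<pi>\<inverse>\<^esub>\<close>; see \<open>perm_op_pure_tensor\<close> below for arbitrary pure tensors.\<close>

definition perm_op :: "(nat \<Rightarrow> nat) \<Rightarrow> multi_index matrix" where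
  "perm_op \<pi> = (\<lambda>a b. if a = b \<circ> inv \<pi> then 1 else 0)"

text \<open>The inverse of \<open>P\<^sub>\<pi>\<close> is \<open>P\<^bsub>\<pi>\<inverse>\<^esub>\<close>; see \<open>perm_op_inverse\<close> below.\<close>

definition permuted_marginal ::
    "nat \<Rightarrow> nat \<Rightarrow> nat set \<times> (nat \<Rightarrow> nat) \<Rightarrow> (multi_index \<Rightarrow> complex) \<Rightarrow> multi_index matrix" where
  "permuted_marginal n N = (\<lambda>(I, \<pi>) x.
     let D = multi_indices {1..n div 2} N
     in mat_prod D [perm_op \<pi>, marginal n N I x, perm_op (inv \<pi>)])"

definition marginal_labels :: "nat \<Rightarrow> (nat set \<times> (nat \<Rightarrow> nat)) set" where
  "marginal_labels n =
     {I. I \<subseteq> {1..n} \<and> card I = n div 2} \<times> {\<pi>. \<pi> permutes {1..n div 2}}"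

lemma comp_permutes_multi_indices:
  assumes "\<pi> permutes S" "a \<in> multi_indices S N"
  shows "a \<circ> \<pi> \<in> multi_indices S N"
  using assms unfolding multi_indices_def
  by (auto simp: PiE_iff extensional_def permutes_in_image permutes_not_in)

lemma perm_op_pure_tensor:
  fixes x :: "nat \<Rightarrow> nat \<Rightarrow> complex"
  assumes "\<pi> permutes {1..m}" "a \<in> multi_indices {1..m} N"
  shows "(\<Sum>b\<in>multi_indices {1..m} N. perm_op \<pi> a b * (\<Prod>k=1..m. x k (b k))) =
         (\<Prod>k=1..m. x (inv \<pi> k) (a k))"
proof -
  let ?D = "multi_indices {1..m} N"
  have iff: "a = b \<circ> inv \<pi> \<longleftrightarrow> b = a \<circ> \<pi>" for b
    using permutes_inv_o[OF assms(1)] by (metis comp_assoc comp_id)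
  have fin: "finite ?D"
    unfolding multi_indices_def by (intro finite_PiE) auto
  have "(\<Sum>b\<in>?D. perm_op \<pi> a b * (\<Prod>k=1..m. x k (b k))) =
        (\<Sum>b\<in>?D. if b = a \<circ> \<pi> then (\<Prod>k=1..m. x k (b k)) else 0)"
    by (intro sum.cong) (auto simp: perm_op_def iff)
  also have "\<dots> = (\<Prod>k=1..m. x k (a (\<pi> k)))"
    using fin comp_permutes_multi_indices[OF assms] by simp
  also have "\<dots> = (\<Prod>k=1..m. x (inv \<pi> k) (a k))"
    using assms(1)
    by (subst prod.permute[OF assms(1), of "\<lambda>k. x (inv \<pi> k) (a k)"])
       (simp add: permutes_inverses o_def)
  finally show ?thesis .
qed

lemma perm_op_inverse:
  assumes "\<pi> permutes {1..m}" "a \<in> multi_indices {1..m} N" "b \<in> multi_indices {1..m} N"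
  shows "mat_mult (multi_indices {1..m} N) (perm_op \<pi>) (perm_op (inv \<pi>)) a b = mat_one a b"
    and "mat_mult (multi_indices {1..m} N) (perm_op (inv \<pi>)) (perm_op \<pi>) a b = mat_one a b"
proof -
  let ?D = "multi_indices {1..m} N"
  have fin: "finite ?D"
    unfolding multi_indices_def by (intro finite_PiE) auto
  have *: "mat_mult ?D (perm_op \<sigma>) (perm_op (inv \<sigma>)) a b = mat_one a b"
    if \<sigma>: "\<sigma> permutes {1..m}" for \<sigma>
  proof -
    have inv2: "inv (inv \<sigma>) = \<sigma>"
      using \<sigma> by (simp add: permutes_inv_inv)
    have "b \<circ> \<sigma> \<circ> inv \<sigma> = b"
      using permutes_inv_o[OF \<sigma>] by (metis comp_assoc comp_id)
    moreover have "mat_mult ?D (perm_op \<sigma>) (perm_op (inv \<sigma>)) a b =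
        (\<Sum>c\<in>?D. if c = b \<circ> \<sigma> then (if a = c \<circ> inv \<sigma> then 1 else 0) else 0)"
      unfolding mat_mult_def perm_op_def inv2 by (intro sum.cong) auto
    ultimately show ?thesis
      using fin comp_permutes_multi_indices[OF \<sigma> assms(3)] by (simp add: mat_one_def)
  qed
  show "mat_mult ?D (perm_op \<pi>) (perm_op (inv \<pi>)) a b = mat_one a b"
    by (rule *[OF assms(1)])
  show "mat_mult ?D (perm_op (inv \<pi>)) (perm_op \<pi>) a b = mat_one a b"
    using *[OF permutes_inv[OF assms(1)]] permutes_inv_inv[OF assms(1)] by simp
qed

section \<open>Non-commutative probability\<close>

locale nc_probability_space = vector_space smul
  for smul :: "complex \<Rightarrow> 'a::ring_1 \<Rightarrow> 'a" +
  fixes \<phi> :: "'a \<Rightarrow> complex"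
  assumes smul_mult_left: "smul c x * y = smul c (x * y)"
    and smul_mult_right: "x * smul c y = smul c (x * y)"
    and linear_functional: "Vector_Spaces.linear smul (*) \<phi>"
    and unital: "\<phi> 1 = 1"

definition poly_eval :: "(complex \<Rightarrow> 'a::ring_1 \<Rightarrow> 'a) \<Rightarrow> complex poly \<Rightarrow> 'a \<Rightarrow> 'a" where
  "poly_eval smul q x = (\<Sum>k\<le>degree q. smul (coeff q k) (x ^ k))"

text \<open>
  Freeness of the unital subalgebras generated by the \<open>a i\<close>, whose elements are the \<open>q(a i)\<close> for
  polynomials \<open>q\<close>: an alternating product of centred elements is centred.
\<close>

definition free_family ::
    "(complex \<Rightarrow> 'a::ring_1 \<Rightarrow> 'a) \<Rightarrow> ('a \<Rightarrow> complex) \<Rightarrow> 'i set \<Rightarrow> ('i \<Rightarrow> 'a) \<Rightarrow> bool" where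
  "free_family smul \<phi> J a \<longleftrightarrow>
     (\<forall>qs :: ('i \<times> complex poly) list.
        qs \<noteq> [] \<and> fst ` set qs \<subseteq> J \<and> distinct_adj (map fst qs) \<and>
        (\<forall>(i, q)\<in>set qs. \<phi> (poly_eval smul q (a i)) = 0) \<longrightarrow>
        \<phi> (prod_list (map (\<lambda>(i, q). poly_eval smul q (a i)) qs)) = 0)"

definition noncrossing_partitions :: "nat \<Rightarrow> nat set set set" where
  "noncrossing_partitions k =
     {P. partition_on {1..k} P \<and>
         \<not> (\<exists>A\<in>P. \<exists>B\<in>P. A \<noteq> B \<and>
              (\<exists>a\<in>A. \<exists>b\<in>B. \<exists>c\<in>A. \<exists>d\<in>B. a < b \<and> b < c \<and> c < d))}"

text \<open>\<open>\<kappa> 1, \<kappa> 2, \<dots>\<close> are the free cumulants of the moment sequence \<open>m 1, m 2, \<dots>\<close>.\<close>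

definition free_cumulants :: "(nat \<Rightarrow> real) \<Rightarrow> (nat \<Rightarrow> real) \<Rightarrow> bool" where
  "free_cumulants m \<kappa> \<longleftrightarrow>
     (\<forall>k\<ge>1. m k = (\<Sum>P\<in>noncrossing_partitions k. \<Prod>B\<in>P. \<kappa> (card B)))"

definition marchenko_pastur :: "real \<Rightarrow> real measure \<Rightarrow> bool" where
  "marchenko_pastur c \<mu> \<longleftrightarrow>
     real_distribution \<mu> \<and> (\<forall>k. integrable \<mu> (\<lambda>x. x ^ k)) \<and>
     free_cumulants (\<lambda>k. \<integral>x. x ^ k \<partial>\<mu>) (\<lambda>_. c)"

definition has_distribution :: "('a::ring_1 \<Rightarrow> complex) \<Rightarrow> 'a \<Rightarrow> real measure \<Rightarrow> bool" where
  "has_distribution \<phi> x \<mu> \<longleftrightarrow> (\<forall>k. \<phi> (x ^ k) = complex_of_real (\<integral>t. t ^ k \<partial>\<mu>))"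

text \<open>
  For each \<open>N\<close>, \<open>A N i\<close> is a random matrix on the probability space \<open>M N\<close> with finite index set
  \<open>D N\<close>, so that \<open>card (D N)\<close> is its size.
\<close>

definition converges_in_moments ::
    "(nat \<Rightarrow> 'w measure) \<Rightarrow> (nat \<Rightarrow> 'k set) \<Rightarrow> 'i set \<Rightarrow> (nat \<Rightarrow> 'i \<Rightarrow> 'w \<Rightarrow> 'k matrix) \<Rightarrow>
     ('a::ring_1 \<Rightarrow> complex) \<Rightarrow> ('i \<Rightarrow> 'a) \<Rightarrow> bool" where
  "converges_in_moments M D J A \<phi> a \<longleftrightarrow>
     (\<forall>js\<in>lists J.
        (\<lambda>N. \<integral>\<omega>. mat_trace (D N) (mat_prod (D N) (map (\<lambda>j. A N j \<omega>) js)) / of_nat (card (D N)) \<partial>M N)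
          \<longlonglongrightarrow> \<phi> (prod_list (map a js)))"

text \<open>
  The free algebra \<open>\<complex>\<langle>x\<^sub>i\<rangle>\<close>, as the monoid algebra of the free monoid of words. Since only mixed moments
  matter, every family in some non-commutative probability space has a copy with the same mixed
  moments here (the coordinate variables, with the functional pulled back).
\<close>

datatype 'i word = Word (letters: "'i list")

instantiation word :: (type) monoid_add
begin
definition zero_word :: "'a word" where "zero_word = Word []"
definition plus_word :: "'a word \<Rightarrow> 'a word \<Rightarrow> 'a word" where
  "plus_word u v = Word (letters u @ letters v)"
instance
  by standard (auto simp: zero_word_def plus_word_def)
end

type_synonym 'i free_algebra = "'i word \<Rightarrow>\<^sub>0 complex"

definition free_algebra_scale :: "complex \<Rightarrow> 'i free_algebra \<Rightarrow> 'i free_algebra" where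
  "free_algebra_scale c x = Poly_Mapping.single 0 c * x"

section \<open>Bicolored maps with a single black vertex\<close>

definition combinatorial_maps :: "nat \<Rightarrow> ((nat \<Rightarrow> nat) \<times> (nat \<Rightarrow> nat)) set" where
  "combinatorial_maps p = {(\<gamma>, \<alpha>). \<gamma> = cycle_of_list [1..<Suc p] \<and> \<alpha> permutes {1..p}}"

text \<open>Cycles of a permutation of \<open>{1..p}\<close>, fixed points included, as sets of points.\<close>

definition cycles_of :: "nat \<Rightarrow> (nat \<Rightarrow> nat) \<Rightarrow> nat set set" where
  "cycles_of p \<alpha> = orbit \<alpha> ` {1..p}"

text \<open>The genus is computed in the reals, so that no rounding is involved.\<close>

definition genus :: "nat \<Rightarrow> (nat \<Rightarrow> nat) \<times> (nat \<Rightarrow> nat) \<Rightarrow> real" where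
  "genus p = (\<lambda>(\<gamma>, \<alpha>).
     (2 - (1 + real (card (cycles_of p \<alpha>)) + real (card (cycles_of p (\<gamma> \<circ> \<alpha>))) - real p)) / 2)"

definition balanced_maps ::
    "nat \<Rightarrow> (nat \<Rightarrow> nat set) \<Rightarrow> (nat \<Rightarrow> nat \<Rightarrow> nat) \<Rightarrow> ((nat \<Rightarrow> nat) \<times> (nat \<Rightarrow> nat)) set" where
  "balanced_maps p f \<pi> =
     {(\<gamma>, \<alpha>) \<in> combinatorial_maps p.
        genus p (\<gamma>, \<alpha>) = 0 \<and>
        (\<forall>C\<in>cycles_of p \<alpha>. \<forall>a\<in>C. \<forall>b\<in>C. f a = f b \<and> \<pi> a = \<pi> b)}"

end

theory Submission
  imports Defs
begin

text \<open>
  By Wick's formula the expected trace of a word of length \<open>p\<close> is a sum over the pairings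
  \<open>\<alpha> \<in> S\<^sub>p\<close> of \<open>N\<close> to the number of free index loops. With \<open>\<beta> = \<gamma>\<alpha>\<close>, these loops are closed walks in the
  digraph with arcs \<open>k \<rightarrow> \<alpha> k\<close> and \<open>k \<rightarrow> \<beta> k\<close>, each arc carrying \<open>n/2\<close> strands, and the permutations of the
  strands at the vertices depend on the labels. If no arc is a loop, one of the two orientations of a linear order shows
  that \<open>p\<close> arcs meet every closed walk; otherwise a loop can be removed. By induction there are at most
  \<open>(p + 1) n/2\<close> free indices, and equality forces every removed loop to join equal labels and \<open>\<alpha>\<close> to be planar.

  The number of planar permutations that preserve a labelling satisfies a recursion on the image of the last point.
  The same recursion holds for the vacuum moments of the operators \<open>(1 + l\<^sub>j)(1 + l\<^sub>j\<^sup>*)\<close> on the full Fock space,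
  where freeness is visible since a centred polynomial in the \<open>j\<close>-th operator maps any vector without leading letter \<open>j\<close>
  to a combination of words with leading letter \<open>j\<close>. For a constant word the recursion is that of the Catalan
  numbers, which count non-crossing partitions and are the moments of four times a Beta variable with parameters
  \<open>1/2\<close> and \<open>3/2\<close>.
\<close>

section \<open>Cycle counts and feedback sets\<close>

text \<open>The index loops depend on the labels, so they are bounded rather than counted. Each
  point has an incoming \<alpha>-arc and an incoming \<beta>-arc of n/2 strands each. Once the
  indices on arcs meeting every closed walk are known, all others follow along the remaining acyclic
  arcs, whatever the permutations of the strands. The number p of the loopless case is half of the
  2p arcs: an arc that is no loop ascends or descends. As p < p + 1, an extremal \<alpha> must have
  a loop, which drives both the bound and its equality case. A loop of \<alpha> compares no labels;
  a loop of \<beta> at k compares those of k and \<alpha> k.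

  The Fock space operator is chosen because on words in a single letter its matrix is the Jacobi
  matrix of the Marchenko-Pastur law of parameter 1: diagonal 1, 2, 2, ... and off-diagonal entries
  1. With x = 4 t that law has density proportional to t^(-1/2) (1 - t)^(1/2) on [0, 1], whence the
  Beta variable.\<close>

definition cycle_count :: "'a set \<Rightarrow> ('a \<Rightarrow> 'a) \<Rightarrow> nat" where
  "cycle_count V \<alpha> = card (orbit \<alpha> ` V)"

text \<open>The first-return map to the complement of \<open>k\<close>.\<close>

definition skip :: "'a \<Rightarrow> ('a \<Rightarrow> 'a) \<Rightarrow> 'a \<Rightarrow> 'a" where
  "skip k \<alpha> = Transposition.transpose k (\<alpha> k) \<circ> \<alpha>"

lemma skip_apply: "inj \<alpha> \<Longrightarrow> skip k \<alpha> x = (if x = k then k else if \<alpha> x = k then \<alpha> k else \<alpha> x)"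
  by (auto simp: skip_def Transposition.transpose_def inj_eq)

lemma permutes_skip:
  assumes "\<alpha> permutes V"
  shows "skip k \<alpha> permutes (V - {k})"
proof (cases "k \<in> V")
  case True
  have "skip k \<alpha> permutes V"
    unfolding skip_def using True assms
    by (intro permutes_compose permutes_swap_id) (auto simp: permutes_in_image)
  then show ?thesis
    by (rule permutes_superset) (use True in \<open>auto simp: skip_def\<close>)
next
  case False
  then show ?thesis using assms by (simp add: skip_def permutes_not_in)
qed

lemma orbit_self:
  assumes "\<alpha> permutes V" "finite V"
  shows "x \<in> orbit \<alpha> x"
  using assms by (intro permutation_self_in_orbit) (auto simp: permutation_permutes)

lemma orbit_eq_iff:
  assumes "\<alpha> permutes V" "finite V"
  shows "orbit \<alpha> x = orbit \<alpha> y \<longleftrightarrow> y \<in> orbit \<alpha> x"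
  using cyclic_on_orbit[OF assms, of x] orbit_self[OF assms]
  by (metis orbit_cyclic_eq3)

lemma orbit_disjoint:
  assumes "\<alpha> permutes V" "finite V" "z \<in> orbit \<alpha> x" "z \<in> orbit \<alpha> y"
  shows "orbit \<alpha> x = orbit \<alpha> y"
  using assms by (metis orbit_eq_iff)

text \<open>The first-return map follows the same cycle; only the passage through \<open>k\<close>
  is shortened to a single step.\<close>

lemma orbit_skip:
  assumes \<alpha>: "\<alpha> permutes V" "finite V" and k: "\<alpha> k \<noteq> k" and x: "x \<noteq> k"
  shows "orbit (skip k \<alpha>) x = orbit \<alpha> x - {k}"
proof -
  have inj: "inj \<alpha>" using \<alpha> permutes_inj by blast
  note s = skip_apply[OF inj, of k]
  show ?thesis
  proof (intro set_eqI iffI)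
    fix y assume "y \<in> orbit (skip k \<alpha>) x"
    then show "y \<in> orbit \<alpha> x - {k}"
    proof induct
      case base
      show ?case
      proof (cases "\<alpha> x = k")
        case True
        then have "\<alpha> k \<in> orbit \<alpha> x" using orbit.step[OF orbit.base, of \<alpha> x] by simp
        then show ?thesis using x k True by (simp add: s)
      qed (use x orbit.base[of \<alpha> x] in \<open>simp add: s\<close>)
    next
      case (step y)
      show ?case
      proof (cases "\<alpha> y = k")
        case True
        then have "\<alpha> k \<in> orbit \<alpha> x" using step orbit.step[OF orbit.step, of y \<alpha> x] by simp
        then show ?thesis using step k True by (simp add: s)
      qed (use step orbit.step[of y \<alpha> x] in \<open>simp add: s\<close>)
    qed
  next
    fix y assume "y \<in> orbit \<alpha> x - {k}"
    \<comment> \<open>The induction may pass through \<open>k\<close>, so the claim also records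
      what to continue from there: the point after \<open>k\<close>.\<close>
    moreover have "(y \<noteq> k \<longrightarrow> y \<in> orbit (skip k \<alpha>) x) \<and> (y = k \<longrightarrow> \<alpha> k \<in> orbit (skip k \<alpha>) x)"
      if "y \<in> orbit \<alpha> x" for y
      using that
    proof induct
      case base
      show ?case using x k orbit.base[of "skip k \<alpha>" x] s[of x] by (auto split: if_splits)
    next
      case (step y)
      show ?case
      proof (cases "y = k")
        case True
        then show ?thesis using step k by auto
      next
        case False
        then have "skip k \<alpha> y \<in> orbit (skip k \<alpha>) x" using step by (auto intro: orbit.step)
        then show ?thesis using False k s[of y] by (auto split: if_splits)
      qed
    qed
    ultimately show "y \<in> orbit (skip k \<alpha>) x" by auto
  qed
qed

text \<open>The cycle of \<open>k\<close> has a second point and thus survives the deletion of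
  \<open>k\<close>; distinct cycles remain distinct because they are disjoint.\<close>

lemma cycle_count_skip:
  assumes \<alpha>: "\<alpha> permutes V" "finite V" and k: "\<alpha> k \<noteq> k"
  shows "cycle_count (V - {k}) (skip k \<alpha>) = cycle_count V \<alpha>"
proof -
  have kV: "k \<in> V" using assms permutes_not_in by metis
  have "orbit \<alpha> k = orbit \<alpha> (\<alpha> k)"
    using \<alpha> permutation_orbit_step permutation_permutes by metis
  then have "orbit \<alpha> ` V = orbit \<alpha> ` (V - {k})"
    using kV k permutes_in_image[OF \<alpha>(1), of k] by auto
  moreover have "orbit (skip k \<alpha>) ` (V - {k}) = (\<lambda>C. C - {k}) ` orbit \<alpha> ` (V - {k})"
    using orbit_skip[OF \<alpha> k] by (auto simp: image_image intro!: image_cong)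
  moreover have "inj_on (\<lambda>C. C - {k}) (orbit \<alpha> ` (V - {k}))"
  proof (rule inj_onI)
    fix C D assume C: "C \<in> orbit \<alpha> ` (V - {k})" and D: "D \<in> orbit \<alpha> ` (V - {k})" and eq: "C - {k} = D - {k}"
    then obtain x y where xy: "C = orbit \<alpha> x" "D = orbit \<alpha> y" "x \<noteq> k" by auto
    then have "x \<in> C" "x \<in> D" using eq orbit_self[OF \<alpha>] by blast+
    then show "C = D" using xy orbit_disjoint[OF \<alpha>] by metis
  qed
  ultimately show ?thesis by (simp add: cycle_count_def card_image)
qed

lemma cycle_count_fixed:
  assumes \<alpha>: "\<alpha> permutes V" "finite V" and k: "\<alpha> k = k" "k \<in> V"
  shows "cycle_count V \<alpha> = cycle_count (V - {k}) \<alpha> + 1"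
proof -
  have "{k} \<notin> orbit \<alpha> ` (V - {k})" using orbit_self[OF \<alpha>] by force
  moreover have "orbit \<alpha> ` V = insert {k} (orbit \<alpha> ` (V - {k}))"
    using k orbit_eq_singleton_iff[of \<alpha> k] by auto
  ultimately show ?thesis by (simp add: cycle_count_def \<alpha>)
qed

lemma cycle_count_cong:
  assumes "\<alpha> permutes V" "finite V" "\<And>x. x \<in> U \<Longrightarrow> \<alpha> x = \<beta> x" "\<And>x. x \<in> U \<Longrightarrow> \<alpha> x \<in> U"
  shows "cycle_count U \<alpha> = cycle_count U \<beta>"
  unfolding cycle_count_def using assms
  by (intro arg_cong[of _ _ card] image_cong refl orbit_cong0[of _ U]) auto

lemma cycle_count_Un:
  assumes \<alpha>: "\<alpha> permutes (U \<union> W)" "finite (U \<union> W)" and UW: "U \<inter> W = {}" and U: "\<And>x. x \<in> U \<Longrightarrow> \<alpha> x \<in> U"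
  shows "cycle_count (U \<union> W) \<alpha> = cycle_count U \<alpha> + cycle_count W \<alpha>"
proof -
  have sub: "orbit \<alpha> x \<subseteq> U" if "x \<in> U" for x
  proof
    fix y assume "y \<in> orbit \<alpha> x"
    then show "y \<in> U" by induct (auto simp: that U)
  qed
  have "orbit \<alpha> ` U \<inter> orbit \<alpha> ` W = {}"
    using sub UW orbit_self[OF \<alpha>] by blast
  then show ?thesis using \<alpha> by (simp add: cycle_count_def image_Un card_Un_disjoint)
qed

section \<open>Transitive pairs of permutations\<close>

text \<open>For permutations of a finite set, the closed subsets are the unions of orbits of the
  generated group, so this is transitivity of that group on \<open>V\<close>.\<close>

definition transitive_pair :: "'a set \<Rightarrow> ('a \<Rightarrow> 'a) \<Rightarrow> ('a \<Rightarrow> 'a) \<Rightarrow> bool" where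
  "transitive_pair V \<alpha> \<beta> \<longleftrightarrow> (\<forall>U. U \<subseteq> V \<and> U \<noteq> {} \<and> \<alpha> ` U \<subseteq> U \<and> \<beta> ` U \<subseteq> U \<longrightarrow> U = V)"

lemma transitive_pair_sym: "transitive_pair V \<alpha> \<beta> \<longleftrightarrow> transitive_pair V \<beta> \<alpha>"
  by (auto simp: transitive_pair_def)

text \<open>A closed set of the reduced pair lifts to a closed set of the original pair:
  \<open>k\<close> is added exactly when some \<alpha>-arc of the set passes through it.\<close>

lemma transitive_pair_skip:
  assumes \<alpha>: "\<alpha> permutes V" and \<beta>: "\<beta> permutes V" and t: "transitive_pair V \<alpha> \<beta>"
    and k: "k \<in> V" "\<beta> k = k"
  shows "transitive_pair (V - {k}) (skip k \<alpha>) \<beta>"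
  unfolding transitive_pair_def
proof (intro allI impI, rule ccontr)
  fix U assume "U \<subseteq> V - {k} \<and> U \<noteq> {} \<and> skip k \<alpha> ` U \<subseteq> U \<and> \<beta> ` U \<subseteq> U" and neq: "U \<noteq> V - {k}"
  then have U: "U \<subseteq> V - {k}" "skip k \<alpha> ` U \<subseteq> U" "\<beta> ` U \<subseteq> U" and ne: "U \<noteq> {}" by auto
  obtain x where x: "x \<in> V" "x \<notin> U" "x \<noteq> k" using U neq by blast
  have s: "skip k \<alpha> y = (if y = k then k else if \<alpha> y = k then \<alpha> k else \<alpha> y)" for y
    using skip_apply permutes_inj[OF \<alpha>] by metis
  have eq: "W = V" if "W \<subseteq> V" "W \<noteq> {}" "\<alpha> ` W \<subseteq> W" "\<beta> ` W \<subseteq> W" for W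
    using that t by (auto simp: transitive_pair_def)
  show False
  proof (cases "\<exists>u\<in>U. \<alpha> u = k")
    case True
    then obtain u where u: "u \<in> U" "\<alpha> u = k" by auto
    then have ak: "skip k \<alpha> u = \<alpha> k" using U by (auto simp: s)
    have "\<alpha> k \<in> U" using u(1) ak U(2) by force
    moreover have "\<alpha> y \<in> insert k U" if "y \<in> U" for y
    proof -
      have "skip k \<alpha> y \<in> U" using that U by auto
      then show ?thesis using U that by (auto simp: s split: if_splits)
    qed
    ultimately have "\<alpha> ` insert k U \<subseteq> insert k U" by blast
    then have "insert k U = V" using eq[of "insert k U"] U k ne by auto
    then show False using x by auto
  next
    case False
    have "\<alpha> y \<in> U" if "y \<in> U" for y
    proof -
      have "skip k \<alpha> y \<in> U" using that U by auto
      then show ?thesis using U False that by (auto simp: s split: if_splits)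
    qed
    then have "\<alpha> ` U \<subseteq> U" by blast
    then have "U = V" using eq[of U] U ne by auto
    then show False using x by auto
  qed
qed

lemma transitive_pair_not_both_fixed:
  assumes "transitive_pair V \<alpha> \<beta>" "k \<in> V" "\<alpha> k = k" "\<beta> k = k"
  shows "V = {k}"
  using assms unfolding transitive_pair_def
  by (metis empty_not_insert empty_subsetI image_empty image_insert insert_subset order_refl)

text \<open>
  Every closed walk along arcs \<open>k \<rightarrow> \<alpha> k\<close> and \<open>k \<rightarrow> \<beta> k\<close> uses an \<open>\<alpha>\<close>-arc ending in \<open>A\<close> or a \<open>\<beta>\<close>-arc ending in \<open>B\<close>,
  as \<open>r\<close> increases along all other arcs.
\<close>

definition feedback_sets :: "'a set \<Rightarrow> ('a \<Rightarrow> 'a) \<Rightarrow> ('a \<Rightarrow> 'a) \<Rightarrow> 'a set \<Rightarrow> 'a set \<Rightarrow> ('a \<Rightarrow> nat) \<Rightarrow> bool" where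
  "feedback_sets V \<alpha> \<beta> A B r \<longleftrightarrow> A \<subseteq> V \<and> B \<subseteq> V \<and>
     (\<forall>k\<in>V. \<alpha> k \<notin> A \<longrightarrow> r k < r (\<alpha> k)) \<and> (\<forall>k\<in>V. \<beta> k \<notin> B \<longrightarrow> r k < r (\<beta> k))"

lemma feedback_sets_sym: "feedback_sets V \<alpha> \<beta> A B r \<longleftrightarrow> feedback_sets V \<beta> \<alpha> B A r"
  by (auto simp: feedback_sets_def)

text \<open>Every arc goes up or down in the order of the natural numbers. Cutting all descending
  arcs, or all ascending ones, destroys every closed walk, and the two cuts together use the 2 *
  \<open>card V\<close> arcs once each, so one of them uses at most half.\<close>

lemma feedback_sets_loopless:
  fixes \<alpha> \<beta> :: "nat \<Rightarrow> nat"
  assumes \<alpha>: "\<alpha> permutes V" and \<beta>: "\<beta> permutes V" and V: "finite V"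
    and nf: "\<And>k. k \<in> V \<Longrightarrow> \<alpha> k \<noteq> k \<and> \<beta> k \<noteq> k"
  shows "\<exists>A B r. feedback_sets V \<alpha> \<beta> A B r \<and> card A + card B \<le> card V"
proof -
  define Up where "Up f = f ` {k\<in>V. k < f k}" for f :: "nat \<Rightarrow> nat"
  define Dn where "Dn f = f ` {k\<in>V. f k < k}" for f :: "nat \<Rightarrow> nat"
  have card: "card (Up f) + card (Dn f) = card V" if f: "f permutes V" and nf: "\<And>k. k \<in> V \<Longrightarrow> f k \<noteq> k" for f
  proof -
    have inj: "inj f" using f permutes_inj by blast
    have "card (Up f) + card (Dn f) = card {k\<in>V. k < f k} + card {k\<in>V. f k < k}"
      unfolding Up_def Dn_def by (simp add: card_image inj_on_subset[OF inj])
    also have "\<dots> = card ({k\<in>V. k < f k} \<union> {k\<in>V. f k < k})"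
      using V by (subst card_Un_disjoint) auto
    also have "{k\<in>V. k < f k} \<union> {k\<in>V. f k < k} = V"
      using nf by (auto simp: neq_iff)
    finally show ?thesis .
  qed
  have sub: "Up f \<subseteq> V" "Dn f \<subseteq> V" if "f permutes V" for f
    using that by (auto simp: Up_def Dn_def permutes_in_image)
  have c: "card (Up \<alpha>) + card (Dn \<alpha>) = card V" "card (Up \<beta>) + card (Dn \<beta>) = card V"
    using card[OF \<alpha>] card[OF \<beta>] nf by auto
  have dn: "k < f k" if "k \<in> V" "f k \<notin> Dn f" "f k \<noteq> k" for f k
    using that by (force simp: Dn_def image_iff nat_neq_iff)
  \<comment> \<open>Potentials are natural numbers, so the reversed order is expressed by
    subtraction from the maximum.\<close>
  have up: "Max V - k < Max V - f k" if "f permutes V" "k \<in> V" "f k \<notin> Up f" "f k \<noteq> k" for f k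
  proof -
    have "f k < k" using that by (force simp: Up_def image_iff nat_neq_iff)
    moreover have "k \<le> Max V" using that V by simp
    ultimately show ?thesis by linarith
  qed
  have d: "feedback_sets V \<alpha> \<beta> (Dn \<alpha>) (Dn \<beta>) id"
    using sub \<alpha> \<beta> nf dn unfolding feedback_sets_def by simp
  have u: "feedback_sets V \<alpha> \<beta> (Up \<alpha>) (Up \<beta>) (\<lambda>k. Max V - k)"
    using sub[OF \<alpha>] sub[OF \<beta>] up[OF \<alpha>] up[OF \<beta>] nf unfolding feedback_sets_def by simp
  show ?thesis
  proof (cases "card (Up \<alpha>) + card (Up \<beta>) \<le> card V")
    case True then show ?thesis using u by blast
  next
    case False
    then have "card (Dn \<alpha>) + card (Dn \<beta>) \<le> card V" using c by linarith
    then show ?thesis using d by blast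
  qed
qed

text \<open>Reinserting \<open>k\<close> subdivides one \<alpha>-arc and adds the \<beta>-loop at
  \<open>k\<close>. Only the loop needs a new cut.\<close>

lemma feedback_sets_unskip:
  assumes \<alpha>: "\<alpha> permutes V" and \<beta>: "\<beta> permutes V" and V: "finite V"
    and k: "k \<in> V" "\<beta> k = k" "\<alpha> k \<noteq> k"
    and f: "feedback_sets (V - {k}) (skip k \<alpha>) \<beta> A B r"
  shows "\<exists>B' r'. feedback_sets V \<alpha> \<beta> A B' r' \<and> card B' = card B + 1"
proof -
  have inj: "inj \<alpha>" "inj \<beta>" using \<alpha> \<beta> permutes_inj by blast+
  have s: "skip k \<alpha> y = (if y = k then k else if \<alpha> y = k then \<alpha> k else \<alpha> y)" for y
    using skip_apply inj by metis
  define k0 where "k0 = inv \<alpha> k"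
  have \<alpha>k0: "\<alpha> k0 = k" using permutes_inverses[OF \<alpha>] by (simp add: k0_def)
  have k0: "\<alpha> k0 = k" "k0 \<in> V" "k0 \<noteq> k" "skip k \<alpha> k0 = \<alpha> k"
    using k \<alpha>k0 permutes_in_image[OF \<alpha>, of k0] by (auto simp: s)
  define r' where "r' = (\<lambda>x. if x = k then 2 * r k0 + 1 else 2 * r x)"
  have A: "A \<subseteq> V - {k}" "B \<subseteq> V - {k}"
    and fa: "\<And>x. x \<in> V - {k} \<Longrightarrow> skip k \<alpha> x \<notin> A \<Longrightarrow> r x < r (skip k \<alpha> x)"
    and fb: "\<And>x. x \<in> V - {k} \<Longrightarrow> \<beta> x \<notin> B \<Longrightarrow> r x < r (\<beta> x)"
    using f by (auto simp: feedback_sets_def)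
  have "feedback_sets V \<alpha> \<beta> A (insert k B) r'"
    unfolding feedback_sets_def
  proof (intro conjI ballI impI)
    fix x assume x: "x \<in> V" "\<alpha> x \<notin> A"
    show "r' x < r' (\<alpha> x)"
    proof (cases "x = k")
      case True
      then show ?thesis using fa[of k0] k0 x k by (auto simp: r'_def)
    next
      case False
      show ?thesis
      proof (cases "\<alpha> x = k")
        case True
        then have "x = k0" using k0 inj by (metis inj_eq)
        then show ?thesis using k0 by (auto simp: r'_def)
      next
        case False
        then show ?thesis using fa[of x] x \<open>x \<noteq> k\<close> by (auto simp: r'_def s)
      qed
    qed
  next
    fix x assume x: "x \<in> V" "\<beta> x \<notin> insert k B"
    then have "x \<noteq> k" using k by auto
    then show "r' x < r' (\<beta> x)" using fb[of x] x by (auto simp: r'_def)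
  qed (use A k in auto)
  moreover have "card (insert k B) = card B + 1"
    using A V by (subst card_insert_disjoint) (auto intro: finite_subset)
  ultimately show ?thesis by blast
qed

text \<open>Removing a loop lowers both the size of \<open>V\<close> and the number of cuts by one.
  The reduction ends either without loops, where \<open>card V\<close> cuts suffice, or at a single
  point.\<close>

lemma feedback_sets_transitive:
  fixes \<alpha> \<beta> :: "nat \<Rightarrow> nat"
  assumes "\<alpha> permutes V" "\<beta> permutes V" "finite V" "V \<noteq> {}" "transitive_pair V \<alpha> \<beta>"
  shows "\<exists>A B r. feedback_sets V \<alpha> \<beta> A B r \<and> card A + card B \<le> card V + 1"
  using assms
proof (induction "card V" arbitrary: V \<alpha> \<beta> rule: less_induct)
  case less
  note \<alpha> = \<open>\<alpha> permutes V\<close> and \<beta> = \<open>\<beta> permutes V\<close>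
  have fix_case: "\<exists>A B r. feedback_sets V a b A B r \<and> card A + card B \<le> card V + 1"
    if a: "a permutes V" and b: "b permutes V" and t: "transitive_pair V a b"
      and k: "k \<in> V" "b k = k" "card V \<noteq> 1" for a b k
  proof -
    have ak: "a k \<noteq> k" using transitive_pair_not_both_fixed[OF t k(1)] k by auto
    have c: "card (V - {k}) < card V" using k less.prems(3) by (metis card_Diff1_less)
    have bV: "b permutes (V - {k})" using b k by (auto intro: permutes_superset)
    have ne: "V - {k} \<noteq> {}"
    proof
      assume "V - {k} = {}"
      then have "V = {k}" using k by blast
      then show False using k by simp
    qed
    have "\<exists>A B r. feedback_sets (V - {k}) (skip k a) b A B r \<and> card A + card B \<le> card (V - {k}) + 1"
      by (rule less.hyps[OF c permutes_skip[OF a] bV _ ne transitive_pair_skip[OF a b t k(1,2)]])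
        (simp add: less.prems(3))
    then obtain A B r where f: "feedback_sets (V - {k}) (skip k a) b A B r" "card A + card B \<le> card (V - {k}) + 1"
      by (elim exE conjE)
    obtain B' r' where "feedback_sets V a b A B' r'" "card B' = card B + 1"
      using feedback_sets_unskip[OF a b less.prems(3) k(1,2) ak f(1)] by blast
    then show ?thesis using f(2) c by (intro exI[of _ A] exI[of _ B'] exI[of _ r'] conjI) (assumption, linarith)
  qed
  consider "card V = 1" | k where "k \<in> V" "\<beta> k = k" "card V \<noteq> 1" | k where "k \<in> V" "\<alpha> k = k" "card V \<noteq> 1"
    | "\<And>k. k \<in> V \<Longrightarrow> \<alpha> k \<noteq> k \<and> \<beta> k \<noteq> k" by blast
  then show ?case
  proof cases
    case 1
    \<comment> \<open>The single point carries two loops, both of which must be cut: this is the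
      origin of the extra 1.\<close>
    have "feedback_sets V \<alpha> \<beta> V V (\<lambda>_. 0)"
      using \<alpha> \<beta> by (auto simp: feedback_sets_def permutes_in_image)
    then show ?thesis using 1 by (intro exI[of _ V] exI[of _ "\<lambda>_. 0"]) simp
  next
    case (2 k) then show ?thesis by (rule fix_case[OF \<alpha> \<beta> less.prems(5)])
  next
    case (3 k)
    then obtain A B r where "feedback_sets V \<beta> \<alpha> A B r" "card A + card B \<le> card V + 1"
      using fix_case[OF \<beta> \<alpha> _ 3] less.prems(5) transitive_pair_sym[of V \<alpha> \<beta>] by blast
    then show ?thesis using feedback_sets_sym[of V \<beta> \<alpha> A B r]
      by (intro exI[of _ B] exI[of _ A] exI[of _ r]) simp
  next
    case 4
    have "\<exists>A B r. feedback_sets V \<alpha> \<beta> A B r \<and> card A + card B \<le> card V"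
      by (rule feedback_sets_loopless[OF \<alpha> \<beta> less.prems(3)]) (rule 4)
    then obtain A B r where "feedback_sets V \<alpha> \<beta> A B r" "card A + card B \<le> card V"
      by (elim exE conjE)
    then show ?thesis by (intro exI[of _ A] exI[of _ B] exI[of _ r]) simp
  qed
qed

text \<open>The potential cannot increase all the way around a cycle of \<alpha>; the arc leaving a
  point of maximal potential must end in \<open>A\<close>.\<close>

lemma cycle_count_le_feedback:
  assumes \<alpha>: "\<alpha> permutes V" and V: "finite V" and f: "feedback_sets V \<alpha> \<beta> A B r"
  shows "cycle_count V \<alpha> \<le> card A"
proof -
  have "\<exists>a\<in>A. C = orbit \<alpha> a" if C: "C \<in> orbit \<alpha> ` V" for C
  proof -
    obtain x where x: "x \<in> V" "C = orbit \<alpha> x" using C by auto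
    have CV: "C \<subseteq> V" using x permutes_orbit_subset[OF \<alpha>] by auto
    then have "finite (r ` C)" "r ` C \<noteq> {}"
      using V x orbit_nonempty[of \<alpha> x] finite_subset by auto
    then have "Max (r ` C) \<in> r ` C" using Max_in by blast
    then obtain y where y: "y \<in> C" "Max (r ` C) = r y" by auto
    have ay: "\<alpha> y \<in> C" using x y orbit.step by metis
    then have "r (\<alpha> y) \<le> r y" using y \<open>finite (r ` C)\<close> by (metis Max_ge imageI)
    then have "\<alpha> y \<in> A" using f y CV by (force simp: feedback_sets_def)
    then show ?thesis using ay x orbit_eq_iff[OF \<alpha> V] by metis
  qed
  then have "orbit \<alpha> ` V \<subseteq> orbit \<alpha> ` A" by blast
  moreover have "finite A" using f V finite_subset by (auto simp: feedback_sets_def)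
  ultimately show ?thesis unfolding cycle_count_def by (meson card_image_le card_mono finite_imageI le_trans)
qed

text \<open>In graph terms: join a cycle of \<alpha> to a cycle of \<beta> by an edge for every
  common point. By transitivity this graph is connected, so it has at most one more vertex than
  edges.\<close>

lemma cycle_count_transitive_le:
  fixes \<alpha> \<beta> :: "nat \<Rightarrow> nat"
  assumes "\<alpha> permutes V" "\<beta> permutes V" "finite V" "V \<noteq> {}" "transitive_pair V \<alpha> \<beta>"
  shows "cycle_count V \<alpha> + cycle_count V \<beta> \<le> card V + 1"
proof -
  obtain A B r where f: "feedback_sets V \<alpha> \<beta> A B r" and c: "card A + card B \<le> card V + 1"
    using feedback_sets_transitive[OF assms] by blast
  have "cycle_count V \<alpha> \<le> card A" using cycle_count_le_feedback[OF assms(1,3) f] .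
  moreover have "cycle_count V \<beta> \<le> card B"
    using cycle_count_le_feedback[OF assms(2,3)] f feedback_sets_sym by metis
  ultimately show ?thesis using c by linarith
qed

section \<open>Counting index assignments\<close>

text \<open>Used for removing a point: \<open>D'\<close> holds the remaining slots, \<open>C\<close>
  the slots of the removed point that may be filled freely, and \<open>g\<close> names the remaining
  slot that each other removed slot must copy.\<close>

lemma card_extensions:
  assumes fin: "finite D" "finite R" and D: "D' \<subseteq> D" "C \<subseteq> D - D'"
    and F: "F \<subseteq> D \<rightarrow>\<^sub>E R" and G: "G \<subseteq> D' \<rightarrow>\<^sub>E R"
    and g: "\<And>x. x \<in> D - D' - C \<Longrightarrow> g x \<in> D'"
    and restr: "\<And>S. S \<in> F \<Longrightarrow> restrict S D' \<in> G"
    and det: "\<And>S x. S \<in> F \<Longrightarrow> x \<in> D - D' - C \<Longrightarrow> S x = S (g x)"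
    and ext: "\<And>S. S \<in> D \<rightarrow>\<^sub>E R \<Longrightarrow> restrict S D' \<in> G \<Longrightarrow> (\<And>x. x \<in> D - D' - C \<Longrightarrow> S x = S (g x)) \<Longrightarrow> S \<in> F"
  shows "card F = card G * card R ^ card C"
proof -
  let ?f = "\<lambda>S. (restrict S D', restrict S C)"
  have inj: "inj_on ?f F"
  proof (rule inj_onI)
    fix S T assume S: "S \<in> F" and T: "T \<in> F" and eq: "?f S = ?f T"
    have 1: "S x = T x" if "x \<in> D'" for x
      using eq that by (auto dest: fun_cong[of _ _ x])
    have 2: "S x = T x" if "x \<in> C" for x
      using eq that by (auto dest: fun_cong[of _ _ x])
    have "S x = T x" if "x \<in> D" for x
    proof (cases "x \<in> D' \<or> x \<in> C")
      case False
      then show ?thesis using det[OF S, of x] det[OF T, of x] 1[OF g, of x] that by auto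
    qed (use 1 2 in auto)
    then show "S = T" using S T F by (intro PiE_ext[of S D "\<lambda>_. R" T]) auto
  qed
  have "?f ` F = G \<times> (C \<rightarrow>\<^sub>E R)"
  proof (intro equalityI subsetI)
    fix y assume "y \<in> ?f ` F"
    then obtain S where S: "S \<in> F" "y = ?f S" by auto
    have "restrict S C \<in> C \<rightarrow>\<^sub>E R" using S F D by (auto simp: PiE_iff)
    then show "y \<in> G \<times> (C \<rightarrow>\<^sub>E R)" using S restr by auto
  next
    fix y assume "y \<in> G \<times> (C \<rightarrow>\<^sub>E R)"
    then obtain T c where y: "y = (T, c)" and T: "T \<in> G" and c: "c \<in> C \<rightarrow>\<^sub>E R" by auto
    define S where "S = (\<lambda>x\<in>D. if x \<in> D' then T x else if x \<in> C then c x else T (g x))"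
    have TP: "T \<in> D' \<rightarrow>\<^sub>E R" using T G by auto
    have 1: "S x = T x" if "x \<in> D'" for x using that D by (auto simp: S_def)
    have 2: "S x = c x" if "x \<in> C" for x using that D by (auto simp: S_def)
    have rT: "restrict S D' = T" using 1 TP by (auto simp: fun_eq_iff PiE_iff extensional_def)
    have rc: "restrict S C = c" using 2 c by (auto simp: fun_eq_iff PiE_iff extensional_def)
    have "S x \<in> R" if "x \<in> D" for x
      using that TP c g[of x] by (auto simp: S_def PiE_iff)
    then have "S \<in> D \<rightarrow>\<^sub>E R" by (auto simp: PiE_iff S_def)
    moreover have "S x = S (g x)" if "x \<in> D - D' - C" for x
      using 1[OF g[OF that]] that by (simp add: S_def)
    ultimately have "S \<in> F" using T rT by (intro ext) auto
    then show "y \<in> ?f ` F" using y rT rc by (intro image_eqI[of _ _ S]) auto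
  qed
  then have "card F = card (G \<times> (C \<rightarrow>\<^sub>E R))" using card_image[OF inj] by simp
  moreover have "finite C" using fin D by (meson finite_Diff finite_subset)
  ultimately show ?thesis by (simp add: card_cartesian_product card_PiE)
qed

text \<open>
  \<open>S (k, s)\<close> is the index in slot \<open>s\<close> of the conjugated tensor entry of the \<open>k\<close>-th factor; \<open>e k i\<close> is the slot holding
  the \<open>i\<close>-th index of the marginal. The remaining slots are traced out inside factor \<open>k\<close>, so that
  \<open>solutions\<close> below expresses that the unconjugated entry of factor \<open>\<alpha> k\<close>
  is paired with the conjugated entry of factor \<open>k\<close>.
\<close>

locale slot_labels =
  fixes low J :: "nat set" and m N :: nat and e :: "nat \<Rightarrow> nat \<Rightarrow> nat"
  assumes fin_J: "finite J" and card_J: "card J = 2 * m" and card_low: "card low = m" and m_pos: "0 < m"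
    and inj_e: "\<And>k. inj_on (e k) low" and e_J: "\<And>k. e k ` low \<subseteq> J" and N_pos: "0 < N"
begin

definition solutions :: "nat set \<Rightarrow> (nat \<Rightarrow> nat) \<Rightarrow> (nat \<Rightarrow> nat) \<Rightarrow> (nat \<times> nat \<Rightarrow> nat) set" where
  "solutions V \<alpha> \<beta> = {S \<in> V \<times> J \<rightarrow>\<^sub>E {1..N}. \<forall>k\<in>V.
     (\<forall>s\<in>J - e (\<alpha> k) ` low. S (k, s) = S (\<alpha> k, s)) \<and>
     (\<forall>i\<in>low. S (k, e (\<alpha> k) i) = S (\<beta> k, e (\<beta> k) i))}"

lemma solutionsI:
  assumes "S \<in> V \<times> J \<rightarrow>\<^sub>E {1..N}"
    and "\<And>k s. k \<in> V \<Longrightarrow> s \<in> J \<Longrightarrow> s \<notin> e (\<alpha> k) ` low \<Longrightarrow> S (k, s) = S (\<alpha> k, s)"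
    and "\<And>k i. k \<in> V \<Longrightarrow> i \<in> low \<Longrightarrow> S (k, e (\<alpha> k) i) = S (\<beta> k, e (\<beta> k) i)"
  shows "S \<in> solutions V \<alpha> \<beta>"
  unfolding solutions_def using assms by blast

lemma solutionsD:
  assumes "S \<in> solutions V \<alpha> \<beta>"
  shows "S \<in> V \<times> J \<rightarrow>\<^sub>E {1..N}"
    and "k \<in> V \<Longrightarrow> s \<in> J \<Longrightarrow> s \<notin> e (\<alpha> k) ` low \<Longrightarrow> S (k, s) = S (\<alpha> k, s)"
    and "k \<in> V \<Longrightarrow> i \<in> low \<Longrightarrow> S (k, e (\<alpha> k) i) = S (\<beta> k, e (\<beta> k) i)"
proof -
  show "S \<in> V \<times> J \<rightarrow>\<^sub>E {1..N}" using assms unfolding solutions_def by (drule_tac CollectD) (erule conjunct1)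
  have *: "\<forall>k\<in>V. (\<forall>s\<in>J - e (\<alpha> k) ` low. S (k, s) = S (\<alpha> k, s)) \<and>
     (\<forall>i\<in>low. S (k, e (\<alpha> k) i) = S (\<beta> k, e (\<beta> k) i))"
    using assms unfolding solutions_def by (drule_tac CollectD) (erule conjunct2)
  show "S (k, s) = S (\<alpha> k, s)" if "k \<in> V" "s \<in> J" "s \<notin> e (\<alpha> k) ` low"
    by (rule bspec[OF conjunct1[OF bspec[OF * that(1)]]]) (use that in blast)
  show "S (k, e (\<alpha> k) i) = S (\<beta> k, e (\<beta> k) i)" if "k \<in> V" "i \<in> low"
    by (rule bspec[OF conjunct2[OF bspec[OF * that(1)]] that(2)])
qed

lemma card_e: "card (e k ` low) = m"
  using card_image[OF inj_e] card_low by simp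

lemma finite_e: "finite (e k ` low)"
  by (rule finite_subset[OF e_J fin_J])

lemma card_J_minus: "card (J - e k ` low) = m"
  using card_Diff_subset[OF finite_e e_J] card_e card_J by simp

section \<open>Upper bounds from feedback sets\<close>

text \<open>By induction along the potential: the traced slots of a point are copied from its
  \<alpha>-predecessor and the other slots from its \<beta>-predecessor, unless the arc is cut. In
  hypothesis \<open>B\<close> agreement on the traced slots of the same point is available, as
  needed where a loop joins different labels.\<close>

lemma solutions_agree:
  assumes \<alpha>: "\<alpha> permutes V" and \<beta>: "\<beta> permutes V" and f: "feedback_sets V \<alpha> \<beta> A B r"
    and S: "S \<in> solutions V \<alpha> \<beta>" and S': "S' \<in> solutions V \<alpha> \<beta>"
    and A: "\<And>k s. k \<in> A \<Longrightarrow> s \<in> J - e k ` low \<Longrightarrow> S (k, s) = S' (k, s)"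
    and B: "\<And>k s. k \<in> B \<Longrightarrow> s \<in> e k ` low \<Longrightarrow> (\<And>s. s \<in> J - e k ` low \<Longrightarrow> S (k, s) = S' (k, s)) \<Longrightarrow>
       S (k, s) = S' (k, s)"
  shows "S = S'"
proof -
  have sol: "S (k, s) = S (\<alpha> k, s)" "S' (k, s) = S' (\<alpha> k, s)" if "k \<in> V" "s \<in> J - e (\<alpha> k) ` low" for k s
    using solutionsD(2)[OF S] solutionsD(2)[OF S'] that by blast+
  have sol': "S (k, e (\<alpha> k) i) = S (\<beta> k, e (\<beta> k) i)" "S' (k, e (\<alpha> k) i) = S' (\<beta> k, e (\<beta> k) i)"
    if "k \<in> V" "i \<in> low" for k i
    using solutionsD(3)[OF S] solutionsD(3)[OF S'] that by blast+
  have agree: "\<forall>s\<in>J. S (k, s) = S' (k, s)" if "k \<in> V" for k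
    using that
  proof (induction "r k" arbitrary: k rule: less_induct)
    case less
    have high: "S (k, s) = S' (k, s)" if s: "s \<in> J - e k ` low" for s
    proof (cases "k \<in> A")
      case True
      then show ?thesis using s by (rule A)
    next
      case False
      define j where "j = inv \<alpha> k"
      have j: "\<alpha> j = k" "j \<in> V"
        using permutes_inverses[OF \<alpha>] less.prems permutes_in_image[OF \<alpha>, of j] by (auto simp: j_def)
      then have "r j < r k" using f False by (force simp: feedback_sets_def)
      then have "S (j, s) = S' (j, s)" using bspec[OF less.hyps[OF _ j(2)], of s] s by blast
      then show ?thesis using sol[of j s] j s by simp
    qed
    have low: "S (k, s) = S' (k, s)" if s: "s \<in> e k ` low" for s
    proof (cases "k \<in> B")
      case True
      then show ?thesis using s high by (rule B)
    next
      case False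
      obtain i where i: "i \<in> low" "s = e k i" using s by auto
      define j where "j = inv \<beta> k"
      have j: "\<beta> j = k" "j \<in> V"
        using permutes_inverses[OF \<beta>] less.prems permutes_in_image[OF \<beta>, of j] by (auto simp: j_def)
      then have "r j < r k" using f False by (force simp: feedback_sets_def)
      moreover have "e (\<alpha> j) i \<in> J" using e_J i by blast
      ultimately have "S (j, e (\<alpha> j) i) = S' (j, e (\<alpha> j) i)" using bspec[OF less.hyps[OF _ j(2)]] by blast
      then show ?thesis using sol'[of j i] j i by simp
    qed
    show ?case using high low by blast
  qed
  show ?thesis
    by (rule PiE_ext[OF solutionsD(1)[OF S] solutionsD(1)[OF S']]) (use agree in auto)
qed

lemma card_solutions_le_inj:
  assumes "finite P" "P \<subseteq> V \<times> J" "inj_on (\<lambda>S. restrict S P) (solutions V \<alpha> \<beta>)"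
  shows "card (solutions V \<alpha> \<beta>) \<le> N ^ card P"
proof -
  have "(\<lambda>S. restrict S P) ` solutions V \<alpha> \<beta> \<subseteq> P \<rightarrow>\<^sub>E {1..N}"
    using assms(2) solutionsD(1) by (fastforce simp: PiE_iff)
  then have "card (solutions V \<alpha> \<beta>) \<le> card (P \<rightarrow>\<^sub>E {1..N})"
    by (rule card_inj_on_le[OF assms(3)]) (use assms(1) in \<open>simp add: finite_PiE\<close>)
  then show ?thesis using assms by (simp add: card_PiE)
qed

text \<open>A cut \<alpha>-arc leaves the m traced slots of its end undetermined, a cut \<beta>-arc
  the m slots of the marginal; each cut therefore costs m free indices.\<close>

definition determining_slots :: "nat set \<Rightarrow> nat set \<Rightarrow> (nat \<times> nat) set" where
  "determining_slots A B = (SIGMA k:A. J - e k ` low) \<union> (SIGMA k:B. e k ` low)"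

lemma determining_slots:
  assumes "finite V" "feedback_sets V \<alpha> \<beta> A B r"
  shows "finite (determining_slots A B)" "determining_slots A B \<subseteq> V \<times> J"
    and "card (determining_slots A B) = m * (card A + card B)"
proof -
  have AB: "A \<subseteq> V" "B \<subseteq> V" "finite A" "finite B"
    using assms finite_subset by (auto simp: feedback_sets_def)
  show "finite (determining_slots A B)" "determining_slots A B \<subseteq> V \<times> J"
    using AB fin_J finite_e e_J unfolding determining_slots_def by blast+
  have "card (determining_slots A B) = card (SIGMA k:A. J - e k ` low) + card (SIGMA k:B. e k ` low)"
    unfolding determining_slots_def using AB fin_J finite_e by (intro card_Un_disjoint) auto
  also have "\<dots> = m * (card A + card B)"
    using AB fin_J finite_e by (simp add: card_SigmaI card_e card_J_minus algebra_simps)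
  finally show "card (determining_slots A B) = m * (card A + card B)" .
qed

lemma card_solutions_le:
  assumes \<alpha>: "\<alpha> permutes V" and \<beta>: "\<beta> permutes V" and V: "finite V" and f: "feedback_sets V \<alpha> \<beta> A B r"
  shows "card (solutions V \<alpha> \<beta>) \<le> N ^ (m * (card A + card B))"
proof -
  note P = determining_slots[OF V f]
  have "inj_on (\<lambda>S. restrict S (determining_slots A B)) (solutions V \<alpha> \<beta>)"
  proof (rule inj_onI)
    fix S S' assume S: "S \<in> solutions V \<alpha> \<beta>" "S' \<in> solutions V \<alpha> \<beta>"
      and eq: "restrict S (determining_slots A B) = restrict S' (determining_slots A B)"
    have "S x = S' x" if "x \<in> determining_slots A B" for x
      using fun_cong[OF eq, of x] that by simp
    then show "S = S'"
      by (intro solutions_agree[OF \<alpha> \<beta> f S]) (auto simp: determining_slots_def)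
  qed
  then show ?thesis using card_solutions_le_inj[OF P(1,2)] P(3) by simp
qed

text \<open>
  At a loop between different labels, one of the free indices of the loop is forced to agree with another slot.
\<close>

lemma card_solutions_unbalanced_le:
  assumes \<alpha>: "\<alpha> permutes V" and \<beta>: "\<beta> permutes V" and V: "finite V" and f: "feedback_sets V \<alpha> \<beta> A B r"
    and k: "k \<in> V" "\<beta> k = k" and i: "i \<in> low" "e (\<alpha> k) i \<noteq> e k i"
  shows "card (solutions V \<alpha> \<beta>) \<le> N ^ (m * (card A + card B) - 1)"
proof -
  note P = determining_slots[OF V f]
  let ?P = "determining_slots A B - {(k, e k i)}"
  \<comment> \<open>The potential cannot increase along the loop of \<beta> at \<open>k\<close>, so
    the loop has been cut.\<close>
  have kB: "k \<in> B" using f k by (force simp: feedback_sets_def)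
  then have mem: "(k, e k i) \<in> determining_slots A B" using i by (auto simp: determining_slots_def)
  have "inj_on (\<lambda>S. restrict S ?P) (solutions V \<alpha> \<beta>)"
  proof (rule inj_onI)
    fix S S' assume S: "S \<in> solutions V \<alpha> \<beta>" "S' \<in> solutions V \<alpha> \<beta>"
      and eq: "restrict S ?P = restrict S' ?P"
    have P: "S x = S' x" if "x \<in> ?P" for x
      using fun_cong[OF eq, of x] that by simp
    have loop: "S (k, e (\<alpha> k) i) = S (k, e k i)" "S' (k, e (\<alpha> k) i) = S' (k, e k i)"
      using solutionsD(3)[OF S(1) k(1) i(1)] solutionsD(3)[OF S(2) k(1) i(1)] k(2) by simp_all
    have J: "e (\<alpha> k) i \<in> J" using e_J i by blast
    show "S = S'"
    proof (rule solutions_agree[OF \<alpha> \<beta> f S])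
      show "S (j, s) = S' (j, s)" if "j \<in> A" "s \<in> J - e j ` low" for j s
        using that i by (intro P) (auto simp: determining_slots_def)
    next
      fix j s assume j: "j \<in> B" "s \<in> e j ` low" and high: "\<And>s. s \<in> J - e j ` low \<Longrightarrow> S (j, s) = S' (j, s)"
      show "S (j, s) = S' (j, s)"
      proof (cases "(j, s) = (k, e k i)")
        case False
        then show ?thesis using j by (intro P) (auto simp: determining_slots_def)
      next
        case True
        \<comment> \<open>The slot compared with the omitted one is either another marginal slot of
          \<open>k\<close>, which is still among the determining ones, or a traced slot of
          \<open>k\<close>, where agreement is already known.\<close>
        have "S (k, e (\<alpha> k) i) = S' (k, e (\<alpha> k) i)"
        proof (cases "e (\<alpha> k) i \<in> e k ` low")
          case True
          then show ?thesis using kB i by (intro P) (auto simp: determining_slots_def)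
        next
          case False
          then show ?thesis using high[of "e (\<alpha> k) i"] True J by simp
        qed
        then show ?thesis using loop True by simp
      qed
    qed
  qed
  moreover have "finite ?P" "?P \<subseteq> V \<times> J" using P by auto
  ultimately show ?thesis using card_solutions_le_inj[of ?P V \<alpha> \<beta>] P mem by simp
qed

section \<open>Removing a loop from the index equations\<close>

text \<open>Since \<alpha> fixes \<open>k\<close>, the equations for its m traced slots are trivial
  and these slots are free. Its marginal slots copy those of \<beta> \<open>k\<close>, so
  substituting them redirects the \<beta>-arc into \<open>k\<close> to \<beta>
  \<open>k\<close>.\<close>

lemma card_solutions_skip_fixed1:
  assumes \<alpha>: "\<alpha> permutes V" and \<beta>: "\<beta> permutes V" and V: "finite V"
    and k: "k \<in> V" "\<alpha> k = k" "\<beta> k \<noteq> k"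
  shows "card (solutions V \<alpha> \<beta>) = card (solutions (V - {k}) \<alpha> (skip k \<beta>)) * N ^ m"
proof -
  have s: "skip k \<beta> x = (if x = k then k else if \<beta> x = k then \<beta> k else \<beta> x)" for x
    using skip_apply permutes_inj[OF \<beta>] by metis
  have \<alpha>V: "\<alpha> j \<in> V" "\<beta> j \<in> V" if "j \<in> V" for j using \<alpha> \<beta> that by (auto simp: permutes_in_image)
  have \<alpha>k: "\<alpha> j \<noteq> k" if "j \<noteq> k" for j using permutes_inj[OF \<alpha>] k that by (metis injD)
  have sV: "skip k \<beta> j \<in> V - {k}" if "j \<in> V" "j \<noteq> k" for j
    using that k \<alpha>V by (auto simp: s)
  have inv: "inv_into low (e k) (e k i) = i" if "i \<in> low" for i
    using that inj_e by simp
  have eJ: "e j i \<in> J" if "i \<in> low" for i j using e_J that by blast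
  let ?C = "{k} \<times> (J - e k ` low)" and ?D' = "(V - {k}) \<times> J"
  let ?g = "\<lambda>(j, s). (\<beta> k, e (\<beta> k) (inv_into low (e k) s))"
  have rest: "\<exists>i\<in>low. x = (k, e k i)" if "x \<in> V \<times> J - ?D' - ?C" for x
    using that by (cases x) auto
  have "card (solutions V \<alpha> \<beta>) = card (solutions (V - {k}) \<alpha> (skip k \<beta>)) * card {1..N} ^ card ?C"
  proof (rule card_extensions[of "V \<times> J" "{1..N}" ?D' ?C _ _ ?g])
    show "finite (V \<times> J)" "finite {1..N}" "?D' \<subseteq> V \<times> J" "?C \<subseteq> V \<times> J - ?D'"
      using V fin_J k by auto
    show "solutions V \<alpha> \<beta> \<subseteq> V \<times> J \<rightarrow>\<^sub>E {1..N}"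
      "solutions (V - {k}) \<alpha> (skip k \<beta>) \<subseteq> ?D' \<rightarrow>\<^sub>E {1..N}" by (auto simp: solutions_def)
    show "?g x \<in> ?D'" if "x \<in> V \<times> J - ?D' - ?C" for x
      using rest[OF that] inv eJ k \<alpha>V by auto
  next
    fix S assume S: "S \<in> solutions V \<alpha> \<beta>"
    note S1 = solutionsD(1)[OF S] and S2 = solutionsD(2)[OF S] and S3 = solutionsD(3)[OF S]
    show "restrict S ?D' \<in> solutions (V - {k}) \<alpha> (skip k \<beta>)"
    proof (rule solutionsI)
      show "restrict S ?D' \<in> ?D' \<rightarrow>\<^sub>E {1..N}" using S1 by (auto simp: PiE_iff)
      show "restrict S ?D' (j, t) = restrict S ?D' (\<alpha> j, t)"
        if "j \<in> V - {k}" "t \<in> J" "t \<notin> e (\<alpha> j) ` low" for j t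
        using S2[of j t] that \<alpha>V \<alpha>k by simp
      fix j i assume j: "j \<in> V - {k}" and i: "i \<in> low"
      have "S (j, e (\<alpha> j) i) = S (skip k \<beta> j, e (skip k \<beta> j) i)"
        using S3[OF _ i, of j] S3[OF k(1) i] j k by (simp add: s)
      then show "restrict S ?D' (j, e (\<alpha> j) i) = restrict S ?D' (skip k \<beta> j, e (skip k \<beta> j) i)"
        using sV[of j] eJ[OF i] j by simp
    qed
    show "S x = S (?g x)" if "x \<in> V \<times> J - ?D' - ?C" for x
      using rest[OF that] inv S3[OF k(1)] k by auto
  next
    fix S assume S: "S \<in> V \<times> J \<rightarrow>\<^sub>E {1..N}" and r: "restrict S ?D' \<in> solutions (V - {k}) \<alpha> (skip k \<beta>)"
      and g: "\<And>x. x \<in> V \<times> J - ?D' - ?C \<Longrightarrow> S x = S (?g x)"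
    have gk: "S (k, e k i) = S (\<beta> k, e (\<beta> k) i)" if "i \<in> low" for i
      using g[of "(k, e k i)"] that inv eJ k by auto
    show "S \<in> solutions V \<alpha> \<beta>"
    proof (rule solutionsI[OF S])
      show "S (j, t) = S (\<alpha> j, t)" if "j \<in> V" "t \<in> J" "t \<notin> e (\<alpha> j) ` low" for j t
      proof (cases "j = k")
        case False
        then show ?thesis using solutionsD(2)[OF r, of j t] that \<alpha>V \<alpha>k by simp
      qed (use k in simp)
      fix j i assume j: "j \<in> V" and i: "i \<in> low"
      show "S (j, e (\<alpha> j) i) = S (\<beta> j, e (\<beta> j) i)"
      proof (cases "j = k")
        case False
        have "S (j, e (\<alpha> j) i) = S (skip k \<beta> j, e (skip k \<beta> j) i)"
          using solutionsD(3)[OF r _ i, of j] j False sV[of j] eJ[OF i] by simp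
        then show ?thesis using gk[OF i] False by (auto simp: s split: if_splits)
      qed (use gk i k in simp)
    qed
  qed
  then show ?thesis by (simp add: card_cartesian_product card_J_minus)
qed

text \<open>Here the marginal slots are free: the equation at \<open>k\<close> compares a slot with
  itself because the labels of \<open>k\<close> and \<alpha> \<open>k\<close> agree. The traced
  slots copy those of \<alpha> \<open>k\<close>, and by the same agreement the \<alpha>-arc into
  \<open>k\<close> can be redirected.\<close>

lemma card_solutions_skip_fixed2:
  assumes \<alpha>: "\<alpha> permutes V" and \<beta>: "\<beta> permutes V" and V: "finite V"
    and k: "k \<in> V" "\<alpha> k \<noteq> k" "\<beta> k = k" and eq: "\<And>i. i \<in> low \<Longrightarrow> e (\<alpha> k) i = e k i"
  shows "card (solutions V \<alpha> \<beta>) = card (solutions (V - {k}) (skip k \<alpha>) \<beta>) * N ^ m"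
proof -
  have s: "skip k \<alpha> x = (if x = k then k else if \<alpha> x = k then \<alpha> k else \<alpha> x)" for x
    using skip_apply permutes_inj[OF \<alpha>] by metis
  have \<alpha>V: "\<alpha> j \<in> V" "\<beta> j \<in> V" if "j \<in> V" for j using \<alpha> \<beta> that by (auto simp: permutes_in_image)
  have \<beta>k: "\<beta> j \<noteq> k" if "j \<noteq> k" for j using permutes_inj[OF \<beta>] k that by (metis injD)
  have sV: "skip k \<alpha> j \<in> V - {k}" if "j \<in> V" "j \<noteq> k" for j
    using that k \<alpha>V by (auto simp: s)
  have eJ: "e j i \<in> J" if "i \<in> low" for i j using e_J that by blast
  have im: "e (\<alpha> k) ` low = e k ` low" using eq by auto
  let ?C = "{k} \<times> e k ` low" and ?D' = "(V - {k}) \<times> J"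
  let ?g = "\<lambda>(j, s). (\<alpha> k, s)"
  have "card (solutions V \<alpha> \<beta>) = card (solutions (V - {k}) (skip k \<alpha>) \<beta>) * card {1..N} ^ card ?C"
  proof (rule card_extensions[of "V \<times> J" "{1..N}" ?D' ?C _ _ ?g])
    show "finite (V \<times> J)" "finite {1..N}" "?D' \<subseteq> V \<times> J" "?C \<subseteq> V \<times> J - ?D'"
      using V fin_J k eJ by auto
    show "solutions V \<alpha> \<beta> \<subseteq> V \<times> J \<rightarrow>\<^sub>E {1..N}"
      "solutions (V - {k}) (skip k \<alpha>) \<beta> \<subseteq> ?D' \<rightarrow>\<^sub>E {1..N}" by (auto simp: solutions_def)
    show "?g x \<in> ?D'" if "x \<in> V \<times> J - ?D' - ?C" for x
      using that k \<alpha>V by auto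
  next
    fix S assume S: "S \<in> solutions V \<alpha> \<beta>"
    note S1 = solutionsD(1)[OF S] and S2 = solutionsD(2)[OF S] and S3 = solutionsD(3)[OF S]
    show "restrict S ?D' \<in> solutions (V - {k}) (skip k \<alpha>) \<beta>"
    proof (rule solutionsI)
      show "restrict S ?D' \<in> ?D' \<rightarrow>\<^sub>E {1..N}" using S1 by (auto simp: PiE_iff)
      fix j t assume j: "j \<in> V - {k}" and t: "t \<in> J" "t \<notin> e (skip k \<alpha> j) ` low"
      have "S (j, t) = S (skip k \<alpha> j, t)"
      proof (cases "\<alpha> j = k")
        case True
        then show ?thesis using S2[of j t] S2[of k t] j t k im by (simp add: s)
      next
        case False
        then show ?thesis using S2[of j t] j t by (simp add: s)
      qed
      then show "restrict S ?D' (j, t) = restrict S ?D' (skip k \<alpha> j, t)"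
        using sV[of j] j t by simp
    next
      fix j i assume j: "j \<in> V - {k}" and i: "i \<in> low"
      have "S (j, e (skip k \<alpha> j) i) = S (\<beta> j, e (\<beta> j) i)"
        using S3[OF _ i, of j] eq[OF i] j k by (auto simp: s)
      then show "restrict S ?D' (j, e (skip k \<alpha> j) i) = restrict S ?D' (\<beta> j, e (\<beta> j) i)"
        using \<alpha>V \<beta>k eJ[OF i] j by simp
    qed
    show "S x = S (?g x)" if "x \<in> V \<times> J - ?D' - ?C" for x
      using that S2[OF k(1)] im by auto
  next
    fix S assume S: "S \<in> V \<times> J \<rightarrow>\<^sub>E {1..N}" and r: "restrict S ?D' \<in> solutions (V - {k}) (skip k \<alpha>) \<beta>"
      and g: "\<And>x. x \<in> V \<times> J - ?D' - ?C \<Longrightarrow> S x = S (?g x)"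
    have gk: "S (k, t) = S (\<alpha> k, t)" if "t \<in> J" "t \<notin> e k ` low" for t
      using g[of "(k, t)"] that k by auto
    show "S \<in> solutions V \<alpha> \<beta>"
    proof (rule solutionsI[OF S])
      fix j t assume j: "j \<in> V" and t: "t \<in> J" "t \<notin> e (\<alpha> j) ` low"
      show "S (j, t) = S (\<alpha> j, t)"
      proof (cases "j = k")
        case True
        then show ?thesis using gk t im by simp
      next
        case False
        have "t \<notin> e (skip k \<alpha> j) ` low" using t im False by (cases "\<alpha> j = k") (simp_all add: s)
        then have "S (j, t) = S (skip k \<alpha> j, t)"
          using solutionsD(2)[OF r, of j t] j False sV[of j] t by simp
        then show ?thesis using gk[of t] t False by (auto simp: s split: if_splits)
      qed
    next
      fix j i assume j: "j \<in> V" and i: "i \<in> low"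
      show "S (j, e (\<alpha> j) i) = S (\<beta> j, e (\<beta> j) i)"
      proof (cases "j = k")
        case False
        then have "S (j, e (skip k \<alpha> j) i) = S (\<beta> j, e (\<beta> j) i)"
          using solutionsD(3)[OF r _ i, of j] j eJ[OF i] \<alpha>V \<beta>k by simp
        then show ?thesis using eq[OF i] False by (auto simp: s split: if_splits)
      qed (use eq i k in simp)
    qed
  qed
  then show ?thesis by (simp add: card_cartesian_product card_e)
qed

text \<open>A removable loop contributes exactly the factor \<open>N ^ m\<close>. The two ways in
  which the reduction can fail, a \<beta>-loop joining different labels and a nontrivial pair
  without loops, each lose at least one power of \<open>N\<close>; in both cases the condition for
  equality is violated.\<close>

theorem card_solutions:
  fixes \<alpha> \<beta> :: "nat \<Rightarrow> nat"
  assumes "\<alpha> permutes V" "\<beta> permutes V" "finite V" "V \<noteq> {}" "transitive_pair V \<alpha> \<beta>"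
  shows "if cycle_count V \<alpha> + cycle_count V \<beta> = card V + 1 \<and> (\<forall>k\<in>V. \<forall>i\<in>low. e (\<alpha> k) i = e k i)
    then card (solutions V \<alpha> \<beta>) = N ^ (m * (card V + 1))
    else card (solutions V \<alpha> \<beta>) \<le> N ^ (m * (card V + 1) - 1)"
  using assms
proof (induction "card V" arbitrary: V \<alpha> \<beta> rule: less_induct)
  case less
  note \<alpha> = \<open>\<alpha> permutes V\<close> and \<beta> = \<open>\<beta> permutes V\<close> and V = \<open>finite V\<close> and t = \<open>transitive_pair V \<alpha> \<beta>\<close>
  let ?bal = "\<lambda>V \<alpha>. \<forall>k\<in>V. \<forall>i\<in>low. e (\<alpha> k) i = e k i"
  have step: ?case
    if c: "card (solutions V \<alpha> \<beta>) = card (solutions (V - {k}) \<alpha>' \<beta>') * N ^ m"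
      and k: "k \<in> V" "card V \<noteq> 1"
      and p: "\<alpha>' permutes (V - {k})" "\<beta>' permutes (V - {k})" and t': "transitive_pair (V - {k}) \<alpha>' \<beta>'"
      and cc: "cycle_count V \<alpha> + cycle_count V \<beta> = cycle_count (V - {k}) \<alpha>' + cycle_count (V - {k}) \<beta>' + 1"
      and bal: "?bal V \<alpha> \<longleftrightarrow> ?bal (V - {k}) \<alpha>'"
    for k \<alpha>' \<beta>'
  proof -
    have cV: "card V = card (V - {k}) + 1" using k V by (metis Suc_eq_plus1 card_Suc_Diff1)
    then have ne: "V - {k} \<noteq> {}" using k by (metis One_nat_def add_0 card.empty)
    have ih: "if cycle_count (V - {k}) \<alpha>' + cycle_count (V - {k}) \<beta>' = card (V - {k}) + 1 \<and> ?bal (V - {k}) \<alpha>'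
      then card (solutions (V - {k}) \<alpha>' \<beta>') = N ^ (m * (card (V - {k}) + 1))
      else card (solutions (V - {k}) \<alpha>' \<beta>') \<le> N ^ (m * (card (V - {k}) + 1) - 1)"
      by (rule less.hyps[OF _ p _ ne t']) (use cV V in simp_all)
    have e1: "N ^ (m * (card (V - {k}) + 1)) * N ^ m = N ^ (m * (card V + 1))"
      unfolding cV by (simp add: power_add[symmetric] algebra_simps)
    \<comment> \<open>Positivity of \<open>m\<close> keeps the truncated subtraction exact.\<close>
    have e2: "N ^ (m * (card (V - {k}) + 1) - 1) * N ^ m = N ^ (m * (card V + 1) - 1)"
      unfolding cV power_add[symmetric] using m_pos by (simp add: algebra_simps)
    show ?thesis
    proof (cases "cycle_count V \<alpha> + cycle_count V \<beta> = card V + 1 \<and> ?bal V \<alpha>")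
      case True
      then have "card (solutions (V - {k}) \<alpha>' \<beta>') = N ^ (m * (card (V - {k}) + 1))"
        using ih cc cV bal by simp
      then show ?thesis using True c e1 by simp
    next
      case False
      then have "card (solutions (V - {k}) \<alpha>' \<beta>') \<le> N ^ (m * (card (V - {k}) + 1) - 1)"
        using ih cc cV bal by (metis add_right_cancel)
      then have "card (solutions V \<alpha> \<beta>) \<le> N ^ (m * (card V + 1) - 1)"
        unfolding c e2[symmetric] by (rule mult_right_mono) simp
      then show ?thesis by (simp only: if_not_P[OF False])
    qed
  qed
  consider (one) "card V = 1" | (fix1) k where "k \<in> V" "\<alpha> k = k" "card V \<noteq> 1"
    | (fix2) k where "k \<in> V" "\<beta> k = k" "card V \<noteq> 1"
    | (loopless) "\<And>k. k \<in> V \<Longrightarrow> \<alpha> k \<noteq> k \<and> \<beta> k \<noteq> k" by blast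
  then show ?case
  proof cases
    case one
    then obtain k where k: "V = {k}" by (metis card_1_singletonE)
    have id: "\<alpha> = id" "\<beta> = id" using \<alpha> \<beta> by (simp_all add: k permutes_sing)
    have cc: "cycle_count V id = 1" by (simp add: cycle_count_def k)
    \<comment> \<open>A single point imposes no equations, and its 2 * \<open>m\<close> slots are
      what the formula predicts for \<open>card V\<close> = 1.\<close>
    have "solutions V id id = V \<times> J \<rightarrow>\<^sub>E {1..N}" by (simp add: solutions_def)
    then have "card (solutions V id id) = N ^ (m * (card V + 1))"
      using fin_J by (simp add: k card_PiE card_cartesian_product card_J mult_2 mult_2_right)
    then show ?thesis using cc one by (simp add: id)
  next
    case (fix1 k)
    have \<beta>k: "\<beta> k \<noteq> k" using transitive_pair_not_both_fixed[OF t fix1(1,2)] fix1 by auto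
    have t': "transitive_pair (V - {k}) \<alpha> (skip k \<beta>)"
      using transitive_pair_skip[OF \<beta> \<alpha> _ fix1(1,2)] t transitive_pair_sym by metis
    show ?thesis
    proof (rule step[OF card_solutions_skip_fixed1[OF \<alpha> \<beta> V fix1(1,2) \<beta>k] fix1(1,3) _ permutes_skip[OF \<beta>] t'])
      show "\<alpha> permutes V - {k}" using \<alpha> fix1 by (auto intro: permutes_superset)
      show "cycle_count V \<alpha> + cycle_count V \<beta> = cycle_count (V - {k}) \<alpha> + cycle_count (V - {k}) (skip k \<beta>) + 1"
        using cycle_count_fixed[OF \<alpha> V fix1(2,1)] cycle_count_skip[OF \<beta> V \<beta>k] by simp
      show "?bal V \<alpha> \<longleftrightarrow> ?bal (V - {k}) \<alpha>" using fix1 by (metis Diff_iff singletonD)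
    qed
  next
    case (fix2 k)
    have \<alpha>k: "\<alpha> k \<noteq> k" using transitive_pair_not_both_fixed[OF t fix2(1)] fix2 by auto
    have s: "skip k \<alpha> x = (if x = k then k else if \<alpha> x = k then \<alpha> k else \<alpha> x)" for x
      using skip_apply permutes_inj[OF \<alpha>] by metis
    show ?thesis
    proof (cases "\<forall>i\<in>low. e (\<alpha> k) i = e k i")
      case True
      show ?thesis
      proof (rule step[OF card_solutions_skip_fixed2[OF \<alpha> \<beta> V fix2(1) \<alpha>k fix2(2)] fix2(1,3) permutes_skip[OF \<alpha>] _
            transitive_pair_skip[OF \<alpha> \<beta> t fix2(1,2)]])
        show "e (\<alpha> k) i = e k i" if "i \<in> low" for i using True that by blast
        show "\<beta> permutes V - {k}" using \<beta> fix2 by (auto intro: permutes_superset)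
        show "cycle_count V \<alpha> + cycle_count V \<beta> = cycle_count (V - {k}) (skip k \<alpha>) + cycle_count (V - {k}) \<beta> + 1"
          using cycle_count_fixed[OF \<beta> V fix2(2,1)] cycle_count_skip[OF \<alpha> V \<alpha>k] by simp
        \<comment> \<open>Redirecting an arc from \<open>k\<close> to \<alpha> \<open>k\<close> does
          not change the slots at its end, since these two labels agree.\<close>
        have "e (skip k \<alpha> j) i = e (\<alpha> j) i" if "j \<noteq> k" "i \<in> low" for j i
          using that True by (cases "\<alpha> j = k") (auto simp: s)
        then have "?bal (V - {k}) (skip k \<alpha>) \<longleftrightarrow> ?bal (V - {k}) \<alpha>" by simp
        then show "?bal V \<alpha> \<longleftrightarrow> ?bal (V - {k}) (skip k \<alpha>)"
          using True by (metis Diff_iff singletonD)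
      qed
    next
      case False
      then obtain i where i: "i \<in> low" "e (\<alpha> k) i \<noteq> e k i" by blast
      obtain A B r where f: "feedback_sets V \<alpha> \<beta> A B r" and AB: "card A + card B \<le> card V + 1"
        using feedback_sets_transitive[OF \<alpha> \<beta> V less.prems(4) t] by blast
      have "card (solutions V \<alpha> \<beta>) \<le> N ^ (m * (card A + card B) - 1)"
        by (rule card_solutions_unbalanced_le[OF \<alpha> \<beta> V f fix2(1,2) i])
      also have "\<dots> \<le> N ^ (m * (card V + 1) - 1)"
        using N_pos AB by (intro power_increasing diff_le_mono mult_le_mono2) auto
      finally have "card (solutions V \<alpha> \<beta>) \<le> N ^ (m * (card V + 1) - 1)" .
      moreover have "\<not> ?bal V \<alpha>" using fix2(1) i by blast
      ultimately show ?thesis by (simp only: if_False simp_thms)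
    qed
  next
    case loopless
    have "\<exists>A B r. feedback_sets V \<alpha> \<beta> A B r \<and> card A + card B \<le> card V"
      by (rule feedback_sets_loopless[OF \<alpha> \<beta> V]) (rule loopless)
    then obtain A B r where f: "feedback_sets V \<alpha> \<beta> A B r" and AB: "card A + card B \<le> card V"
      by (elim exE conjE)
    have "cycle_count V \<alpha> \<le> card A" by (rule cycle_count_le_feedback[OF \<alpha> V f])
    moreover have "feedback_sets V \<beta> \<alpha> B A r" using f feedback_sets_sym[of V \<alpha> \<beta> A B r] by blast
    then have "cycle_count V \<beta> \<le> card B" by (rule cycle_count_le_feedback[OF \<beta> V])
    \<comment> \<open>Each cycle needs a cut of its own, so \<open>card V\<close> cuts exclude the
      extremal cycle count.\<close>
    ultimately have ne: "cycle_count V \<alpha> + cycle_count V \<beta> \<noteq> card V + 1" using AB by linarith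
    have "card (solutions V \<alpha> \<beta>) \<le> N ^ (m * (card A + card B))"
      by (rule card_solutions_le[OF \<alpha> \<beta> V f])
    also have "m * (card A + card B) \<le> m * card V" using AB by simp
    then have "N ^ (m * (card A + card B)) \<le> N ^ (m * (card V + 1) - 1)"
      using N_pos m_pos by (intro power_increasing) (auto simp: algebra_simps)
    finally have "card (solutions V \<alpha> \<beta>) \<le> N ^ (m * (card V + 1) - 1)" .
    then show ?thesis using ne by (simp only: if_False simp_thms)
  qed
qed

end

section \<open>Planar permutations\<close>

text \<open>The cycle (a, a + 1, ..., b - 1) in closed form. Arbitrary half-open intervals are
  allowed because the recursion cuts the point set into intervals.\<close>

definition rot :: "nat \<Rightarrow> nat \<Rightarrow> nat \<Rightarrow> nat" where
  "rot a b x = (if a \<le> x \<and> x < b then if Suc x = b then a else Suc x else x)"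

lemma cycle_of_list_upt: "cycle_of_list [a..<b] = rot a b"
proof (induction "b - a" arbitrary: a)
  case (Suc n)
  show ?case
  proof (cases "Suc a < b")
    case True
    then have "[a..<b] = a # Suc a # [Suc (Suc a)..<b]" "[Suc a..<b] = Suc a # [Suc (Suc a)..<b]"
      by (simp_all add: upt_conv_Cons)
    then have "cycle_of_list [a..<b] = Transposition.transpose a (Suc a) \<circ> cycle_of_list [Suc a..<b]"
      by simp
    also have "cycle_of_list [Suc a..<b] = rot (Suc a) b"
      using Suc by simp
    also have "Transposition.transpose a (Suc a) \<circ> rot (Suc a) b = rot a b"
      using True by (auto simp: fun_eq_iff rot_def Transposition.transpose_def)
    finally show ?thesis .
  next
    case False
    then have "[a..<b] = [a]" "b = Suc a" using Suc by (auto simp: upt_conv_Cons)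
    then show ?thesis by (auto simp: fun_eq_iff rot_def)
  qed
qed (auto simp: fun_eq_iff rot_def)

lemma rot_permutes: "rot a b permutes {a..<b}"
  using cycle_permutes[of "[a..<b]"] by (simp add: cycle_of_list_upt)

text \<open>A transposition of two points of a cycle splits it into two cycles, here supported on
  the intervals up to \<open>i\<close> and after \<open>i\<close>. This is what makes the planar
  recursion a product.\<close>

lemma rot_split:
  assumes "a \<le> i" "i < b"
  shows "rot a (Suc b) \<circ> Transposition.transpose i b = rot a (Suc i) \<circ> rot (Suc i) (Suc b)"
  using assms by (auto simp: fun_eq_iff rot_def Transposition.transpose_def)

lemma rot_closed:
  assumes "x \<in> U" "a \<le> x" "x < b" and cl: "\<And>y. y \<in> U \<Longrightarrow> a \<le> y \<Longrightarrow> y < b \<Longrightarrow> rot a b y \<in> U"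
  shows "{a..<b} \<subseteq> U"
proof
  have up: "y \<in> U" if "z \<in> U" "a \<le> z" "z \<le> y" "y < b" for y z
    using that(3,1,2,4)
  proof (induction y rule: dec_induct)
    case (step y)
    then show ?case using cl[of y] by (auto simp: rot_def)
  qed
  have "b - 1 \<in> U" using up[of x "b - 1"] assms by auto
  then have "a \<in> U" using cl[of "b - 1"] assms by (auto simp: rot_def)
  then show "y \<in> U" if "y \<in> {a..<b}" for y using up[of a y] that by auto
qed

lemma permutes_image_eq:
  assumes "\<alpha> permutes V" "finite V" "U \<subseteq> V" "\<alpha> ` U \<subseteq> U"
  shows "\<alpha> ` U = U"
proof (rule endo_inj_surj)
  show "finite U" using assms finite_subset by blast
  show "\<alpha> ` U \<subseteq> U" by fact
  show "inj_on \<alpha> U" using permutes_inj[OF assms(1)] by (rule inj_on_subset) simp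
qed

text \<open>By finiteness \<alpha> permutes any set that it maps into itself, so a set closed under
  both maps is closed under \<open>rot a b\<close>, a single cycle on the interval.\<close>

lemma transitive_pair_rot:
  assumes \<alpha>: "\<alpha> permutes {a..<b}"
  shows "transitive_pair {a..<b} \<alpha> (rot a b \<circ> \<alpha>)"
  unfolding transitive_pair_def
proof (intro allI impI)
  fix U assume U: "U \<subseteq> {a..<b} \<and> U \<noteq> {} \<and> \<alpha> ` U \<subseteq> U \<and> (rot a b \<circ> \<alpha>) ` U \<subseteq> U"
  then obtain x where x: "x \<in> U" "x \<in> {a..<b}" by blast
  have eq: "\<alpha> ` U = U" by (rule permutes_image_eq[OF \<alpha>]) (use U in auto)
  have "rot a b y \<in> U" if "y \<in> U" for y
  proof -
    have "y \<in> \<alpha> ` U" using that eq by simp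
    then obtain z where z: "z \<in> U" "y = \<alpha> z" by (elim imageE)
    have "(rot a b \<circ> \<alpha>) z \<in> U" using U z(1) by (elim conjE) (erule subsetD, erule imageI)
    then show ?thesis using z(2) by simp
  qed
  then have "{a..<b} \<subseteq> U" using rot_closed[of x U a b] x by auto
  then show "U = {a..<b}" using U by auto
qed

lemma cycle_count_rot_le:
  assumes "\<alpha> permutes {a..<b}" "a < b"
  shows "cycle_count {a..<b} \<alpha> + cycle_count {a..<b} (rot a b \<circ> \<alpha>) \<le> b - a + 1"
  using cycle_count_transitive_le[OF assms(1) permutes_compose[OF assms(1) rot_permutes] _ _ transitive_pair_rot[OF assms(1)]] assms(2)
  by auto

text \<open>Equality in the cycle bound, that is genus 0. On the empty interval there are no cycles
  and the equation would fail; the guard makes the identity planar there, which gives the recursion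
  its initial value 1.\<close>

definition planar :: "nat \<Rightarrow> nat \<Rightarrow> (nat \<Rightarrow> nat) \<Rightarrow> bool" where
  "planar a b \<alpha> \<longleftrightarrow> \<alpha> permutes {a..<b} \<and>
     (a < b \<longrightarrow> cycle_count {a..<b} \<alpha> + cycle_count {a..<b} (rot a b \<circ> \<alpha>) = b - a + 1)"

lemma interval_Suc_minus: "a \<le> b \<Longrightarrow> {a..<Suc b} - {b} = {a..<b}"
  by auto

lemma permutes_Suc_fixed_iff:
  assumes "a \<le> b" "\<alpha> b = b"
  shows "\<alpha> permutes {a..<Suc b} \<longleftrightarrow> \<alpha> permutes {a..<b}"
proof
  assume "\<alpha> permutes {a..<Suc b}"
  then show "\<alpha> permutes {a..<b}" by (rule permutes_superset) (use assms in \<open>auto simp: less_Suc_eq\<close>)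
next
  assume "\<alpha> permutes {a..<b}"
  then show "\<alpha> permutes {a..<Suc b}" by (rule permutes_subset) auto
qed

text \<open>A new fixed point \<open>b\<close> adds one cycle to \<alpha>. On the side of \<beta> it
  is only inserted into an existing cycle, unless the interval was empty, so the two sides of the
  defining equation grow alike.\<close>

lemma planar_Suc_fixed_iff:
  assumes ab: "a \<le> b" and bfix: "\<alpha> b = b"
  shows "planar a (Suc b) \<alpha> \<longleftrightarrow> planar a b \<alpha>"
proof (cases "\<alpha> permutes {a..<Suc b}")
  case False
  then show ?thesis using permutes_Suc_fixed_iff[of a b \<alpha>, OF assms] by (simp add: planar_def)
next
  case \<alpha>: True
  show ?thesis
  proof (cases "a = b")
    case True
    have "\<alpha> = id" using \<alpha> True permutes_Suc_fixed_iff[of a b \<alpha>, OF assms] by simp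
    moreover have "{b..<Suc b} = {b}" by auto
    ultimately show ?thesis using True by (auto simp: planar_def cycle_count_def permutes_id rot_def)
  next
    case False
    let ?V = "{a..<Suc b}" and ?\<beta> = "rot a (Suc b) \<circ> \<alpha>"
    have \<beta>: "?\<beta> permutes ?V" by (rule permutes_compose[OF \<alpha> rot_permutes])
    have \<beta>b: "?\<beta> b \<noteq> b" using False ab bfix by (simp add: rot_def)
    have V: "?V - {b} = {a..<b}" by (rule interval_Suc_minus[OF ab])
    have sk: "skip b ?\<beta> = rot a b \<circ> \<alpha>"
    proof
      fix x
      have x: "\<alpha> x = b \<longleftrightarrow> x = b" using bfix permutes_inj[OF \<alpha>] by (metis injD)
      show "skip b ?\<beta> x = (rot a b \<circ> \<alpha>) x"
        unfolding skip_apply[OF permutes_inj[OF \<beta>]] using bfix x ab False by (auto simp: rot_def)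
    qed
    have "cycle_count (?V - {b}) (skip b ?\<beta>) = cycle_count ?V ?\<beta>"
      by (rule cycle_count_skip[OF \<beta> _ \<beta>b]) simp
    then have "cycle_count ?V ?\<beta> = cycle_count {a..<b} (rot a b \<circ> \<alpha>)"
      by (simp only: V sk)
    moreover have "cycle_count ?V \<alpha> = cycle_count {a..<b} \<alpha> + 1"
      using cycle_count_fixed[OF \<alpha> _ bfix] V ab by simp
    ultimately show ?thesis
      using \<alpha> permutes_Suc_fixed_iff[of a b \<alpha>, OF assms] ab False by (auto simp: planar_def)
  qed
qed

section \<open>Decomposition by the image of the last point\<close>

text \<open>The general shape of a planar permutation sending \<open>b\<close> to \<open>i\<close>:
  the second component acts up to \<open>i\<close>, the first strictly between \<open>i\<close> and
  \<open>b\<close>, and the transposition inserts \<open>b\<close> into the cycle of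
  \<open>i\<close>, just before \<open>i\<close>.\<close>

definition glue :: "nat \<Rightarrow> nat \<Rightarrow> (nat \<Rightarrow> nat) \<times> (nat \<Rightarrow> nat) \<Rightarrow> nat \<Rightarrow> nat" where
  "glue i b = (\<lambda>(\<alpha>1, \<alpha>2). Transposition.transpose i b \<circ> (\<alpha>2 \<circ> \<alpha>1))"

context
  fixes a i b :: nat and \<alpha>1 \<alpha>2 :: "nat \<Rightarrow> nat"
  assumes i: "a \<le> i" "i < b" and \<alpha>1: "\<alpha>1 permutes {Suc i..<b}" and \<alpha>2: "\<alpha>2 permutes {a..<Suc i}"
begin

lemma glue_parts:
  "x \<in> {a..<Suc i} \<Longrightarrow> (\<alpha>2 \<circ> \<alpha>1) x = \<alpha>2 x" "x \<in> {Suc i..<Suc b} \<Longrightarrow> (\<alpha>2 \<circ> \<alpha>1) x = \<alpha>1 x"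
proof -
  show "(\<alpha>2 \<circ> \<alpha>1) x = \<alpha>2 x" if "x \<in> {a..<Suc i}" using that permutes_not_in[OF \<alpha>1, of x] by simp
  show "(\<alpha>2 \<circ> \<alpha>1) x = \<alpha>1 x" if x: "x \<in> {Suc i..<Suc b}"
  proof -
    have "\<alpha>1 permutes {Suc i..<Suc b}" by (rule permutes_subset[OF \<alpha>1]) auto
    then have "\<alpha>1 x \<in> {Suc i..<Suc b}" using x by (simp add: permutes_in_image del: atLeastLessThan_iff)
    then have "\<alpha>1 x \<notin> {a..<Suc i}" by auto
    then show ?thesis using permutes_not_in[OF \<alpha>2] by simp
  qed
qed

lemma glue_permutes: "\<alpha>2 \<circ> \<alpha>1 permutes {a..<b}" "glue i b (\<alpha>1, \<alpha>2) permutes {a..<Suc b}" "glue i b (\<alpha>1, \<alpha>2) b = i"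
proof -
  show p: "\<alpha>2 \<circ> \<alpha>1 permutes {a..<b}"
    by (intro permutes_compose permutes_subset[OF \<alpha>1] permutes_subset[OF \<alpha>2]) (use i in auto)
  show "glue i b (\<alpha>1, \<alpha>2) permutes {a..<Suc b}"
    unfolding glue_def prod.case
    by (intro permutes_compose[OF permutes_subset[OF p]] permutes_swap_id) (use i in auto)
  have "(\<alpha>2 \<circ> \<alpha>1) b = b" using permutes_not_in[OF p, of b] by simp
  then show "glue i b (\<alpha>1, \<alpha>2) b = i" by (simp add: glue_def)
qed

text \<open>Inserting \<open>b\<close> into an existing cycle creates no new one, which settles the
  first count. For the second, \<open>rot_split\<close> cancels the transposition and leaves two
  maps on disjoint intervals, the upper one now including \<open>b\<close>.\<close>

lemma cycle_count_glue:
  "cycle_count {a..<Suc b} (glue i b (\<alpha>1, \<alpha>2)) = cycle_count {a..<Suc i} \<alpha>2 + cycle_count {Suc i..<b} \<alpha>1"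
  "cycle_count {a..<Suc b} (rot a (Suc b) \<circ> glue i b (\<alpha>1, \<alpha>2)) =
     cycle_count {a..<Suc i} (rot a (Suc i) \<circ> \<alpha>2) + cycle_count {Suc i..<Suc b} (rot (Suc i) (Suc b) \<circ> \<alpha>1)"
proof -
  let ?\<alpha> = "glue i b (\<alpha>1, \<alpha>2)"
  have fin: "finite {x..<y}" for x y :: nat by simp
  have ne: "?\<alpha> b \<noteq> b" using glue_permutes(3) i by simp
  have "(\<alpha>2 \<circ> \<alpha>1) b = b" using permutes_not_in[OF glue_permutes(1), of b] by simp
  then have sk: "skip b ?\<alpha> = \<alpha>2 \<circ> \<alpha>1"
    by (simp add: skip_def glue_permutes(3) glue_def fun_eq_iff transpose_commute[of b i])
  have U: "{a..<b} = {a..<Suc i} \<union> {Suc i..<b}" "{a..<Suc b} = {a..<Suc i} \<union> {Suc i..<Suc b}" using i by auto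
  have p: "\<alpha>2 \<circ> \<alpha>1 permutes {a..<b}" by (rule glue_permutes)
  have "cycle_count {a..<Suc b} ?\<alpha> = cycle_count {a..<b} (\<alpha>2 \<circ> \<alpha>1)"
    using cycle_count_skip[OF glue_permutes(2) fin ne] interval_Suc_minus[of a b] i sk by simp
  also have "\<dots> = cycle_count {a..<Suc i} (\<alpha>2 \<circ> \<alpha>1) + cycle_count {Suc i..<b} (\<alpha>2 \<circ> \<alpha>1)"
  proof -
    have "(\<alpha>2 \<circ> \<alpha>1) x \<in> {a..<Suc i}" if "x \<in> {a..<Suc i}" for x
      unfolding glue_parts(1)[OF that] using that \<alpha>2 by (simp add: permutes_in_image del: atLeastLessThan_iff)
    then show ?thesis using p unfolding U(1) by (intro cycle_count_Un) auto
  qed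
  also have "cycle_count {a..<Suc i} (\<alpha>2 \<circ> \<alpha>1) = cycle_count {a..<Suc i} \<alpha>2"
  proof (rule cycle_count_cong[OF p fin glue_parts(1)])
    show "(\<alpha>2 \<circ> \<alpha>1) x \<in> {a..<Suc i}" if "x \<in> {a..<Suc i}" for x
      unfolding glue_parts(1)[OF that] using that \<alpha>2 by (simp add: permutes_in_image del: atLeastLessThan_iff)
  qed
  also have "cycle_count {Suc i..<b} (\<alpha>2 \<circ> \<alpha>1) = cycle_count {Suc i..<b} \<alpha>1"
  proof (rule cycle_count_cong[OF p fin])
    fix x assume x: "x \<in> {Suc i..<b}"
    then show eq: "(\<alpha>2 \<circ> \<alpha>1) x = \<alpha>1 x" by (intro glue_parts(2)) auto
    show "(\<alpha>2 \<circ> \<alpha>1) x \<in> {Suc i..<b}"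
      unfolding eq using x \<alpha>1 by (simp add: permutes_in_image del: atLeastLessThan_iff)
  qed
  finally show "cycle_count {a..<Suc b} ?\<alpha> = cycle_count {a..<Suc i} \<alpha>2 + cycle_count {Suc i..<b} \<alpha>1" .

  let ?\<beta> = "rot a (Suc b) \<circ> ?\<alpha>"
  have \<beta>: "?\<beta> permutes {a..<Suc b}" by (rule permutes_compose[OF glue_permutes(2) rot_permutes])
  have \<beta>eq: "?\<beta> x = rot a (Suc i) (rot (Suc i) (Suc b) ((\<alpha>2 \<circ> \<alpha>1) x))" for x
    using fun_cong[OF rot_split[OF i], of "(\<alpha>2 \<circ> \<alpha>1) x"] by (simp add: glue_def)
  have \<alpha>1': "\<alpha>1 permutes {Suc i..<Suc b}" by (rule permutes_subset[OF \<alpha>1]) auto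
  have low: "?\<beta> x = (rot a (Suc i) \<circ> \<alpha>2) x" "?\<beta> x \<in> {a..<Suc i}" if x: "x \<in> {a..<Suc i}" for x
  proof -
    have m: "\<alpha>2 x \<in> {a..<Suc i}" using x \<alpha>2 by (simp add: permutes_in_image del: atLeastLessThan_iff)
    then show eq: "?\<beta> x = (rot a (Suc i) \<circ> \<alpha>2) x"
      unfolding \<beta>eq glue_parts(1)[OF x] by (simp add: rot_def)
    show "?\<beta> x \<in> {a..<Suc i}" unfolding eq
      using m rot_permutes[of a "Suc i"] by (simp add: permutes_in_image del: atLeastLessThan_iff)
  qed
  have high: "?\<beta> x = (rot (Suc i) (Suc b) \<circ> \<alpha>1) x" "?\<beta> x \<in> {Suc i..<Suc b}" if x: "x \<in> {Suc i..<Suc b}" for x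
  proof -
    have m: "rot (Suc i) (Suc b) (\<alpha>1 x) \<in> {Suc i..<Suc b}"
      using x \<alpha>1' rot_permutes[of "Suc i" "Suc b"] by (simp add: permutes_in_image del: atLeastLessThan_iff)
    then show eq: "?\<beta> x = (rot (Suc i) (Suc b) \<circ> \<alpha>1) x"
      unfolding \<beta>eq glue_parts(2)[OF x] by (simp add: rot_def[of a "Suc i"])
    show "?\<beta> x \<in> {Suc i..<Suc b}" unfolding eq using m by simp
  qed
  have "cycle_count {a..<Suc b} ?\<beta> = cycle_count {a..<Suc i} ?\<beta> + cycle_count {Suc i..<Suc b} ?\<beta>"
    using \<beta> low(2) unfolding U(2) by (intro cycle_count_Un) auto
  also have "cycle_count {a..<Suc i} ?\<beta> = cycle_count {a..<Suc i} (rot a (Suc i) \<circ> \<alpha>2)"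
    by (rule cycle_count_cong[OF \<beta> fin low])
  also have "cycle_count {Suc i..<Suc b} ?\<beta> = cycle_count {Suc i..<Suc b} (rot (Suc i) (Suc b) \<circ> \<alpha>1)"
    by (rule cycle_count_cong[OF \<beta> fin high])
  finally show "cycle_count {a..<Suc b} ?\<beta> = cycle_count {a..<Suc i} (rot a (Suc i) \<circ> \<alpha>2) +
     cycle_count {Suc i..<Suc b} (rot (Suc i) (Suc b) \<circ> \<alpha>1)" .
qed

text \<open>The two cycle bounds on the subintervals add up to the bound on the whole interval, so
  equality holds on the whole exactly if it holds in both parts. The fixed point \<open>b\<close> is
  then dropped from the upper part.\<close>

lemma planar_glue_iff: "planar a (Suc b) (glue i b (\<alpha>1, \<alpha>2)) \<longleftrightarrow> planar (Suc i) b \<alpha>1 \<and> planar a (Suc i) \<alpha>2"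
proof -
  have bfix: "\<alpha>1 b = b" using permutes_not_in[OF \<alpha>1, of b] by simp
  have \<alpha>1': "\<alpha>1 permutes {Suc i..<Suc b}" by (rule permutes_subset[OF \<alpha>1]) auto
  have "cycle_count {Suc i..<Suc b} \<alpha>1 = cycle_count {Suc i..<b} \<alpha>1 + 1"
    using cycle_count_fixed[OF \<alpha>1' _ bfix] interval_Suc_minus[of "Suc i" b] i by simp
  moreover have "cycle_count {Suc i..<Suc b} \<alpha>1 + cycle_count {Suc i..<Suc b} (rot (Suc i) (Suc b) \<circ> \<alpha>1) \<le> Suc b - Suc i + 1"
    using cycle_count_rot_le[OF \<alpha>1'] i by simp
  moreover have "cycle_count {a..<Suc i} \<alpha>2 + cycle_count {a..<Suc i} (rot a (Suc i) \<circ> \<alpha>2) \<le> Suc i - a + 1"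
    using cycle_count_rot_le[OF \<alpha>2] i by simp
  ultimately have "planar a (Suc b) (glue i b (\<alpha>1, \<alpha>2)) \<longleftrightarrow> planar (Suc i) (Suc b) \<alpha>1 \<and> planar a (Suc i) \<alpha>2"
    using i \<alpha>1' \<alpha>2 glue_permutes(2) unfolding planar_def cycle_count_glue by auto
  then show ?thesis using planar_Suc_fixed_iff[of "Suc i" b \<alpha>1] bfix i by simp
qed

end

text \<open>
  Multiplying \<open>\<alpha>\<close> by a transposition splits off a cycle without changing \<open>\<beta>\<close>, so the cycle counts of the new pair exceed
  the bound for transitive pairs, and the new permutation preserves the two intervals cut out by \<open>i\<close>.
\<close>

lemma planar_unglue:
  assumes i: "a \<le> i" "i < b" and p: "planar a (Suc b) \<alpha>" and \<alpha>b: "\<alpha> b = i"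
  shows "\<exists>\<alpha>1 \<alpha>2. \<alpha>1 permutes {Suc i..<b} \<and> \<alpha>2 permutes {a..<Suc i} \<and> \<alpha> = glue i b (\<alpha>1, \<alpha>2)"
proof -
  let ?V = "{a..<Suc b}"
  define \<alpha>' where "\<alpha>' = skip b \<alpha>"
  let ?\<beta> = "rot a (Suc b) \<circ> \<alpha>"
  have \<alpha>: "\<alpha> permutes ?V" using p by (simp add: planar_def)
  have V: "?V - {b} = {a..<b}" using i by (intro interval_Suc_minus) simp
  have \<alpha>': "\<alpha>' permutes {a..<b}" using permutes_skip[OF \<alpha>, of b] V by (simp add: \<alpha>'_def)
  have \<alpha>'V: "\<alpha>' permutes ?V" by (rule permutes_subset[OF \<alpha>']) auto
  have \<alpha>'b: "\<alpha>' b = b" using permutes_not_in[OF \<alpha>', of b] by simp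
  have \<alpha>eq: "\<alpha> = Transposition.transpose i b \<circ> \<alpha>'"
    by (simp add: \<alpha>'_def skip_def \<alpha>b fun_eq_iff transpose_commute[of b i])
  have \<beta>eq: "?\<beta> x = rot a (Suc i) (rot (Suc i) (Suc b) (\<alpha>' x))" for x
    using fun_cong[OF rot_split[OF i], of "\<alpha>' x"] by (simp add: \<alpha>eq)
  have "cycle_count ?V \<alpha>' = cycle_count {a..<b} \<alpha>' + 1"
    using cycle_count_fixed[OF \<alpha>'V _ \<alpha>'b] V i by simp
  also have "cycle_count {a..<b} \<alpha>' = cycle_count ?V \<alpha>"
    using cycle_count_skip[OF \<alpha>, of b] V i \<alpha>b by (simp add: \<alpha>'_def)
  \<comment> \<open>Detaching \<open>b\<close> from \<alpha> raises the count by one, which is one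
    too many for a transitive pair.\<close>
  finally have "cycle_count ?V \<alpha>' + cycle_count ?V ?\<beta> = card ?V + 2"
    using p i by (simp add: planar_def)
  then have "\<not> transitive_pair ?V \<alpha>' ?\<beta>"
    using cycle_count_transitive_le[OF \<alpha>'V permutes_compose[OF \<alpha> rot_permutes]] i by force
  then obtain U where U: "U \<subseteq> ?V" "U \<noteq> {}" "\<alpha>' ` U \<subseteq> U" "?\<beta> ` U \<subseteq> U" "U \<noteq> ?V"
    unfolding transitive_pair_def by blast
  have \<alpha>'U: "\<alpha>' ` U = U" by (rule permutes_image_eq[OF \<alpha>'V _ U(1,3)]) simp
  have \<rho>: "rot a (Suc i) (rot (Suc i) (Suc b) y) \<in> U" if "y \<in> U" for y
  proof -
    have "y \<in> \<alpha>' ` U" using that \<alpha>'U by simp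
    then obtain z where z: "z \<in> U" "y = \<alpha>' z" by (elim imageE)
    have "?\<beta> z \<in> U" using subsetD[OF U(4) imageI[OF z(1)]] .
    then show ?thesis using z(2) \<beta>eq[of z] by simp
  qed
  have low: "{a..<Suc i} \<subseteq> U" if "x \<in> U" "x \<in> {a..<Suc i}" for x
  proof (rule rot_closed[OF that(1)])
    show "rot a (Suc i) y \<in> U" if "y \<in> U" "a \<le> y" "y < Suc i" for y
      using \<rho>[OF that(1)] that by (simp add: rot_def[of "Suc i"])
  qed (use that in auto)
  have high: "{Suc i..<Suc b} \<subseteq> U" if "x \<in> U" "x \<in> {Suc i..<Suc b}" for x
  proof (rule rot_closed[OF that(1)])
    fix y assume y: "y \<in> U" "Suc i \<le> y" "y < Suc b"
    then have "rot (Suc i) (Suc b) y \<in> {Suc i..<Suc b}" using i by (auto simp: rot_def)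
    then show "rot (Suc i) (Suc b) y \<in> U"
      using \<rho>[OF y(1)] by (simp add: rot_def[of a])
  qed (use that in auto)
  have Vsplit: "?V = {a..<Suc i} \<union> {Suc i..<Suc b}" using i by auto
  \<comment> \<open>The set \<open>U\<close> contains each of the two intervals that it meets; being
    nonempty and proper, it is one of them.\<close>
  have "U = {a..<Suc i} \<or> U = {Suc i..<Suc b}"
    using low high U(1,2,5) unfolding Vsplit by blast
  then have pres: "\<alpha>' x \<in> {a..<Suc i} \<longleftrightarrow> x \<in> {a..<Suc i}" if "x \<in> ?V" for x
  proof -
    have mem: "\<alpha>' x \<in> U \<longleftrightarrow> x \<in> U"
      using \<alpha>'U permutes_inj[OF \<alpha>'V] by (metis inj_image_mem_iff)
    have "\<alpha>' x \<in> ?V" using that \<alpha>'V by (simp add: permutes_in_image del: atLeastLessThan_iff)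
    then show ?thesis
      using mem that \<open>U = {a..<Suc i} \<or> U = {Suc i..<Suc b}\<close> by auto
  qed
  define \<alpha>1 where "\<alpha>1 x = (if x \<in> {Suc i..<b} then \<alpha>' x else x)" for x
  define \<alpha>2 where "\<alpha>2 x = (if x \<in> {a..<Suc i} then \<alpha>' x else x)" for x
  have inj: "inj \<alpha>'" using permutes_inj[OF \<alpha>'] .
  have "\<alpha>1 permutes {Suc i..<b}"
  proof (rule inj_imp_permutes)
    show "inj_on \<alpha>1 {Suc i..<b}" using inj by (auto simp: inj_on_def \<alpha>1_def)
    fix x assume x: "x \<in> {Suc i..<b}"
    then have "x \<in> {a..<b}" using i by simp
    then have "\<alpha>' x \<in> {a..<b}" using \<alpha>' by (simp add: permutes_in_image del: atLeastLessThan_iff)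
    then show "\<alpha>1 x \<in> {Suc i..<b}" using pres[of x] x i by (auto simp: \<alpha>1_def)
  qed (auto simp: \<alpha>1_def)
  moreover have "\<alpha>2 permutes {a..<Suc i}"
  proof (rule inj_imp_permutes)
    show "inj_on \<alpha>2 {a..<Suc i}" using inj by (auto simp: inj_on_def \<alpha>2_def)
    show "\<alpha>2 x \<in> {a..<Suc i}" if x: "x \<in> {a..<Suc i}" for x
      using pres[of x] x i by (auto simp: \<alpha>2_def)
  qed (auto simp: \<alpha>2_def)
  moreover have "\<alpha>' x = \<alpha>2 (\<alpha>1 x)" for x
  proof (cases "x \<in> {Suc i..<b}")
    case True
    then have "\<alpha>' x \<notin> {a..<Suc i}" using pres[of x] i by auto
    then show ?thesis using True by (simp add: \<alpha>1_def \<alpha>2_def del: atLeastLessThan_iff)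
  next
    case False
    then show ?thesis
      using permutes_not_in[OF \<alpha>', of x] by (cases "x \<in> {a..<Suc i}") (auto simp: \<alpha>1_def \<alpha>2_def)
  qed
  then have "\<alpha> = glue i b (\<alpha>1, \<alpha>2)" by (simp add: glue_def \<alpha>eq fun_eq_iff)
  ultimately show ?thesis by blast
qed

definition planar_maps :: "nat \<Rightarrow> nat \<Rightarrow> (nat \<Rightarrow> 'i) \<Rightarrow> (nat \<Rightarrow> nat) set" where
  "planar_maps a b f = {\<alpha>. planar a b \<alpha> \<and> (\<forall>k\<in>{a..<b}. f (\<alpha> k) = f k)}"

lemma finite_planar_maps: "finite (planar_maps a b f)"
proof (rule finite_subset)
  show "planar_maps a b f \<subseteq> {\<alpha>. \<alpha> permutes {a..<b}}" by (auto simp: planar_maps_def planar_def)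
qed (simp add: finite_permutations)

lemma card_planar_maps_self: "card (planar_maps a a f) = 1"
proof -
  have "planar_maps a a f = {id}" by (auto simp: planar_maps_def planar_def)
  then show ?thesis by simp
qed

text \<open>The transposition exchanges two points of equal label and is therefore invisible to
  \<open>f\<close>.\<close>

lemma glue_balanced_iff:
  assumes i: "a \<le> i" "i < b" and \<alpha>1: "\<alpha>1 permutes {Suc i..<b}" and \<alpha>2: "\<alpha>2 permutes {a..<Suc i}"
    and fi: "f i = f b"
  shows "(\<forall>k\<in>{a..<Suc b}. f (glue i b (\<alpha>1, \<alpha>2) k) = f k) \<longleftrightarrow>
    (\<forall>k\<in>{Suc i..<b}. f (\<alpha>1 k) = f k) \<and> (\<forall>k\<in>{a..<Suc i}. f (\<alpha>2 k) = f k)"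
proof -
  have g: "f (glue i b (\<alpha>1, \<alpha>2) k) = f ((\<alpha>2 \<circ> \<alpha>1) k)" for k
    using fi by (auto simp: glue_def Transposition.transpose_def)
  have U: "{a..<Suc b} = {a..<Suc i} \<union> ({Suc i..<b} \<union> {b})" using i by auto
  have b: "(\<alpha>2 \<circ> \<alpha>1) b = b"
    using permutes_not_in[OF glue_permutes(1)[OF i \<alpha>1 \<alpha>2], of b] by simp
  have "(\<forall>k\<in>{a..<Suc i}. f ((\<alpha>2 \<circ> \<alpha>1) k) = f k) \<longleftrightarrow> (\<forall>k\<in>{a..<Suc i}. f (\<alpha>2 k) = f k)"
    by (intro ball_cong refl) (simp only: glue_parts(1)[OF i \<alpha>1 \<alpha>2])
  moreover have "(\<forall>k\<in>{Suc i..<b}. f ((\<alpha>2 \<circ> \<alpha>1) k) = f k) \<longleftrightarrow> (\<forall>k\<in>{Suc i..<b}. f (\<alpha>1 k) = f k)"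
  proof (intro ball_cong refl)
    fix k assume "k \<in> {Suc i..<b}"
    then have "k \<in> {Suc i..<Suc b}" by auto
    then show "f ((\<alpha>2 \<circ> \<alpha>1) k) = f k \<longleftrightarrow> f (\<alpha>1 k) = f k" by (simp only: glue_parts(2)[OF i \<alpha>1 \<alpha>2])
  qed
  ultimately show ?thesis unfolding U g ball_Un using b by auto
qed

text \<open>The first set collects the permutations fixing \<open>b\<close>; in the others the image
  \<open>i\<close> of \<open>b\<close> has the label of \<open>b\<close>, since the labelling is
  preserved.\<close>

lemma planar_maps_Suc:
  assumes "a \<le> b"
  shows "planar_maps a (Suc b) f = planar_maps a b f \<union>
    (\<Union>i\<in>{i\<in>{a..<b}. f i = f b}. glue i b ` (planar_maps (Suc i) b f \<times> planar_maps a (Suc i) f))"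
proof (intro equalityI subsetI)
  fix \<alpha> assume \<alpha>: "\<alpha> \<in> planar_maps a (Suc b) f"
  then have pl: "planar a (Suc b) \<alpha>" and bal: "\<forall>k\<in>{a..<Suc b}. f (\<alpha> k) = f k" by (auto simp: planar_maps_def)
  have perm: "\<alpha> permutes {a..<Suc b}" using pl by (simp add: planar_def)
  show "\<alpha> \<in> planar_maps a b f \<union>
    (\<Union>i\<in>{i\<in>{a..<b}. f i = f b}. glue i b ` (planar_maps (Suc i) b f \<times> planar_maps a (Suc i) f))"
  proof (cases "\<alpha> b = b")
    case True
    then show ?thesis using planar_Suc_fixed_iff[of a b \<alpha>, OF assms True] pl bal by (auto simp: planar_maps_def)
  next
    case False
    define i where "i = \<alpha> b"
    have "b \<in> {a..<Suc b}" using assms by simp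
    then have "\<alpha> b \<in> {a..<Suc b}" using perm by (simp add: permutes_in_image del: atLeastLessThan_iff)
    then have i: "a \<le> i" "i < b" using False by (auto simp: i_def)
    obtain \<alpha>1 \<alpha>2 where g: "\<alpha>1 permutes {Suc i..<b}" "\<alpha>2 permutes {a..<Suc i}" "\<alpha> = glue i b (\<alpha>1, \<alpha>2)"
      using planar_unglue[OF i pl i_def[symmetric]] by (elim exE conjE)
    have fi: "f i = f b" using bal assms by (auto simp: i_def)
    have "planar (Suc i) b \<alpha>1 \<and> planar a (Suc i) \<alpha>2"
      using planar_glue_iff[OF i g(1,2)] pl g(3) by simp
    moreover have "(\<forall>k\<in>{Suc i..<b}. f (\<alpha>1 k) = f k) \<and> (\<forall>k\<in>{a..<Suc i}. f (\<alpha>2 k) = f k)"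
      using glue_balanced_iff[of a i b \<alpha>1 \<alpha>2 f, OF i g(1,2) fi] bal g(3) by simp
    ultimately have "\<alpha>1 \<in> planar_maps (Suc i) b f" "\<alpha>2 \<in> planar_maps a (Suc i) f"
      by (simp_all add: planar_maps_def)
    then show ?thesis using g(3) i fi by auto
  qed
next
  fix \<alpha> assume "\<alpha> \<in> planar_maps a b f \<union>
    (\<Union>i\<in>{i\<in>{a..<b}. f i = f b}. glue i b ` (planar_maps (Suc i) b f \<times> planar_maps a (Suc i) f))"
  then consider "\<alpha> \<in> planar_maps a b f" | i \<alpha>1 \<alpha>2 where "a \<le> i" "i < b" "f i = f b"
    "\<alpha>1 \<in> planar_maps (Suc i) b f" "\<alpha>2 \<in> planar_maps a (Suc i) f" "\<alpha> = glue i b (\<alpha>1, \<alpha>2)" by auto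
  then show "\<alpha> \<in> planar_maps a (Suc b) f"
  proof cases
    case 1
    then have "\<alpha> b = b" using permutes_not_in[of \<alpha> "{a..<b}" b] by (simp add: planar_maps_def planar_def)
    then show ?thesis using 1 planar_Suc_fixed_iff[of a b \<alpha>] assms by (auto simp: planar_maps_def less_Suc_eq)
  next
    case (2 i \<alpha>1 \<alpha>2)
    then have g: "\<alpha>1 permutes {Suc i..<b}" "\<alpha>2 permutes {a..<Suc i}" by (auto simp: planar_maps_def planar_def)
    have "planar a (Suc b) \<alpha>"
      using planar_glue_iff[OF 2(1,2) g] 2(4,5,6) by (simp add: planar_maps_def)
    moreover have "\<forall>k\<in>{a..<Suc b}. f (\<alpha> k) = f k"
      using glue_balanced_iff[of a i b \<alpha>1 \<alpha>2 f, OF 2(1,2) g 2(3)] 2(4,5,6) by (simp add: planar_maps_def)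
    ultimately show ?thesis by (simp add: planar_maps_def)
  qed
qed

lemma glue_inj:
  assumes i: "a \<le> i" "i < b"
  shows "inj_on (glue i b) (planar_maps (Suc i) b f \<times> planar_maps a (Suc i) f)"
proof (rule inj_onI)
  fix x y assume x: "x \<in> planar_maps (Suc i) b f \<times> planar_maps a (Suc i) f"
    and y: "y \<in> planar_maps (Suc i) b f \<times> planar_maps a (Suc i) f" and eq: "glue i b x = glue i b y"
  obtain \<alpha>1 \<alpha>2 \<beta>1 \<beta>2 where xy: "x = (\<alpha>1, \<alpha>2)" "y = (\<beta>1, \<beta>2)" by (cases x, cases y)
  have \<alpha>: "\<alpha>1 permutes {Suc i..<b}" "\<alpha>2 permutes {a..<Suc i}" and \<beta>: "\<beta>1 permutes {Suc i..<b}" "\<beta>2 permutes {a..<Suc i}"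
    using x y xy by (auto simp: planar_maps_def planar_def)
  have "Transposition.transpose i b (\<alpha>2 (\<alpha>1 k)) = Transposition.transpose i b (\<beta>2 (\<beta>1 k))" for k
    using fun_cong[OF eq, of k] by (simp add: xy glue_def)
  then have e: "(\<alpha>2 \<circ> \<alpha>1) k = (\<beta>2 \<circ> \<beta>1) k" for k by (metis comp_apply transpose_involutory)
  have "\<alpha>1 k = \<beta>1 k" for k
  proof (cases "k \<in> {Suc i..<b}")
    case True
    then have "k \<in> {Suc i..<Suc b}" by auto
    then show ?thesis using e[of k] glue_parts(2)[OF i \<alpha>] glue_parts(2)[OF i \<beta>] by simp
  qed (use permutes_not_in \<alpha>(1) \<beta>(1) in metis)
  moreover have "\<alpha>2 k = \<beta>2 k" for k
  proof (cases "k \<in> {a..<Suc i}")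
    case True
    then show ?thesis using e[of k] glue_parts(1)[OF i \<alpha>] glue_parts(1)[OF i \<beta>] by simp
  qed (use permutes_not_in \<alpha>(2) \<beta>(2) in metis)
  ultimately show "x = y" by (auto simp: xy)
qed

lemma card_planar_maps_Suc:
  assumes "a \<le> b"
  shows "card (planar_maps a (Suc b) f) = card (planar_maps a b f) +
    (\<Sum>i\<in>{i\<in>{a..<b}. f i = f b}. card (planar_maps (Suc i) b f) * card (planar_maps a (Suc i) f))"
proof -
  let ?I = "{i\<in>{a..<b}. f i = f b}" and ?G = "\<lambda>i. glue i b ` (planar_maps (Suc i) b f \<times> planar_maps a (Suc i) f)"
  have val: "\<alpha> b = i" if "i \<in> ?I" "\<alpha> \<in> ?G i" for \<alpha> i
    using that glue_permutes(3)[of a i b] by (auto simp: planar_maps_def planar_def)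
  have fixed: "\<alpha> b = b" if "\<alpha> \<in> planar_maps a b f" for \<alpha>
    using that permutes_not_in[of \<alpha> "{a..<b}" b] by (simp add: planar_maps_def planar_def)
  have fin: "finite (?G i)" for i by (simp add: finite_planar_maps)
  have "card (planar_maps a (Suc b) f) = card (planar_maps a b f) + card (\<Union>i\<in>?I. ?G i)"
    unfolding planar_maps_Suc[OF assms]
  proof (rule card_Un_disjoint)
    show "planar_maps a b f \<inter> (\<Union>i\<in>?I. ?G i) = {}"
    proof (rule equals0I)
      fix x assume x: "x \<in> planar_maps a b f \<inter> (\<Union>i\<in>?I. ?G i)"
      then obtain i where i: "i \<in> ?I" "x \<in> ?G i" by blast
      then show False using val[OF i] fixed[OF IntD1[OF x]] by simp
    qed
  qed (use fin finite_planar_maps in auto)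
  also have "card (\<Union>i\<in>?I. ?G i) = (\<Sum>i\<in>?I. card (?G i))"
  proof (rule card_UN_disjoint)
    show "\<forall>i\<in>?I. \<forall>j\<in>?I. i \<noteq> j \<longrightarrow> ?G i \<inter> ?G j = {}"
    proof (intro ballI impI equals0I)
      fix i j x assume ij: "i \<in> ?I" "j \<in> ?I" "i \<noteq> j" and x: "x \<in> ?G i \<inter> ?G j"
      have "x b = i" by (rule val[OF ij(1) IntD1[OF x]])
      moreover have "x b = j" by (rule val[OF ij(2) IntD2[OF x]])
      ultimately show False using ij(3) by simp
    qed
  qed (use fin in auto)
  also have "\<dots> = (\<Sum>i\<in>?I. card (planar_maps (Suc i) b f) * card (planar_maps a (Suc i) f))"
  proof (intro sum.cong refl)
    fix i assume "i \<in> ?I"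
    then have "inj_on (glue i b) (planar_maps (Suc i) b f \<times> planar_maps a (Suc i) f)"
      by (intro glue_inj) auto
    then show "card (?G i) = card (planar_maps (Suc i) b f) * card (planar_maps a (Suc i) f)"
      by (simp add: card_image card_cartesian_product)
  qed
  finally show ?thesis .
qed

section \<open>The Fock space model\<close>

text \<open>
  \<open>(1 + l\<^sub>j)(1 + l\<^sub>j\<^sup>*)\<close> for the creation operator \<open>l\<^sub>j\<close> of the full Fock space, acting on arbitrary coefficient
  functions of words.
\<close>

definition fock_op :: "'i \<Rightarrow> ('i list \<Rightarrow> complex) \<Rightarrow> 'i list \<Rightarrow> complex" where
  "fock_op j v w = v w + v (j # w) + (if w \<noteq> [] \<and> hd w = j then v (tl w) + v w else 0)"

definition vacuum :: "'i list \<Rightarrow> complex" where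
  "vacuum w = (if w = [] then 1 else 0)"

text \<open>The representation of the free algebra in which the j-th generator acts as
  \<open>fock_op j\<close>; freeness and moments are read off from its action on the vacuum.\<close>

definition free_op :: "'i free_algebra \<Rightarrow> ('i list \<Rightarrow> complex) \<Rightarrow> 'i list \<Rightarrow> complex" where
  "free_op x v w = (\<Sum>u\<in>Poly_Mapping.keys x. Poly_Mapping.lookup x u * foldr fock_op (letters u) v w)"

definition vacuum_state :: "'i free_algebra \<Rightarrow> complex" where
  "vacuum_state x = free_op x vacuum []"

definition free_generator :: "'i \<Rightarrow> 'i free_algebra" where
  "free_generator j = Poly_Mapping.single (Word [j]) 1"

lemma fock_op_sum: "finite A \<Longrightarrow> fock_op j (\<lambda>w. \<Sum>x\<in>A. c x * V x w) w = (\<Sum>x\<in>A. c x * fock_op j (V x) w)"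
  by (simp add: fock_op_def sum.distrib algebra_simps)

lemma foldr_fock_op_sum:
  assumes "finite A"
  shows "foldr fock_op js (\<lambda>w. \<Sum>x\<in>A. c x * V x w) = (\<lambda>w. \<Sum>x\<in>A. c x * foldr fock_op js (V x) w)"
proof (induction js)
  case (Cons j js)
  show ?case unfolding foldr.simps comp_def Cons.IH by (simp add: fun_eq_iff fock_op_sum[OF assms])
qed simp

lemma free_op_superset:
  assumes "finite A" "Poly_Mapping.keys x \<subseteq> A"
  shows "free_op x v w = (\<Sum>u\<in>A. Poly_Mapping.lookup x u * foldr fock_op (letters u) v w)"
  unfolding free_op_def using assms by (intro sum.mono_neutral_left) (auto simp: in_keys_iff)

lemma free_op_add: "free_op (x + y) v w = free_op x v w + free_op y v w"
proof -
  have "Poly_Mapping.keys (x + y) \<subseteq> Poly_Mapping.keys x \<union> Poly_Mapping.keys y" by (rule keys_add)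
  then show ?thesis
    using free_op_superset[of "Poly_Mapping.keys x \<union> Poly_Mapping.keys y" x v w] free_op_superset[of "Poly_Mapping.keys x \<union> Poly_Mapping.keys y" y v w]
      free_op_superset[of "Poly_Mapping.keys x \<union> Poly_Mapping.keys y" "x + y" v w]
    by (simp add: lookup_add algebra_simps sum.distrib)
qed

lemma free_op_0: "free_op 0 v w = 0"
  by (simp add: free_op_def)

lemma free_op_sum: "free_op (\<Sum>i\<in>A. x i) v w = (\<Sum>i\<in>A. free_op (x i) v w)"
  by (induction A rule: infinite_finite_induct) (auto simp: free_op_0 free_op_add)

lemma free_op_single: "free_op (Poly_Mapping.single u c) v w = c * foldr fock_op (letters u) v w"
  by (subst free_op_superset[of "{u}"]) auto

lemma free_algebra_eq_sum: "x = (\<Sum>u\<in>Poly_Mapping.keys x. Poly_Mapping.single u (Poly_Mapping.lookup x u))"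
  by (rule poly_mapping_eqI)
    (auto simp: lookup_sum lookup_single when_def in_keys_iff sum.delta')

lemma free_op_mult: "free_op (x * y) v = free_op x (free_op y v)"
proof
  fix w
  have "x * y = (\<Sum>u\<in>Poly_Mapping.keys x. Poly_Mapping.single u (Poly_Mapping.lookup x u)) * (\<Sum>u\<in>Poly_Mapping.keys y. Poly_Mapping.single u (Poly_Mapping.lookup y u))"
    using free_algebra_eq_sum[of x] free_algebra_eq_sum[of y] by simp
  also have "\<dots> = (\<Sum>u\<in>Poly_Mapping.keys x. \<Sum>t\<in>Poly_Mapping.keys y. Poly_Mapping.single (u + t) (Poly_Mapping.lookup x u * Poly_Mapping.lookup y t))"
    by (simp add: sum_product mult_single)
  finally have "free_op (x * y) v w =
      (\<Sum>u\<in>Poly_Mapping.keys x. \<Sum>t\<in>Poly_Mapping.keys y. Poly_Mapping.lookup x u * Poly_Mapping.lookup y t * foldr fock_op (letters u) (foldr fock_op (letters t) v) w)"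
    by (simp add: free_op_sum free_op_single plus_word_def)
  also have "\<dots> = (\<Sum>u\<in>Poly_Mapping.keys x. Poly_Mapping.lookup x u * foldr fock_op (letters u) (\<lambda>w. \<Sum>t\<in>Poly_Mapping.keys y. Poly_Mapping.lookup y t * foldr fock_op (letters t) v w) w)"
    by (simp add: foldr_fock_op_sum sum_distrib_left mult.assoc)
  also have "\<dots> = free_op x (free_op y v) w"
    by (simp add: free_op_def[abs_def])
  finally show "free_op (x * y) v w = free_op x (free_op y v) w" .
qed

lemma free_op_1: "free_op 1 v = v"
  by (simp add: fun_eq_iff free_op_single zero_word_def flip: single_one)

lemma free_op_scale: "free_op (free_algebra_scale c x) v w = c * free_op x v w"
  by (simp add: free_algebra_scale_def free_op_mult free_op_single zero_word_def)

lemma free_op_generator: "free_op (free_generator j) v = fock_op j v"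
  by (simp add: fun_eq_iff free_generator_def free_op_single)

lemma free_op_generator_power: "free_op (free_generator j ^ k) v = (fock_op j ^^ k) v"
  by (induction k) (auto simp: free_op_1 free_op_mult free_op_generator)

lemma free_op_generator_prod: "free_op (prod_list (map free_generator js)) v = foldr fock_op js v"
  by (induction js) (auto simp: free_op_1 free_op_mult free_op_generator)

lemma free_op_poly_eval:
  "free_op (poly_eval free_algebra_scale q (free_generator j)) v w = (\<Sum>k\<le>degree q. coeff q k * (fock_op j ^^ k) v w)"
  by (simp add: poly_eval_def free_op_sum free_op_scale free_op_generator_power)

lemma nc_probability_space_vacuum: "nc_probability_space free_algebra_scale (vacuum_state :: 'i free_algebra \<Rightarrow> complex)"
proof
  show "free_algebra_scale a (x + y) = free_algebra_scale a x + free_algebra_scale a y" for a and x y :: "'i free_algebra"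
    by (simp add: free_algebra_scale_def algebra_simps)
  show "free_algebra_scale (a + b) x = free_algebra_scale a x + free_algebra_scale b x" for a b and x :: "'i free_algebra"
    by (simp add: free_algebra_scale_def algebra_simps single_add)
  show "free_algebra_scale a (free_algebra_scale b x) = free_algebra_scale (a * b) x" for a b and x :: "'i free_algebra"
    by (simp add: free_algebra_scale_def mult.assoc[symmetric] mult_single)
  show "free_algebra_scale 1 x = x" for x :: "'i free_algebra"
    by (simp add: free_algebra_scale_def)
  show "free_algebra_scale c x * y = free_algebra_scale c (x * y)" for c and x y :: "'i free_algebra"
    by (simp add: free_algebra_scale_def mult.assoc)
  \<comment> \<open>The index 0 stands for the empty word, which commutes with every word, so
    scalars are central although the algebra is not commutative.\<close>
  have comm: "Poly_Mapping.single 0 c * x = x * Poly_Mapping.single 0 c" for c and x :: "'i free_algebra"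
  proof -
    have "Poly_Mapping.single 0 c * x = (\<Sum>u\<in>Poly_Mapping.keys x. Poly_Mapping.single u (c * Poly_Mapping.lookup x u))"
      by (subst (1) free_algebra_eq_sum[of x]) (simp add: sum_distrib_left mult_single)
    also have "\<dots> = x * Poly_Mapping.single 0 c"
      by (subst (3) free_algebra_eq_sum[of x]) (simp add: sum_distrib_right mult_single mult.commute)
    finally show ?thesis .
  qed
  show "x * free_algebra_scale c y = free_algebra_scale c (x * y)" for c and x y :: "'i free_algebra"
    unfolding free_algebra_scale_def by (metis comm mult.assoc)
  show "vacuum_state (1 :: 'i free_algebra) = 1"
    by (simp add: vacuum_state_def free_op_1 vacuum_def)
  show "vacuum_state (x + y) = vacuum_state x + vacuum_state y" for x y :: "'i free_algebra"
    by (simp add: vacuum_state_def free_op_add)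
  show "vacuum_state (free_algebra_scale c x) = c * vacuum_state x" for c and x :: "'i free_algebra"
    by (simp add: vacuum_state_def free_op_scale)
qed

text \<open>The j-th operator only changes the number of leading letters \<open>j\<close>. On the
  words with a fixed remainder \<open>u\<close> it acts as on powers of \<open>j\<close> alone, and
  a vector without leading \<open>j\<close> enters there as the vacuum scaled by
  \<open>v u\<close>.\<close>

lemma fock_op_power_replicate:
  assumes v: "\<And>u. v (j # u) = 0" and u: "u = [] \<or> hd u \<noteq> j"
  shows "(fock_op j ^^ k) v (replicate r j @ u) = (fock_op j ^^ k) vacuum (replicate r j) * v u"
proof (induction k arbitrary: r)
  case 0
  then show ?case using v by (cases r) (auto simp: vacuum_def)
next
  case (Suc k)
  note IH = Suc.IH[of 0] Suc.IH[of "Suc 0"] Suc.IH[of r] Suc.IH[of "Suc r"] Suc.IH[of "r - 1"]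
  show ?case
  proof (cases r)
    case 0
    then show ?thesis using IH u by (auto simp: fock_op_def algebra_simps)
  next
    case (Suc r')
    then show ?thesis using IH by (auto simp: fock_op_def algebra_simps)
  qed
qed

text \<open>What is proved is stronger than vanishing of the vacuum coefficient: the alternating
  product sends the vacuum to a vector supported on words that begin with the leftmost index of the
  product. This passes from one factor to the next because neighbouring indices differ.\<close>

lemma free_family_generators: "free_family free_algebra_scale vacuum_state J free_generator"
  unfolding free_family_def
proof (intro allI impI)
  fix qs :: "('a \<times> complex poly) list"
  let ?prod = "\<lambda>qs. prod_list (map (\<lambda>(i, q). poly_eval free_algebra_scale q (free_generator i)) qs)"
  assume "qs \<noteq> [] \<and> fst ` set qs \<subseteq> J \<and> distinct_adj (map fst qs) \<and>
    (\<forall>(i, q)\<in>set qs. vacuum_state (poly_eval free_algebra_scale q (free_generator i)) = 0)"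
  then have "qs \<noteq> []" "distinct_adj (map fst qs)"
    "\<forall>(i, q)\<in>set qs. vacuum_state (poly_eval free_algebra_scale q (free_generator i)) = 0" by auto
  then have "\<forall>w. w = [] \<or> hd w \<noteq> fst (hd qs) \<longrightarrow> free_op (?prod qs) vacuum w = 0"
  proof (induction qs)
    case (Cons x qs)
    obtain j q where x: "x = (j, q)" by (cases x)
    define v where "v = free_op (?prod qs) vacuum"
    have v: "v (j # u) = 0" for u
    proof (cases "qs = []")
      case True
      then show ?thesis by (simp add: v_def free_op_1 vacuum_def)
    next
      case False
      then have "fst (hd qs) \<noteq> j" "distinct_adj (map fst qs)"
        using Cons.prems(2) x by (auto simp: distinct_adj_Cons hd_map)
      then show ?thesis using Cons.IH False Cons.prems(3) by (auto simp: v_def)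
    qed
    show ?case
    proof (intro allI impI)
      fix w assume w: "w = [] \<or> hd w \<noteq> fst (hd (x # qs))"
      have "free_op (?prod (x # qs)) vacuum w = (\<Sum>k\<le>degree q. coeff q k * (fock_op j ^^ k) v w)"
        by (simp add: x free_op_mult free_op_poly_eval v_def)
      \<comment> \<open>Centredness enters here: on words without leading \<open>j\<close> the
        factor acts as multiplication by its own vacuum expectation.\<close>
      also have "\<dots> = (\<Sum>k\<le>degree q. coeff q k * (fock_op j ^^ k) vacuum []) * v w"
        using fock_op_power_replicate[of v j w _ 0] v w x by (simp add: sum_distrib_right mult.assoc)
      also have "(\<Sum>k\<le>degree q. coeff q k * (fock_op j ^^ k) vacuum []) = vacuum_state (poly_eval free_algebra_scale q (free_generator j))"
        by (simp add: vacuum_state_def free_op_poly_eval)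
      also have "\<dots> = 0" using Cons.prems(3) x by auto
      finally show "free_op (?prod (x # qs)) vacuum w = 0" by simp
    qed
  qed simp
  then show "vacuum_state (?prod qs) = 0" by (simp add: vacuum_state_def)
qed

section \<open>Vacuum moments\<close>

definition word_moment :: "'i list \<Rightarrow> complex" where
  "word_moment js = foldr fock_op js vacuum []"

lemma word_moment_Nil [simp]: "word_moment [] = 1"
  by (simp add: word_moment_def vacuum_def)

text \<open>Contributions are sorted by the last operator whose creation part writes the displayed
  letter \<open>j\<close> directly onto \<open>u\<close>. It is the operator at position
  \<open>i\<close>; those applied afterwards, \<open>take i js\<close>, act above that letter as
  they would on the vacuum.\<close>

lemma foldr_fock_op_vacuum_append:
  "foldr fock_op js vacuum (w @ j # u) =
    (\<Sum>i<length js. if js ! i = j then foldr fock_op (take i js) vacuum w *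
       (foldr fock_op (drop (Suc i) js) vacuum u + foldr fock_op (drop (Suc i) js) vacuum (j # u)) else 0)"
proof (induction js arbitrary: w)
  case Nil
  then show ?case by (simp add: vacuum_def)
next
  case (Cons k js)
  define G where "G i = foldr fock_op (drop (Suc i) js) vacuum u + foldr fock_op (drop (Suc i) js) vacuum (j # u)" for i
  let ?F = "\<lambda>w. foldr fock_op js vacuum (w @ j # u)"
  have F: "?F w = (\<Sum>i<length js. if js ! i = j then foldr fock_op (take i js) vacuum w * G i else 0)" for w
    unfolding G_def by (rule Cons.IH)
  have "foldr fock_op (k # js) vacuum (w @ j # u) = ?F w + ?F (k # w) +
      (if w \<noteq> [] \<and> hd w = k then ?F (tl w) + ?F w else 0) +
      (if w = [] \<and> j = k then foldr fock_op js vacuum u + foldr fock_op js vacuum (j # u) else 0)"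
    by (cases w) (auto simp: fock_op_def)
  also have "\<dots> = (\<Sum>i<length js. if js ! i = j then foldr fock_op (take (Suc i) (k # js)) vacuum w * G i else 0) +
      (if w = [] \<and> j = k then foldr fock_op js vacuum u + foldr fock_op js vacuum (j # u) else 0)"
    unfolding F by (auto simp: sum.distrib[symmetric] fock_op_def algebra_simps intro!: sum.cong)
  also have "\<dots> = (\<Sum>i<length (k # js). if (k # js) ! i = j then foldr fock_op (take i (k # js)) vacuum w *
       (foldr fock_op (drop (Suc i) (k # js)) vacuum u + foldr fock_op (drop (Suc i) (k # js)) vacuum (j # u)) else 0)"
    unfolding length_Cons sum.lessThan_Suc_shift by (auto simp: vacuum_def G_def cong: if_cong)
  finally show ?case .
qed

text \<open>The coefficients at the empty word and at the one-letter word left over by the preceding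
  lemma combine into one more application of the j-th operator. Hence \<open>drop i js\<close>, with
  its head \<open>j\<close>, appears instead of \<open>drop (Suc i) js\<close>.\<close>

lemma word_moment_Cons:
  "word_moment (j # js) = word_moment js + (\<Sum>i<length js. if js ! i = j then word_moment (take i js) * word_moment (drop i js) else 0)"
proof -
  have "word_moment (j # js) = word_moment js + foldr fock_op js vacuum ([] @ j # [])"
    by (simp add: word_moment_def fock_op_def)
  also have "foldr fock_op js vacuum ([] @ j # []) = (\<Sum>i<length js. if js ! i = j then word_moment (take i js) * word_moment (drop i js) else 0)"
    unfolding foldr_fock_op_vacuum_append
  proof (intro sum.cong refl)
    fix i assume "i \<in> {..<length js}"
    then have "drop i js = js ! i # drop (Suc i) js" by (simp add: Cons_nth_drop_Suc)
    then show "(if js ! i = j then foldr fock_op (take i js) vacuum [] *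
       (foldr fock_op (drop (Suc i) js) vacuum [] + foldr fock_op (drop (Suc i) js) vacuum [j]) else 0) =
      (if js ! i = j then word_moment (take i js) * word_moment (drop i js) else 0)"
      by (simp add: word_moment_def fock_op_def)
  qed
  finally show ?thesis .
qed

lemma vacuum_state_prod: "vacuum_state (prod_list (map free_generator js)) = word_moment js"
  by (simp add: vacuum_state_def free_op_generator_prod word_moment_def)

lemma vacuum_state_power: "vacuum_state (free_generator j ^ k) = word_moment (replicate k j)"
  using vacuum_state_prod[of "replicate k j"] by (simp add: map_replicate_const)

section \<open>Non-crossing partitions and Catalan numbers\<close>

text \<open>The last point of the interval is the first letter of the reversed word. Choosing a
  later equal letter in the moment recursion corresponds to choosing the image of the last point,
  and the two subwords to the two intervals.\<close>

lemma word_moment_eq_card_planar_maps: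
  "a \<le> b \<Longrightarrow> word_moment (map f (rev [a..<b])) = of_nat (card (planar_maps a b f))"
proof (induction "b - a" arbitrary: a b rule: less_induct)
  case less
  show ?case
  proof (cases "a = b")
    case True
    then show ?thesis by (simp add: card_planar_maps_self)
  next
    case False
    define c where "c = b - 1"
    have c: "b = Suc c" "a \<le> c" using less.prems False by (auto simp: c_def)
    let ?js = "map f (rev [a..<c])"
    let ?N = "\<lambda>a b. of_nat (card (planar_maps a b f)) :: complex"
    have IH: "word_moment (map f (rev [x..<y])) = ?N x y" if "x \<le> y" "y - x < b - a" for x y
      using less.hyps[OF that(2,1)] .
    \<comment> \<open>Position \<open>i\<close> of the reversed word is the point
      \<open>c - Suc i\<close>, whose successor \<open>c - i\<close> separates the two
      intervals.\<close>
    have idx: "?js ! i = f (c - Suc i)" "take i ?js = map f (rev [c - i..<c])" "drop i ?js = map f (rev [a..<c - i])"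
      if i: "i < c - a" for i
    proof -
      show "?js ! i = f (c - Suc i)" using i by (simp add: rev_nth)
      have e: "a + (c - a - i) = c - i" using i by linarith
      show "take i ?js = map f (rev [c - i..<c])"
        using i e by (simp add: take_map take_rev drop_upt)
      show "drop i ?js = map f (rev [a..<c - i])"
        using i e by (simp add: drop_map drop_rev take_upt)
    qed
    have "word_moment (map f (rev [a..<b])) = word_moment (f c # ?js)"
      using c by simp
    also have "\<dots> = word_moment ?js + (\<Sum>i<c - a. if f (c - Suc i) = f c then ?N (c - i) c * ?N a (c - i) else 0)"
      unfolding word_moment_Cons
    proof (intro arg_cong2[of _ _ _ _ "(+)"] refl sum.cong)
      show "{..<length ?js} = {..<c - a}" by simp
      fix i assume i: "i \<in> {..<c - a}"
      then have "c - i \<le> c" "c - (c - i) < b - a" "a \<le> c - i" "c - i - a < b - a" using c by auto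
      note IH' = IH[OF this(1,2)] IH[OF this(3,4)]
      from i have "i < c - a" by simp
      note idx' = idx[OF this]
      show "(if ?js ! i = f c then word_moment (take i ?js) * word_moment (drop i ?js) else 0) =
        (if f (c - Suc i) = f c then ?N (c - i) c * ?N a (c - i) else 0)"
        unfolding idx' IH' ..
    qed
    also have "word_moment ?js = ?N a c" using IH[of a c] c by simp
    also have "(\<Sum>i<c - a. if f (c - Suc i) = f c then ?N (c - i) c * ?N a (c - i) else 0) =
      (\<Sum>i\<in>{a..<c}. if f i = f c then ?N (Suc i) c * ?N a (Suc i) else 0)"
    proof (rule sum.reindex_bij_witness[of _ "\<lambda>i. c - Suc i" "\<lambda>i. c - Suc i"])
      fix i assume "i \<in> {..<c - a}"
      then have "Suc (c - Suc i) = c - i" by auto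
      then show "(if f (c - Suc i) = f c then ?N (Suc (c - Suc i)) c * ?N a (Suc (c - Suc i)) else 0) =
        (if f (c - Suc i) = f c then ?N (c - i) c * ?N a (c - i) else 0)" by simp
    qed auto
    also have "?N a c + \<dots> = ?N a (Suc c)"
      unfolding card_planar_maps_Suc[OF c(2)] of_nat_add of_nat_sum of_nat_mult
      by (subst sum.inter_filter) auto
    finally show ?thesis by (simp only: c)
  qed
qed

fun catalan :: "nat \<Rightarrow> nat" where
  "catalan 0 = 1"
| "catalan (Suc n) = (\<Sum>i\<le>n. catalan i * catalan (n - i))"

declare catalan.simps(2) [simp del]

text \<open>The term without a chosen letter supplies the summand with index n of the Catalan
  recursion.\<close>

lemma word_moment_replicate: "word_moment (replicate k j) = of_nat (catalan k)"
proof (induction k rule: less_induct)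
  case (less k)
  show ?case
  proof (cases k)
    case (Suc n)
    have "word_moment (replicate k j) = word_moment (replicate n j) +
        (\<Sum>i<n. word_moment (replicate i j) * word_moment (replicate (n - i) j))"
      unfolding Suc replicate_Suc word_moment_Cons
      by (intro arg_cong2[of _ _ _ _ "(+)"] refl sum.cong) auto
    also have "\<dots> = of_nat (catalan n) + (\<Sum>i<n. of_nat (catalan i) * of_nat (catalan (n - i)))"
      by (intro arg_cong2[of _ _ _ _ "(+)"] sum.cong refl arg_cong2[of _ _ _ _ "(*)"] less.IH) (auto simp: Suc)
    also have "\<dots> = of_nat (catalan k)"
      unfolding Suc catalan.simps lessThan_Suc_atMost[symmetric] by simp
    finally show ?thesis .
  qed simp
qed

text \<open>Stated for arbitrary intervals, like \<open>planar\<close>, so that both halves of a cut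
  are of the same kind.\<close>

definition interval_ncp :: "nat \<Rightarrow> nat \<Rightarrow> nat set set set" where
  "interval_ncp a b =
     {P. partition_on {a..<b} P \<and>
         \<not> (\<exists>A\<in>P. \<exists>B\<in>P. A \<noteq> B \<and>
              (\<exists>x\<in>A. \<exists>y\<in>B. \<exists>z\<in>A. \<exists>w\<in>B. x < y \<and> y < z \<and> z < w))}"

lemma interval_ncpI:
  assumes "\<Union>P = {a..<b}" "{} \<notin> P"
    and "\<And>A B x. A \<in> P \<Longrightarrow> B \<in> P \<Longrightarrow> x \<in> A \<Longrightarrow> x \<in> B \<Longrightarrow> A = B"
    and "\<And>A B x y z w. A \<in> P \<Longrightarrow> B \<in> P \<Longrightarrow> A \<noteq> B \<Longrightarrow> x \<in> A \<Longrightarrow> y \<in> B \<Longrightarrow> z \<in> A \<Longrightarrow> w \<in> B \<Longrightarrow>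
      x < y \<Longrightarrow> y < z \<Longrightarrow> z < w \<Longrightarrow> False"
  shows "P \<in> interval_ncp a b"
  unfolding interval_ncp_def mem_Collect_eq
proof
  show "partition_on {a..<b} P"
  proof (rule partition_onI)
    show "\<Union>P = {a..<b}" by fact
    show "{} \<notin> P" by fact
    show "disjnt p q" if "p \<in> P" "q \<in> P" "p \<noteq> q" for p q
      unfolding disjnt_iff using assms(3)[OF that(1,2)] that(3) by blast
  qed
  show "\<not> (\<exists>A\<in>P. \<exists>B\<in>P. A \<noteq> B \<and> (\<exists>x\<in>A. \<exists>y\<in>B. \<exists>z\<in>A. \<exists>w\<in>B. x < y \<and> y < z \<and> z < w))"
  proof
  assume "\<exists>A\<in>P. \<exists>B\<in>P. A \<noteq> B \<and> (\<exists>x\<in>A. \<exists>y\<in>B. \<exists>z\<in>A. \<exists>w\<in>B. x < y \<and> y < z \<and> z < w)"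
  then show False by (elim bexE conjE) (rule assms(4))
  qed
qed

lemma interval_ncpD:
  assumes "P \<in> interval_ncp a b"
  shows "\<Union>P = {a..<b}" "{} \<notin> P"
    and "A \<in> P \<Longrightarrow> B \<in> P \<Longrightarrow> x \<in> A \<Longrightarrow> x \<in> B \<Longrightarrow> A = B"
    and "A \<in> P \<Longrightarrow> B \<in> P \<Longrightarrow> A \<noteq> B \<Longrightarrow> x \<in> A \<Longrightarrow> y \<in> B \<Longrightarrow> z \<in> A \<Longrightarrow> w \<in> B \<Longrightarrow>
      x < y \<Longrightarrow> y < z \<Longrightarrow> z < w \<Longrightarrow> False"
    and "A \<in> P \<Longrightarrow> A \<subseteq> {a..<b}" and "A \<in> P \<Longrightarrow> A \<noteq> {}"
proof -
  have p: "partition_on {a..<b} P" and c: "\<not> (\<exists>A\<in>P. \<exists>B\<in>P. A \<noteq> B \<and>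
              (\<exists>x\<in>A. \<exists>y\<in>B. \<exists>z\<in>A. \<exists>w\<in>B. x < y \<and> y < z \<and> z < w))"
    using assms by (auto simp: interval_ncp_def)
  show U: "\<Union>P = {a..<b}" using partition_onD1[OF p] by simp
  show ne: "{} \<notin> P" by (rule partition_onD3[OF p])
  show "A \<subseteq> {a..<b}" if "A \<in> P" using U that by blast
  show "A \<noteq> {}" if "A \<in> P" using ne that by blast
  show "A = B" if "A \<in> P" "B \<in> P" "x \<in> A" "x \<in> B"
    using disjointD[OF partition_onD2[OF p] that(1,2)] that(3,4) by blast
  show False if "A \<in> P" "B \<in> P" "A \<noteq> B" "x \<in> A" "y \<in> B" "z \<in> A" "w \<in> B" "x < y" "y < z" "z < w"
    using c that by blast
qed

lemma noncrossing_partitions_eq: "noncrossing_partitions k = interval_ncp 1 (Suc k)"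
  unfolding noncrossing_partitions_def interval_ncp_def by (simp add: atLeastLessThanSuc_atLeastAtMost)

lemma finite_interval_ncp: "finite (interval_ncp a b)"
proof (rule finite_subset)
  show "interval_ncp a b \<subseteq> Pow (Pow {a..<b})"
    using interval_ncpD(5) by blast
qed simp

text \<open>The counterpart of \<open>glue\<close> for partitions: \<open>P\<close> lives strictly
  between \<open>i\<close> and \<open>b\<close>, and \<open>b\<close> joins the block of
  \<open>i\<close> in \<open>Q\<close>.\<close>

definition join_ncp :: "nat \<Rightarrow> nat \<Rightarrow> nat set set \<times> nat set set \<Rightarrow> nat set set" where
  "join_ncp i b = (\<lambda>(P, Q). P \<union> (\<lambda>B. if i \<in> B then insert b B else B) ` Q)"

definition split_ncp :: "nat \<Rightarrow> nat \<Rightarrow> nat set set \<Rightarrow> nat set set \<times> nat set set" where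
  "split_ncp i b P = ({C \<in> P. C \<subseteq> {Suc i..<b}}, (\<lambda>C. C - {b}) ` {C \<in> P. \<not> C \<subseteq> {Suc i..<b}})"

text \<open>The point \<open>i\<close> is the predecessor of \<open>b\<close> in its block;
  partitions are sorted by this datum.\<close>

definition ncp_last :: "nat \<Rightarrow> nat \<Rightarrow> nat \<Rightarrow> nat set set set" where
  "ncp_last a b i = {P \<in> interval_ncp a (Suc b). \<exists>B\<in>P. b \<in> B \<and> i \<in> B \<and> B \<inter> {Suc i..<b} = {}}"

lemma join_ncp_mem:
  assumes i: "a \<le> i" "i < b" and P: "P \<in> interval_ncp (Suc i) b" and Q: "Q \<in> interval_ncp a (Suc i)"
  shows "join_ncp i b (P, Q) \<in> ncp_last a b i"
proof -
  define g where "g B = (if i \<in> B then insert b B else B)" for B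
  let ?R = "join_ncp i b (P, Q)"
  note Pd = interval_ncpD[OF P] and Qd = interval_ncpD[OF Q]
  have PB: "A \<subseteq> {Suc i..<b}" if "A \<in> P" for A using Pd(5)[OF that] .
  have QB: "A \<subseteq> {a..i}" if "A \<in> Q" for A using Qd(5)[OF that] by auto
  have gB: "g A \<subseteq> {a..i} \<union> {b}" if "A \<in> Q" for A using QB[OF that] by (auto simp: g_def)
  have gmem: "x \<in> A" if "x \<in> g A" "x \<noteq> b" for x A using that by (auto simp: g_def split: if_splits)
  have gb: "i \<in> A" if "b \<in> g A" "A \<in> Q" for A using that QB[OF that(2)] i by (auto simp: g_def split: if_splits)
  have R: "C \<in> ?R \<longleftrightarrow> C \<in> P \<or> (\<exists>A\<in>Q. C = g A)" for C by (auto simp: join_ncp_def g_def)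
  have "i \<in> \<Union>Q" using Qd(1) i by simp
  then obtain B where B: "B \<in> Q" "i \<in> B" by (elim UnionE)
  have "?R \<in> interval_ncp a (Suc b)"
  proof (rule interval_ncpI)
    have "\<Union>?R = {Suc i..<b} \<union> \<Union>(g ` Q)" using Pd(1) by (auto simp: join_ncp_def g_def)
    also have "\<Union>(g ` Q) = {a..<Suc i} \<union> {b}"
      unfolding Qd(1)[symmetric] using B by (auto simp: g_def)
    finally show "\<Union>?R = {a..<Suc b}" using i by auto
    show "{} \<notin> ?R" using Pd(2) Qd(2) by (auto simp: R g_def split: if_splits)
  next
    fix A B x assume A: "A \<in> ?R" and B: "B \<in> ?R" and x: "x \<in> A" "x \<in> B"
    have both: "g A' = g B'" if "A' \<in> Q" "B' \<in> Q" "x \<in> g A'" "x \<in> g B'" for A' B'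
    proof (cases "x = b")
      case True
      then have "i \<in> A'" "i \<in> B'" using gb that by blast+
      then show ?thesis using Qd(3)[OF that(1,2)] by blast
    next
      case False
      then have "x \<in> A'" "x \<in> B'" using gmem that by blast+
      then show ?thesis using Qd(3)[OF that(1,2)] by blast
    qed
    have mixed: False if P': "A' \<in> P" "x \<in> A'" and Q': "B' \<in> Q" "x \<in> g B'" for A' B'
    proof -
      have "x \<in> {Suc i..<b}" using PB[OF P'(1)] P'(2) by (rule subsetD)
      moreover have "x \<in> {a..i} \<union> {b}" using gB[OF Q'(1)] Q'(2) by (rule subsetD)
      ultimately show False by auto
    qed
    consider "A \<in> P" "B \<in> P" | B' where "A \<in> P" "B' \<in> Q" "B = g B'" | A' where "A' \<in> Q" "A = g A'" "B \<in> P"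
      | A' B' where "A' \<in> Q" "A = g A'" "B' \<in> Q" "B = g B'"
      using A B unfolding R by blast
    then show "A = B"
    proof cases
      case 1 then show ?thesis by (rule Pd(3)[OF _ _ x])
    next
      case (2 B')
      then show ?thesis using mixed[OF 2(1) x(1) 2(2)] x(2) by simp
    next
      case (3 A')
      then show ?thesis using mixed[OF 3(3) x(2) 3(1)] x(1) by simp
    next
      case (4 A' B')
      then show ?thesis using both[OF 4(1,3)] x by simp
    qed
  next
    fix A B x y z w assume A: "A \<in> ?R" and B: "B \<in> ?R" and AB: "A \<noteq> B"
      and m: "x \<in> A" "y \<in> B" "z \<in> A" "w \<in> B" and o: "x < y" "y < z" "z < w"
    consider "A \<in> P" "B \<in> P" | B' where "A \<in> P" "B' \<in> Q" "B = g B'" | A' where "A' \<in> Q" "A = g A'" "B \<in> P"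
      | A' B' where "A' \<in> Q" "A = g A'" "B' \<in> Q" "B = g B'"
      using A B unfolding R by blast
    then show False
    proof cases
      case 1 then show ?thesis using Pd(4)[OF 1 AB m o] by simp
    next
      case (2 B')
      have "x \<in> {Suc i..<b}" "z \<in> {Suc i..<b}" using PB[OF 2(1)] m by blast+
      moreover have "y \<in> {a..i} \<union> {b}" using gB[OF 2(2)] m(2) 2(3) by blast
      ultimately show ?thesis using o by auto
    next
      case (3 A')
      have "y \<in> {Suc i..<b}" "w \<in> {Suc i..<b}" using PB[OF 3(3)] m by blast+
      moreover have "z \<in> {a..i} \<union> {b}" using gB[OF 3(1)] m(3) 3(2) by blast
      ultimately show ?thesis using o by auto
    next
      case (4 A' B')
      have wb: "w \<le> b" using subsetD[OF gB[OF 4(3)], of w] m(4) 4(4) i by auto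
      then have ne: "x \<noteq> b" "y \<noteq> b" "z \<noteq> b" using o by auto
      have x: "x \<in> A'" "z \<in> A'" using gmem[of x A'] gmem[of z A'] m ne 4(2) by simp_all
      have y: "y \<in> B'" using gmem[of y B'] m ne 4(4) by simp
      have AB': "A' \<noteq> B'" using AB 4 by auto
      show ?thesis
      \<comment> \<open>A crossing that ends in the added point \<open>b\<close> is turned into one
        ending in \<open>i\<close>, which belongs to the same block and lies beyond
        \<open>z\<close>.\<close>
      proof (cases "w = b")
        case True
        then have iB: "i \<in> B'" using gb[OF _ 4(3)] m(4) 4(4) by simp
        have "z \<le> i" using QB[OF 4(1)] x by auto
        moreover have "z \<noteq> i" using Qd(3)[OF 4(1,3), of i] iB x AB' by auto
        ultimately have "z < i" by simp
        then show ?thesis using Qd(4)[OF 4(1,3) AB' x(1) y x(2) iB o(1,2)] by simp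
      next
        case False
        then have "w \<in> B'" using gmem[of w B'] m(4) 4(4) by simp
        then show ?thesis using Qd(4)[OF 4(1,3) AB' x(1) y x(2) _ o] by simp
      qed
    qed
  qed
  moreover have "g B \<in> ?R" unfolding R by (rule disjI2, rule bexI[OF refl B(1)])
  moreover have "b \<in> g B" "i \<in> g B" using B(2) by (simp_all add: g_def)
  moreover have "g B \<inter> {Suc i..<b} = {}" using gB[OF B(1)] by auto
  ultimately show ?thesis unfolding ncp_last_def by blast
qed

lemma split_join_ncp:
  assumes i: "a \<le> i" "i < b" and P: "P \<in> interval_ncp (Suc i) b" and Q: "Q \<in> interval_ncp a (Suc i)"
  shows "split_ncp i b (join_ncp i b (P, Q)) = (P, Q)"
proof -
  let ?g = "\<lambda>B. if i \<in> B then insert b B else B"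
  have PB: "A \<subseteq> {Suc i..<b}" if "A \<in> P" for A using interval_ncpD(5)[OF P that] .
  have QB: "A \<subseteq> {a..i}" "A \<noteq> {}" if "A \<in> Q" for A using interval_ncpD(5,6)[OF Q that] by auto
  have n: "\<not> ?g A \<subseteq> {Suc i..<b}" if AQ: "A \<in> Q" for A
  proof -
    obtain x where x: "x \<in> A" using QB(2)[OF AQ] by auto
    then have "x \<le> i" using QB(1)[OF AQ] by auto
    then show ?thesis using x by (auto split: if_splits)
  qed
  have d: "?g A - {b} = A" if "A \<in> Q" for A using QB[OF that] i by auto
  have 1: "{C \<in> P \<union> ?g ` Q. C \<subseteq> {Suc i..<b}} = P" using PB n by blast
  have 2: "{C \<in> P \<union> ?g ` Q. \<not> C \<subseteq> {Suc i..<b}} = ?g ` Q" using PB n by blast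
  have 3: "(\<lambda>C. C - {b}) ` ?g ` Q = Q" unfolding image_image using d by simp
  show ?thesis unfolding split_ncp_def join_ncp_def prod.case 1 2 3 ..
qed

text \<open>The block containing \<open>i\<close> and \<open>b\<close> acts as a barrier: another
  block with points on both sides of \<open>i\<close> would cross it. No other block can therefore
  be cut by the splitting.\<close>

lemma ncp_last_split:
  assumes i: "a \<le> i" "i < b" and R: "R \<in> ncp_last a b i"
  shows "fst (split_ncp i b R) \<in> interval_ncp (Suc i) b" "snd (split_ncp i b R) \<in> interval_ncp a (Suc i)"
    and "join_ncp i b (split_ncp i b R) = R"
proof -
  let ?g = "\<lambda>B. if i \<in> B then insert b B else B"
  have RN: "R \<in> interval_ncp a (Suc b)" using R by (simp add: ncp_last_def)
  obtain B where B: "B \<in> R" "b \<in> B" "i \<in> B" "B \<inter> {Suc i..<b} = {}" using R by (auto simp: ncp_last_def)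
  note Rd = interval_ncpD[OF RN]
  \<comment> \<open>A violation gives points x < i < y < b of the two blocks in alternation.\<close>
  have dich: "C \<subseteq> {Suc i..<b} \<or> C \<subseteq> {a..<i}" if C: "C \<in> R" "C \<noteq> B" for C
  proof (rule ccontr)
    assume n: "\<not> (C \<subseteq> {Suc i..<b} \<or> C \<subseteq> {a..<i})"
    have ib: "i \<notin> C" "b \<notin> C" using Rd(3)[OF C(1) B(1)] B C(2) by blast+
    have Cab: "x \<in> {a..<Suc b}" if "x \<in> C" for x using Rd(5)[OF C(1)] that by blast
    obtain x y where x: "x \<in> C" "x \<notin> {Suc i..<b}" and y: "y \<in> C" "y \<notin> {a..<i}" using n by blast
    have "x < i" using x Cab[of x] ib by (cases "x = b"; cases "x = i") auto
    moreover have "i < y" "y < b" using y Cab[of y] ib by (cases "y = b"; cases "y = i"; auto)+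
    ultimately show False using Rd(4)[OF C(1) B(1) C(2) x(1) B(3) y(1) B(2)] by simp
  qed
  have Bsub: "B - {b} \<subseteq> {a..<Suc i}"
  proof
    fix x assume x: "x \<in> B - {b}"
    then have "x \<in> {a..<Suc b}" using Rd(5)[OF B(1)] by blast
    moreover have "x \<notin> {Suc i..<b}" using B(4) x by blast
    ultimately show "x \<in> {a..<Suc i}" using x by auto
  qed
  let ?P = "{C \<in> R. C \<subseteq> {Suc i..<b}}" and ?Q = "{C \<in> R. \<not> C \<subseteq> {Suc i..<b}}"
  have Qsub: "C - {b} \<subseteq> {a..<Suc i}" "C - {b} \<noteq> {}" if "C \<in> ?Q" for C
  proof -
    show "C - {b} \<subseteq> {a..<Suc i}"
    proof (cases "C = B")
      case False
      then have "C \<subseteq> {a..<i}" using dich[of C] that by blast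
      moreover have "{a..<i} \<subseteq> {a..<Suc i}" by auto
      ultimately show ?thesis by blast
    qed (use Bsub in simp)
    show "C - {b} \<noteq> {}"
    proof (cases "C = B")
      case False
      then have C: "C \<subseteq> {a..<i}" "C \<noteq> {}" using dich[of C] Rd(6)[of C] that by blast+
      then have "b \<notin> C" using i by auto
      then show ?thesis using C(2) by simp
    qed (use B i in auto)
  qed
  show "fst (split_ncp i b R) \<in> interval_ncp (Suc i) b"
    unfolding split_ncp_def fst_conv
  proof (rule interval_ncpI)
    show "\<Union>?P = {Suc i..<b}"
    proof (intro equalityI subsetI)
      fix x assume x: "x \<in> {Suc i..<b}"
      then have "x \<in> \<Union>R" using Rd(1) i by simp
      then obtain C where C: "C \<in> R" "x \<in> C" by blast
      then have "C \<noteq> B" using B(4) x by blast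
      moreover have "\<not> C \<subseteq> {a..<i}" using C(2) x by auto
      ultimately have "C \<subseteq> {Suc i..<b}" using dich[OF C(1)] by simp
      then show "x \<in> \<Union>?P" using C by blast
    qed blast
    show "{} \<notin> ?P" using Rd(2) by blast
    show "A = B" if "A \<in> ?P" "B \<in> ?P" "x \<in> A" "x \<in> B" for A B x using Rd(3)[of A B x] that by blast
    show False if "A \<in> ?P" "B \<in> ?P" "A \<noteq> B" "x \<in> A" "y \<in> B" "z \<in> A" "w \<in> B" "x < y" "y < z" "z < w" for A B x y z w
      using Rd(4)[of A B x y z w] that by blast
  qed
  show "snd (split_ncp i b R) \<in> interval_ncp a (Suc i)"
    unfolding split_ncp_def snd_conv
  proof (rule interval_ncpI)
    show "\<Union>((\<lambda>C. C - {b}) ` ?Q) = {a..<Suc i}"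
    proof (intro equalityI subsetI)
      fix x assume x: "x \<in> {a..<Suc i}"
      then have "x \<in> \<Union>R" using Rd(1) i by simp
      then obtain C where C: "C \<in> R" "x \<in> C" by blast
      then have "\<not> C \<subseteq> {Suc i..<b}" "x \<noteq> b" using x i by auto
      then show "x \<in> \<Union>((\<lambda>C. C - {b}) ` ?Q)" using C by blast
    next
      fix x assume "x \<in> \<Union>((\<lambda>C. C - {b}) ` ?Q)"
      then obtain C where "C \<in> ?Q" "x \<in> C - {b}" by blast
      then show "x \<in> {a..<Suc i}" using Qsub(1) by blast
    qed
    show "{} \<notin> (\<lambda>C. C - {b}) ` ?Q" using Qsub(2) by blast
  next
    fix A B x assume "A \<in> (\<lambda>C. C - {b}) ` ?Q" "B \<in> (\<lambda>C. C - {b}) ` ?Q" and x: "x \<in> A" "x \<in> B"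
    then obtain A' B' where AB: "A = A' - {b}" "B = B' - {b}" "A' \<in> R" "B' \<in> R" by blast
    then have "A' = B'" using x Rd(3)[of A' B' x] by blast
    then show "A = B" using AB by simp
  next
    fix A B x y z w assume "A \<in> (\<lambda>C. C - {b}) ` ?Q" "B \<in> (\<lambda>C. C - {b}) ` ?Q" and ne: "A \<noteq> B"
      and m: "x \<in> A" "y \<in> B" "z \<in> A" "w \<in> B" and o: "x < y" "y < z" "z < w"
    then obtain A' B' where AB: "A = A' - {b}" "B = B' - {b}" "A' \<in> R" "B' \<in> R" by blast
    then show False using Rd(4)[of A' B' x y z w] ne m o by blast
  qed
  have gd: "?g (C - {b}) = C" if "C \<in> ?Q" for C
  proof (cases "C = B")
    case True
    then show ?thesis using B i by auto
  next
    case False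
    then have "C \<subseteq> {a..<i}" using dich[of C] that by blast
    then have "i \<notin> C" "b \<notin> C" using i by auto
    then show ?thesis by auto
  qed
  have "?g ` (\<lambda>C. C - {b}) ` ?Q = ?Q" unfolding image_image using gd by simp
  then show "join_ncp i b (split_ncp i b R) = R"
    unfolding split_ncp_def join_ncp_def prod.case by blast
qed

lemma card_ncp_last:
  assumes i: "a \<le> i" "i < b"
  shows "card (ncp_last a b i) = card (interval_ncp (Suc i) b) * card (interval_ncp a (Suc i))"
proof -
  have "bij_betw (split_ncp i b) (ncp_last a b i) (interval_ncp (Suc i) b \<times> interval_ncp a (Suc i))"
  proof (rule bij_betw_byWitness[where f' = "join_ncp i b"])
    show "\<forall>R\<in>ncp_last a b i. join_ncp i b (split_ncp i b R) = R"
      using ncp_last_split(3)[OF i] by (intro ballI)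
    show "\<forall>x\<in>interval_ncp (Suc i) b \<times> interval_ncp a (Suc i). split_ncp i b (join_ncp i b x) = x"
      using split_join_ncp[OF i] by auto
    show "split_ncp i b ` ncp_last a b i \<subseteq> interval_ncp (Suc i) b \<times> interval_ncp a (Suc i)"
      by (rule image_subsetI) (simp add: mem_Times_iff ncp_last_split(1,2)[OF i])
    show "join_ncp i b ` (interval_ncp (Suc i) b \<times> interval_ncp a (Suc i)) \<subseteq> ncp_last a b i"
      using join_ncp_mem[OF i] by auto
  qed
  then show ?thesis using bij_betw_same_card card_cartesian_product by metis
qed

lemma insert_singleton_ncp:
  assumes "a \<le> b"
  shows "bij_betw (insert {b}) (interval_ncp a b) {P \<in> interval_ncp a (Suc b). {b} \<in> P}"
proof (rule bij_betw_byWitness[where f' = "\<lambda>P. P - {{b}}"])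
  have nb: "A \<subseteq> {a..<b}" if "P \<in> interval_ncp a b" "A \<in> P" for A P using interval_ncpD(5)[OF that] .
  show "\<forall>P\<in>interval_ncp a b. insert {b} P - {{b}} = P"
  proof
    fix P assume "P \<in> interval_ncp a b"
    then have "{b} \<notin> P" using nb[of P "{b}"] by auto
    then show "insert {b} P - {{b}} = P" by simp
  qed
  show "\<forall>P\<in>{P \<in> interval_ncp a (Suc b). {b} \<in> P}. insert {b} (P - {{b}}) = P" by auto
  show "insert {b} ` interval_ncp a b \<subseteq> {P \<in> interval_ncp a (Suc b). {b} \<in> P}"
  proof (rule image_subsetI)
    fix P assume P: "P \<in> interval_ncp a b"
    note Pd = interval_ncpD[OF P]
    have lt: "x < b" if "A \<in> P" "x \<in> A" for A x using nb[OF P that(1)] that(2) by auto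
    have "insert {b} P \<in> interval_ncp a (Suc b)"
    proof (rule interval_ncpI)
      show "\<Union>(insert {b} P) = {a..<Suc b}" using Pd(1) assms by auto
      show "{} \<notin> insert {b} P" using Pd(2) by simp
      show "A = B" if "A \<in> insert {b} P" "B \<in> insert {b} P" "x \<in> A" "x \<in> B" for A B x
        using that lt Pd(3)[of A B x] by fastforce
      show False if "A \<in> insert {b} P" "B \<in> insert {b} P" "A \<noteq> B" "x \<in> A" "y \<in> B" "z \<in> A" "w \<in> B"
        "x < y" "y < z" "z < w" for A B x y z w
        using that lt Pd(4)[of A B x y z w] by fastforce
    qed
    then show "insert {b} P \<in> {P \<in> interval_ncp a (Suc b). {b} \<in> P}" by simp
  qed
  show "(\<lambda>P. P - {{b}}) ` {P \<in> interval_ncp a (Suc b). {b} \<in> P} \<subseteq> interval_ncp a b"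
  proof (rule image_subsetI)
    fix P assume "P \<in> {P \<in> interval_ncp a (Suc b). {b} \<in> P}"
    then have P: "P \<in> interval_ncp a (Suc b)" and bP: "{b} \<in> P" by auto
    note Pd = interval_ncpD[OF P]
    have nb: "b \<notin> A" if "A \<in> P" "A \<noteq> {b}" for A using Pd(3)[OF that(1) bP] that(2) by blast
    show "P - {{b}} \<in> interval_ncp a b"
    proof (rule interval_ncpI)
      have "\<Union>(P - {{b}}) = \<Union>P - {b}" using nb by blast
      then show "\<Union>(P - {{b}}) = {a..<b}" using Pd(1) by auto
      show "{} \<notin> P - {{b}}" using Pd(2) by simp
      show "A = B" if "A \<in> P - {{b}}" "B \<in> P - {{b}}" "x \<in> A" "x \<in> B" for A B x
        using that Pd(3)[of A B x] by blast
      show False if "A \<in> P - {{b}}" "B \<in> P - {{b}}" "A \<noteq> B" "x \<in> A" "y \<in> B" "z \<in> A" "w \<in> B"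
        "x < y" "y < z" "z < w" for A B x y z w
        using that Pd(4)[of A B x y z w] by blast
    qed
  qed
qed

text \<open>Either \<open>b\<close> is a singleton block or it has a predecessor in its block. This
  is the recursion for planar permutations with a constant labelling.\<close>

lemma card_interval_ncp_Suc:
  assumes "a \<le> b"
  shows "card (interval_ncp a (Suc b)) = card (interval_ncp a b) +
    (\<Sum>i\<in>{a..<b}. card (interval_ncp (Suc i) b) * card (interval_ncp a (Suc i)))"
proof -
  let ?S = "{P \<in> interval_ncp a (Suc b). {b} \<in> P}"
  have "interval_ncp a (Suc b) = ?S \<union> (\<Union>i\<in>{a..<b}. ncp_last a b i)"
  proof (intro equalityI subsetI)
    fix P assume P: "P \<in> interval_ncp a (Suc b)"
    note Pd = interval_ncpD[OF P]
    have "b \<in> \<Union>P" using Pd(1) assms by simp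
    then obtain B where B: "B \<in> P" "b \<in> B" by blast
    show "P \<in> ?S \<union> (\<Union>i\<in>{a..<b}. ncp_last a b i)"
    proof (cases "B = {b}")
      case True
      then show ?thesis using P B by simp
    next
      case False
      have fin: "finite (B - {b})" "B - {b} \<noteq> {}"
        using finite_subset[OF Pd(5)[OF B(1)]] B False by auto
      define i where "i = Max (B - {b})"
      have iB: "i \<in> B" "i \<noteq> b" using Max_in[OF fin] by (auto simp: i_def)
      have "i \<in> {a..<Suc b}" using Pd(5)[OF B(1)] iB(1) by blast
      then have i: "i \<in> {a..<b}" using iB by simp
      have "x \<le> i" if "x \<in> B" "x \<noteq> b" for x using Max_ge[OF fin(1), of x] that by (simp add: i_def)
      then have "B \<inter> {Suc i..<b} = {}" by (auto simp: not_less_eq_eq[symmetric])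
      then have "P \<in> ncp_last a b i" using P B iB unfolding ncp_last_def by blast
      then show ?thesis using i by blast
    qed
  qed (auto simp: ncp_last_def)
  moreover have "?S \<inter> (\<Union>i\<in>{a..<b}. ncp_last a b i) = {}"
  proof (rule equals0I)
    fix P assume "P \<in> ?S \<inter> (\<Union>i\<in>{a..<b}. ncp_last a b i)"
    then obtain i B where "P \<in> interval_ncp a (Suc b)" "{b} \<in> P" "i < b" "B \<in> P" "b \<in> B" "i \<in> B"
      by (auto simp: ncp_last_def)
    then show False using interval_ncpD(3)[of P a "Suc b" B "{b}" b] by auto
  qed
  ultimately have "card (interval_ncp a (Suc b)) = card ?S + card (\<Union>i\<in>{a..<b}. ncp_last a b i)"
    using finite_interval_ncp[of a "Suc b"] by (metis card_Un_disjoint finite_Un)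
  also have "card ?S = card (interval_ncp a b)"
    using bij_betw_same_card[OF insert_singleton_ncp[OF assms]] by simp
  also have "card (\<Union>i\<in>{a..<b}. ncp_last a b i) = (\<Sum>i\<in>{a..<b}. card (ncp_last a b i))"
  proof (rule card_UN_disjoint)
    show "\<forall>i\<in>{a..<b}. finite (ncp_last a b i)"
      using finite_interval_ncp[of a "Suc b"] by (simp add: ncp_last_def)
    have le: "i \<le> j" if "P \<in> ncp_last a b i" "P \<in> ncp_last a b j" "i < b" for i j P
    proof -
      from that(1) obtain B where B: "B \<in> P" "b \<in> B" "i \<in> B" and P: "P \<in> interval_ncp a (Suc b)"
        by (auto simp: ncp_last_def)
      from that(2) obtain C where C: "C \<in> P" "b \<in> C" "C \<inter> {Suc j..<b} = {}" by (auto simp: ncp_last_def)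
      have "i \<in> C" using interval_ncpD(3)[OF P B(1) C(1) B(2) C(2)] B(3) by simp
      then have "i \<notin> {Suc j..<b}" using C(3) by blast
      then show ?thesis using that(3) by simp
    qed
    show "\<forall>i\<in>{a..<b}. \<forall>j\<in>{a..<b}. i \<noteq> j \<longrightarrow> ncp_last a b i \<inter> ncp_last a b j = {}"
    proof (intro ballI impI equals0I)
      fix i j P assume ij: "i \<in> {a..<b}" "j \<in> {a..<b}" "i \<noteq> j" and P: "P \<in> ncp_last a b i \<inter> ncp_last a b j"
      then show False using le[of P i j] le[of P j i] by auto
    qed
  qed simp
  also have "\<dots> = (\<Sum>i\<in>{a..<b}. card (interval_ncp (Suc i) b) * card (interval_ncp a (Suc i)))"
    by (intro sum.cong refl card_ncp_last) auto
  finally show ?thesis .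
qed

lemma card_interval_ncp: "a \<le> b \<Longrightarrow> card (interval_ncp a b) = catalan (b - a)"
proof (induction "b - a" arbitrary: a b rule: less_induct)
  case less
  show ?case
  proof (cases "a = b")
    case True
    have "interval_ncp a a = {{}}"
      by (auto simp: interval_ncp_def partition_on_def)
    then show ?thesis using True by simp
  next
    case False
    define c where "c = b - 1"
    have c: "b = Suc c" "a \<le> c" using less.prems False by (auto simp: c_def)
    have "card (interval_ncp a b) = card (interval_ncp a c) +
      (\<Sum>i\<in>{a..<c}. card (interval_ncp (Suc i) c) * card (interval_ncp a (Suc i)))"
      unfolding c(1) by (rule card_interval_ncp_Suc[OF c(2)])
    also have "card (interval_ncp a c) = catalan (c - a)" using less.hyps[of c a] c by simp
    also have "(\<Sum>i\<in>{a..<c}. card (interval_ncp (Suc i) c) * card (interval_ncp a (Suc i))) =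
      (\<Sum>i\<in>{a..<c}. catalan (c - Suc i) * catalan (Suc i - a))"
      by (intro sum.cong refl arg_cong2[of _ _ _ _ "(*)"] less.hyps) (auto simp: c)
    also have "\<dots> = (\<Sum>t<c - a. catalan t * catalan (c - a - t))"
      by (rule sum.reindex_bij_witness[of _ "\<lambda>t. c - Suc t" "\<lambda>i. c - Suc i"]) (auto intro!: arg_cong[of _ _ catalan])
    also have "catalan (c - a) + \<dots> = catalan (Suc (c - a))"
      unfolding catalan.simps lessThan_Suc_atMost[symmetric] by simp
    also have "Suc (c - a) = b - a" using c by simp
    finally show ?thesis .
  qed
qed

lemma card_noncrossing_partitions: "card (noncrossing_partitions k) = catalan k"
  by (simp add: noncrossing_partitions_eq card_interval_ncp)

text \<open>The convolution recursion is the quadratic equation F = 1 + X F^2 for the generating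
  function. Completing the square gives S^2 = 1 - 4 X for S = 1 - 2 X F, and differentiation gives a
  linear equation whose coefficients involve only neighbouring Catalan numbers.\<close>

lemma catalan_recurrence: "(n + 2) * catalan (Suc n) = 2 * (2 * n + 1) * catalan n"
proof -
  define F :: "real fps" where "F = Abs_fps (\<lambda>n. real (catalan n))"
  define S where "S = 1 - 2 * fps_X * F"
  have F: "F = 1 + fps_X * F\<^sup>2"
  proof (rule fps_ext)
    fix n
    show "fps_nth F n = fps_nth (1 + fps_X * F\<^sup>2) n"
    proof (cases n)
      case 0
      then show ?thesis by (simp add: F_def)
    next
      case (Suc k)
      then have "fps_nth (1 + fps_X * F\<^sup>2) n = fps_nth (F * F) k" by (simp add: power2_eq_square)
      also have "\<dots> = fps_nth F n" unfolding fps_mult_nth by (simp add: F_def Suc catalan.simps atLeast0AtMost)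
      finally show ?thesis ..
    qed
  qed
  have alg: "(1 - 2 * x * y)\<^sup>2 = 1 - 4 * x * (y - x * y\<^sup>2)" for x y :: "real fps"
    by algebra
  have "F - fps_X * F\<^sup>2 = 1" using F by (metis add_diff_cancel_right')
  then have S2: "S * S = 1 - fps_const 4 * fps_X"
    using alg[of fps_X F] by (simp add: S_def power2_eq_square numeral_fps_const)
  then have "fps_deriv (S * S) = - fps_const 4" by simp
  then have "S * fps_deriv S + fps_deriv S * S = - fps_const 4" by (simp only: fps_deriv_mult)
  then have d: "S * fps_deriv S + S * fps_deriv S = - fps_const 4" by (simp only: mult.commute)
  let ?D = "(1 - fps_const 4 * fps_X) * fps_deriv S"
  \<comment> \<open>Multiplying (S^2)' = -4 by S and replacing S^2 gives 2 (1 - 4 X) S' = -4 S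
    without dividing power series.\<close>
  have "?D + ?D = S * S * fps_deriv S + S * S * fps_deriv S" unfolding S2 ..
  also have "\<dots> = S * (S * fps_deriv S + S * fps_deriv S)" by (simp only: distrib_left mult.assoc)
  also have "\<dots> = S * (- fps_const 4)" unfolding d ..
  finally have e: "fps_nth (?D + ?D) (Suc n) = fps_nth (S * (- fps_const 4)) (Suc n)" by (rule arg_cong)
  have Sn: "fps_nth S (Suc k) = - 2 * real (catalan k)" for k
    by (simp add: S_def F_def numeral_fps_const mult.assoc)
  have D: "fps_nth ?D (Suc n) = real (n + 2) * fps_nth S (Suc (Suc n)) - 4 * (real (Suc n) * fps_nth S (Suc n))"
    by (simp add: left_diff_distrib mult.assoc)
  have "fps_nth (S * (- fps_const 4)) (Suc n) = - 4 * fps_nth S (Suc n)" by simp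
  then have "2 * (real (n + 2) * fps_nth S (Suc (Suc n)) - 4 * (real (Suc n) * fps_nth S (Suc n))) = - 4 * fps_nth S (Suc n)"
    using e D by (simp only: fps_add_nth mult_2)
  then have "real ((n + 2) * catalan (Suc n)) = real (2 * (2 * n + 1) * catalan n)"
    unfolding Sn by (simp add: algebra_simps)
  then show ?thesis by (simp only: of_nat_eq_iff)
qed

section \<open>The Marchenko--Pastur distribution\<close>

lemma Beta_pos: "0 < x \<Longrightarrow> 0 < y \<Longrightarrow> 0 < Beta x (y :: real)"
  by (simp add: Beta_def Gamma_real_pos)

text \<open>The density of the scaled variable is sqrt ((4 - x) / x) / (2 \<pi>) on (0, 4], as Beta
  (1/2) (3/2) = \<pi> / 2.\<close>

definition mp_measure :: "real measure" where
  "mp_measure = distr (density lborel (\<lambda>t. ennreal (t powr (- 1 / 2) * (1 - t) powr (1 / 2) / Beta (1 / 2) (3 / 2)) * indicator {0..1} t))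
     borel (\<lambda>t. 4 * t)"

text \<open>The functional equation of the Beta function in its first argument, multiplied by 4, is
  the two-term Catalan recurrence.\<close>

lemma catalan_Beta: "real (catalan k) = 4 ^ k * Beta (real k + 1 / 2) (3 / 2) / Beta (1 / 2) (3 / 2)"
proof (induction k)
  case 0
  have "Beta (1 / 2) (3 / 2 :: real) \<noteq> 0" using Beta_pos[of "1/2" "3/2"] by simp
  then show ?case by simp
next
  case (Suc k)
  have "real k + 1 / 2 \<notin> \<int>\<^sub>\<le>\<^sub>0" by (auto elim!: nonpos_Ints_cases')
  from Beta_plus1_left[OF this, of "3 / 2"]
  have B: "Beta (real (Suc k) + 1 / 2) (3 / 2) * (real k + 2) = (real k + 1 / 2) * Beta (real k + 1 / 2) (3 / 2)"
    by (simp add: algebra_simps)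
  have "real (k + 2) * real (catalan (Suc k)) = 2 * (2 * real k + 1) * real (catalan k)"
    using catalan_recurrence[of k] by (metis of_nat_1 of_nat_add of_nat_mult of_nat_numeral)
  also have "\<dots> = 4 ^ Suc k * ((real k + 1 / 2) * Beta (real k + 1 / 2) (3 / 2)) / Beta (1 / 2) (3 / 2)"
    unfolding Suc.IH by (simp add: algebra_simps add_divide_distrib)
  also have "\<dots> = real (k + 2) * (4 ^ Suc k * Beta (real (Suc k) + 1 / 2) (3 / 2) / Beta (1 / 2) (3 / 2))"
    unfolding B[symmetric] by simp
  finally show ?case by (simp only: mult_cancel_left of_nat_eq_0_iff) simp
qed

lemma mp_nn_integral:
  "(\<integral>\<^sup>+t. ennreal (t powr (- 1 / 2) * (1 - t) powr (1 / 2) / Beta (1 / 2) (3 / 2) * (4 * t) ^ k) * indicator {0..1} t \<partial>lborel)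
    = ennreal (real (catalan k))"
proof (rule nn_integral_has_integral_lebesgue')
  let ?B = "Beta (1 / 2) (3 / 2) :: real"
  have B: "?B > 0" by (rule Beta_pos) auto
  show "0 \<le> t powr (- 1 / 2) * (1 - t) powr (1 / 2) / ?B * (4 * t) ^ k" if "t \<in> {0..1}" for t :: real
    using that B by (intro mult_nonneg_nonneg divide_nonneg_pos) auto
  have "((\<lambda>t. t powr (real k + 1 / 2 - 1) * (1 - t) powr (3 / 2 - 1)) has_integral Beta (real k + 1 / 2) (3 / 2)) {0..1}"
    by (rule has_integral_Beta_real) auto
  from has_integral_mult_right[OF this, of "4 ^ k / ?B"]
  have "((\<lambda>t. 4 ^ k / ?B * (t powr (real k + 1 / 2 - 1) * (1 - t) powr (3 / 2 - 1))) has_integral real (catalan k)) {0..1}"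
    by (simp add: catalan_Beta)
  moreover have "4 ^ k / ?B * (t powr (real k + 1 / 2 - 1) * (1 - t) powr (3 / 2 - 1)) =
    t powr (- 1 / 2) * (1 - t) powr (1 / 2) / ?B * (4 * t) ^ k" if "t \<in> {0..1}" for t :: real
  \<comment> \<open>At 0 both sides vanish because \<open>0 powr x\<close> is 0, also for negative
    \<open>x\<close>; elsewhere the exponents add up.\<close>
  proof (cases "t = 0")
    case False
    then have "t powr (real k + 1 / 2 - 1) = t ^ k * t powr (- 1 / 2)"
      using that by (simp add: powr_realpow[symmetric] powr_add[symmetric])
    then show ?thesis by (simp add: power_mult_distrib)
  qed (simp add: powr_def)
  ultimately show "((\<lambda>t. t powr (- 1 / 2) * (1 - t) powr (1 / 2) / ?B * (4 * t) ^ k) has_integral real (catalan k)) {0..1}"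
    by (rule has_integral_eq[rotated])
qed

lemma mp_density_measurable [measurable]:
  "(\<lambda>t :: real. ennreal (t powr (- 1 / 2) * (1 - t) powr (1 / 2) / Beta (1 / 2) (3 / 2)) * indicator {0..1} t) \<in> borel_measurable borel"
  by measurable

lemma mp_moments: "has_bochner_integral mp_measure (\<lambda>x. x ^ k) (real (catalan k))"
proof (rule has_bochner_integral_nn_integral)
  let ?d = "\<lambda>t :: real. ennreal (t powr (- 1 / 2) * (1 - t) powr (1 / 2) / Beta (1 / 2) (3 / 2)) * indicator {0..1} t"
  have B: "Beta (1 / 2) (3 / 2 :: real) > 0" by (rule Beta_pos) auto
  show "(\<lambda>x. x ^ k) \<in> borel_measurable mp_measure" by (simp add: mp_measure_def)
  show "AE x in mp_measure. 0 \<le> x ^ k"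
    unfolding mp_measure_def by (subst AE_distr_iff) (auto simp: AE_density indicator_def)
  show "0 \<le> real (catalan k)" by simp
  have "(\<integral>\<^sup>+x. ennreal (x ^ k) \<partial>mp_measure) = (\<integral>\<^sup>+t. ?d t * ennreal ((4 * t) ^ k) \<partial>lborel)"
    unfolding mp_measure_def by (subst nn_integral_distr) (auto simp: nn_integral_density)
  also have "\<dots> = (\<integral>\<^sup>+t. ennreal (t powr (- 1 / 2) * (1 - t) powr (1 / 2) / Beta (1 / 2) (3 / 2) * (4 * t) ^ k) * indicator {0..1} t \<partial>lborel)"
    using B by (intro nn_integral_cong) (auto simp: indicator_def ennreal_mult[symmetric])
  also have "\<dots> = ennreal (real (catalan k))" by (rule mp_nn_integral)
  finally show "(\<integral>\<^sup>+x. ennreal (x ^ k) \<partial>mp_measure) = ennreal (real (catalan k))" .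
qed

text \<open>If all free cumulants are 1, the k-th moment is the number of non-crossing partitions of
  k points, hence a Catalan number.\<close>

lemma marchenko_pastur_mp_measure: "marchenko_pastur 1 mp_measure"
proof -
  have "emeasure mp_measure (space mp_measure) = (\<integral>\<^sup>+x. ennreal (x ^ 0) \<partial>mp_measure)" by simp
  also have "\<dots> = ennreal (\<integral>x. x ^ 0 \<partial>mp_measure)"
    by (rule nn_integral_eq_integral) (use mp_moments[of 0] in \<open>auto simp: has_bochner_integral_iff\<close>)
  also have "\<dots> = 1" using mp_moments[of 0] by (simp add: has_bochner_integral_iff)
  finally have "prob_space mp_measure" by (rule prob_spaceI)
  then have "real_distribution mp_measure"
    by (simp add: real_distribution_def real_distribution_axioms_def mp_measure_def)
  then show ?thesis
    using mp_moments unfolding marchenko_pastur_def free_cumulants_def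
    by (simp add: has_bochner_integral_iff card_noncrossing_partitions)
qed

lemma has_distribution_generator: "has_distribution vacuum_state (free_generator j) mp_measure"
  using mp_moments by (simp add: has_distribution_def vacuum_state_power word_moment_replicate has_bochner_integral_iff)

section \<open>Gaussian moments and the Wick formula\<close>

lemma borel_measurable_cnj [measurable]: "cnj \<in> borel_measurable borel"
  by (intro borel_measurable_continuous_onI continuous_intros)

text \<open>A disc of squared radius \<open>a\<close> has area \<pi> * \<open>a\<close>, and
  half-lines generate the Borel sets. This plays the role of polar coordinates for radial
  integrands.\<close>

lemma distr_cmod_square_lborel:
  "distr lborel borel (\<lambda>z :: complex. (cmod z)\<^sup>2) = density lborel (\<lambda>x :: real. ennreal pi * indicator {0..} x)"
  (is "?M = ?N")
proof (rule measure_eqI_generator_eq[where E = "range (\<lambda>a :: real. {..a})" and \<Omega> = UNIV and A = "\<lambda>n. {..real n}"])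
  have em: "emeasure ?M {..a} = ennreal (pi * max a 0)" for a :: real
  proof -
    have "emeasure ?M {..a} = emeasure lborel {z :: complex. (cmod z)\<^sup>2 \<le> a}"
      by (subst emeasure_distr) (auto intro!: arg_cong2[of _ _ _ _ emeasure])
    also have "\<dots> = ennreal (pi * max a 0)"
    proof (cases "a \<ge> 0")
      case True
      then have "{z :: complex. (cmod z)\<^sup>2 \<le> a} = cball 0 (sqrt a)"
        by (auto simp: real_le_rsqrt) (metis norm_ge_zero power2_eq_square real_sqrt_le_iff real_sqrt_abs abs_of_nonneg sqrt_le_D)
      then show ?thesis using True by (simp add: emeasure_cball unit_ball_vol_2)
    next
      case False
      then have "{z :: complex. (cmod z)\<^sup>2 \<le> a} = {}"
        by (auto simp: not_le intro: less_le_trans)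
      then show ?thesis using False by simp
    qed
    finally show ?thesis .
  qed
  have en: "emeasure ?N {..a} = ennreal (pi * max a 0)" for a :: real
  proof -
    have "emeasure ?N {..a} = (\<integral>\<^sup>+x. ennreal pi * indicator {0..a} x \<partial>lborel)"
      by (subst emeasure_density) (auto intro!: nn_integral_cong simp: indicator_def)
    also have "\<dots> = ennreal pi * emeasure lborel {0..a}" by (simp add: nn_integral_cmult_indicator)
    also have "\<dots> = ennreal (pi * max a 0)"
      by (cases "a \<ge> 0") (auto simp: ennreal_mult)
    finally show ?thesis .
  qed
  show "Int_stable (range (\<lambda>a :: real. {..a}))"
    by (auto simp: Int_stable_def)
  show "emeasure ?M X = emeasure ?N X" if "X \<in> range (\<lambda>a :: real. {..a})" for X
    using that em en by auto
  show "sets ?M = sigma_sets UNIV (range (\<lambda>a :: real. {..a}))" "sets ?N = sigma_sets UNIV (range (\<lambda>a :: real. {..a}))"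
    by (simp_all add: borel_eq_atMost)
  show "(\<Union>i. {..real i}) = UNIV" by (auto intro: real_arch_simple)
  show "emeasure ?M {..real i} \<noteq> \<infinity>" for i using em by simp
qed auto

text \<open>
  The rotated measure is translation invariant and agrees with \<open>lborel\<close> on the unit ball; Fubini's theorem for
  \<open>indicator B y * indicator A (u * z + y)\<close> turns this into equality.
\<close>

lemma lborel_distr_rotation:
  fixes u :: complex
  assumes u: "cmod u = 1"
  shows "distr lborel borel (\<lambda>z. u * z) = lborel"
proof (rule measure_eqI)
  fix A assume "A \<in> sets (distr lborel borel (\<lambda>z. u * z))"
  then have A [measurable]: "A \<in> sets borel" by simp
  have u0: "u \<noteq> 0" using u by auto
  define B where "B = ball (0 :: complex) 1"
  have B [measurable]: "B \<in> sets borel" by (simp add: B_def)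
  have tr: "(\<integral>\<^sup>+z. f (z + y) \<partial>lborel) = (\<integral>\<^sup>+z. f z \<partial>lborel)"
    if [measurable]: "f \<in> borel_measurable borel" for f and y :: complex
  proof -
    have "lborel = distr lborel borel (\<lambda>z. y + 1 *\<^sub>R z)"
      using lborel_affine[of 1 y] by (simp add: density_1)
    then have "(\<integral>\<^sup>+z. f z \<partial>lborel) = (\<integral>\<^sup>+z. f z \<partial>distr lborel borel (\<lambda>z. y + 1 *\<^sub>R z))" by simp
    also have "\<dots> = (\<integral>\<^sup>+z. f (z + y) \<partial>lborel)" by (subst nn_integral_distr) (auto simp: add.commute)
    finally show ?thesis ..
  qed
  have vol: "(\<integral>\<^sup>+z. indicator B (y - u * z) \<partial>lborel) = emeasure lborel B" for y
  proof -
    have "indicator B (y - u * z) = (indicator (ball (y / u) 1) z :: ennreal)" for z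
    proof -
      have "cmod (y - u * z) = cmod (u * (y / u - z))" using u0 by (simp add: algebra_simps)
      then show ?thesis using u by (simp add: norm_mult indicator_def dist_norm norm_minus_commute B_def)
    qed
    then have "(\<integral>\<^sup>+z. indicator B (y - u * z) \<partial>lborel) = emeasure lborel (ball (y / u) 1)" by simp
    then show ?thesis by (simp add: emeasure_ball B_def)
  qed
  have "emeasure lborel B * emeasure (distr lborel borel (\<lambda>z. u * z)) A =
      (\<integral>\<^sup>+y. indicator B y * (\<integral>\<^sup>+z. indicator A (u * z) \<partial>lborel) \<partial>lborel)"
  proof -
    have "emeasure (distr lborel borel (\<lambda>z. u * z)) A = (\<integral>\<^sup>+z. indicator A (u * z) \<partial>lborel)"
    proof -
      have "emeasure (distr lborel borel (\<lambda>z. u * z)) A = (\<integral>\<^sup>+z. indicator A z \<partial>distr lborel borel (\<lambda>z. u * z))"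
        by simp
      also have "\<dots> = (\<integral>\<^sup>+z. indicator A (u * z) \<partial>lborel)" by (subst nn_integral_distr) auto
      finally show ?thesis .
    qed
    then show ?thesis by (subst nn_integral_multc) auto
  qed
  also have "\<dots> = (\<integral>\<^sup>+y. (\<integral>\<^sup>+z. indicator B y * indicator A (u * z + y) \<partial>lborel) \<partial>lborel)"
  proof (rule nn_integral_cong)
    fix y
    have "(\<integral>\<^sup>+z. indicator A (u * z) \<partial>lborel) = (\<integral>\<^sup>+z. indicator A (u * (z + y / u)) \<partial>lborel)"
      by (rule tr[symmetric]) measurable
    also have "\<dots> = (\<integral>\<^sup>+z. indicator A (u * z + y) \<partial>lborel)" using u0 by (simp add: distrib_left)
    finally show "indicator B y * (\<integral>\<^sup>+z. indicator A (u * z) \<partial>lborel) = (\<integral>\<^sup>+z. indicator B y * indicator A (u * z + y) \<partial>lborel)"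
      by (simp add: nn_integral_cmult)
  qed
  also have "\<dots> = (\<integral>\<^sup>+z. (\<integral>\<^sup>+y. indicator B y * indicator A (u * z + y) \<partial>lborel) \<partial>lborel)"
    by (rule pair_sigma_finite.Fubini') (auto intro: pair_sigma_finite.intro sigma_finite_lborel)
  also have "\<dots> = (\<integral>\<^sup>+z. (\<integral>\<^sup>+y. indicator B (y - u * z) * indicator A y \<partial>lborel) \<partial>lborel)"
  proof (rule nn_integral_cong)
    fix z
    show "(\<integral>\<^sup>+y. indicator B y * indicator A (u * z + y) \<partial>lborel) = (\<integral>\<^sup>+y. indicator B (y - u * z) * indicator A y \<partial>lborel)"
      by (subst tr[of "\<lambda>y. indicator B (y - u * z) * indicator A y" "u * z", symmetric]) (auto simp: add.commute)
  qed
  also have "\<dots> = (\<integral>\<^sup>+y. (\<integral>\<^sup>+z. indicator B (y - u * z) * indicator A y \<partial>lborel) \<partial>lborel)"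
    by (rule pair_sigma_finite.Fubini') (auto intro: pair_sigma_finite.intro sigma_finite_lborel)
  also have "\<dots> = (\<integral>\<^sup>+y. emeasure lborel B * indicator A y \<partial>lborel)"
    by (intro nn_integral_cong) (simp add: nn_integral_multc vol)
  also have "\<dots> = emeasure lborel B * emeasure lborel A"
    by (simp add: nn_integral_cmult)
  finally have "emeasure lborel B * emeasure (distr lborel borel (\<lambda>z. u * z)) A = emeasure lborel B * emeasure lborel A" .
  moreover have "emeasure lborel B = ennreal pi" by (simp add: emeasure_ball unit_ball_vol_2 B_def)
  ultimately show "emeasure (distr lborel borel (\<lambda>z. u * z)) A = emeasure lborel A"
    by (simp add: ennreal_mult_cancel_left)
qed simp

text \<open>The squared modulus of a standard complex Gaussian variable is exponentially distributed
  with rate 1, whose a-th moment is \<open>fact a\<close>.\<close>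

lemma nn_integral_gaussian_power:
  "(\<integral>\<^sup>+z. ennreal (1 / pi * exp (- (cmod z)\<^sup>2)) * ennreal ((cmod z) ^ (2 * a)) \<partial>lborel) = ennreal (fact a)"
proof -
  let ?h = "\<lambda>x :: real. ennreal (1 / pi * (x ^ a * exp (- x)) * indicator {0..} x)"
  have "(\<integral>\<^sup>+z. ennreal (1 / pi * exp (- (cmod z)\<^sup>2)) * ennreal ((cmod z) ^ (2 * a)) \<partial>lborel) =
      (\<integral>\<^sup>+z. ?h ((cmod z)\<^sup>2) \<partial>(lborel :: complex measure))"
    by (intro nn_integral_cong) (simp add: ennreal_mult[symmetric] power_mult[symmetric] mult_ac)
  also have "\<dots> = (\<integral>\<^sup>+x. ?h x \<partial>distr lborel borel (\<lambda>z :: complex. (cmod z)\<^sup>2))"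
    by (subst nn_integral_distr) auto
  also have "\<dots> = (\<integral>\<^sup>+x. ennreal pi * indicator {0..} x * ?h x \<partial>lborel)"
    unfolding distr_cmod_square_lborel by (subst nn_integral_density) auto
  also have "\<dots> = (\<integral>\<^sup>+x. ennreal (x ^ a * exp (- x)) * indicator {0..} x \<partial>lborel)"
    by (intro nn_integral_cong) (auto simp: indicator_def ennreal_mult[symmetric])
  also have "\<dots> = ennreal (fact a)"
    using nn_intergal_power_times_exp_Ici[of a] by simp
  finally show ?thesis .
qed

context
  fixes M :: "'w measure" and Z :: "'w \<Rightarrow> complex"
  assumes Z: "standard_complex_gaussian M Z"
begin

lemma gaussian_measurable [measurable]: "Z \<in> borel_measurable M"
  using Z distributed_measurable[of M lborel Z] by (simp add: standard_complex_gaussian_def)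

lemma gaussian_distr: "distr M borel Z = density lborel (\<lambda>z. ennreal (1 / pi * exp (- (cmod z)\<^sup>2)))"
  using Z distributed_distr_eq_density[of M lborel Z] by (simp add: standard_complex_gaussian_def cong: distr_cong)

lemma gaussian_has_bochner_integral_norm: "has_bochner_integral M (\<lambda>\<omega>. (cmod (Z \<omega>)) ^ (2 * a)) (fact a)"
proof (rule has_bochner_integral_nn_integral)
  have "(\<integral>\<^sup>+\<omega>. ennreal ((cmod (Z \<omega>)) ^ (2 * a)) \<partial>M) = (\<integral>\<^sup>+z. ennreal ((cmod z) ^ (2 * a)) \<partial>distr M borel Z)"
    by (subst nn_integral_distr) auto
  also have "\<dots> = (\<integral>\<^sup>+z. ennreal (1 / pi * exp (- (cmod z)\<^sup>2)) * ennreal ((cmod z) ^ (2 * a)) \<partial>lborel)"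
    unfolding gaussian_distr by (subst nn_integral_density) auto
  also have "\<dots> = ennreal (fact a)" by (rule nn_integral_gaussian_power)
  finally show "(\<integral>\<^sup>+\<omega>. ennreal ((cmod (Z \<omega>)) ^ (2 * a)) \<partial>M) = ennreal (fact a)" .
qed auto

lemma gaussian_integrable: "integrable M (\<lambda>\<omega>. Z \<omega> ^ a * cnj (Z \<omega>) ^ b)"
proof (rule Bochner_Integration.integrable_bound)
  show "integrable M (\<lambda>\<omega>. (cmod (Z \<omega>)) ^ (2 * a) + (cmod (Z \<omega>)) ^ (2 * b))"
    using gaussian_has_bochner_integral_norm by (auto simp: has_bochner_integral_iff)
  show "AE \<omega> in M. norm (Z \<omega> ^ a * cnj (Z \<omega>) ^ b) \<le> norm ((cmod (Z \<omega>)) ^ (2 * a) + (cmod (Z \<omega>)) ^ (2 * b))"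
  proof (rule AE_I2)
    fix \<omega>
    \<comment> \<open>The inequality of arithmetic and geometric means bounds the mixed moment by
      the radial ones.\<close>
    have "x ^ a * x ^ b \<le> x ^ (2 * a) + x ^ (2 * b)" if "x \<ge> 0" for x :: real
    proof -
      have "2 * (x ^ a * x ^ b) \<le> (x ^ a)\<^sup>2 + (x ^ b)\<^sup>2" using sum_squares_bound[of "x ^ a" "x ^ b"] by simp
      moreover have "0 \<le> x ^ a * x ^ b" using that by simp
      ultimately have "x ^ a * x ^ b \<le> (x ^ a)\<^sup>2 + (x ^ b)\<^sup>2" by linarith
      then show ?thesis by (simp add: power_mult[symmetric] mult.commute)
    qed
    then show "norm (Z \<omega> ^ a * cnj (Z \<omega>) ^ b) \<le> norm ((cmod (Z \<omega>)) ^ (2 * a) + (cmod (Z \<omega>)) ^ (2 * b))"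
      by (simp add: norm_mult norm_power)
  qed
qed measurable

lemma gaussian_moment: "(\<integral>\<omega>. Z \<omega> ^ a * cnj (Z \<omega>) ^ b \<partial>M) = (if a = b then fact a else 0)"
proof (cases "a = b")
  case True
  have "(\<integral>\<omega>. Z \<omega> ^ a * cnj (Z \<omega>) ^ a \<partial>M) = (\<integral>\<omega>. complex_of_real ((cmod (Z \<omega>)) ^ (2 * a)) \<partial>M)"
    by (intro Bochner_Integration.integral_cong refl)
      (simp add: power_mult_distrib[symmetric] complex_norm_square[symmetric] power_mult)
  also have "\<dots> = complex_of_real (fact a)"
    using gaussian_has_bochner_integral_norm[of a] by (simp add: has_bochner_integral_iff del: of_real_power)
  finally show ?thesis using True by simp
next
  case False
  define g where "g z = (1 / pi * exp (- (cmod z)\<^sup>2)) *\<^sub>R (z ^ a * cnj z ^ b)" for z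
  have [measurable]: "g \<in> borel_measurable borel" unfolding g_def by measurable
  have "(\<integral>\<omega>. Z \<omega> ^ a * cnj (Z \<omega>) ^ b \<partial>M) = (\<integral>z. z ^ a * cnj z ^ b \<partial>distr M borel Z)"
    by (subst integral_distr) auto
  also have "\<dots> = (\<integral>z. g z \<partial>lborel)"
    unfolding gaussian_distr g_def by (subst integral_density) auto
  finally have I: "(\<integral>\<omega>. Z \<omega> ^ a * cnj (Z \<omega>) ^ b \<partial>M) = (\<integral>z. g z \<partial>lborel)" .
  \<comment> \<open>Rotation by this angle multiplies \<open>z ^ a * cnj z ^ b\<close> by exp (i
    \<pi>) = -1, so the integral equals its own negative.\<close>
  define \<theta> where "\<theta> = pi / (real a - real b)"
  have "(\<integral>z. g z \<partial>lborel) = (\<integral>z. g z \<partial>distr lborel borel (\<lambda>z. cis \<theta> * z))"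
    by (simp add: lborel_distr_rotation)
  also have "\<dots> = (\<integral>z. g (cis \<theta> * z) \<partial>lborel)"
    by (subst integral_distr) auto
  finally have "(\<integral>z. g z \<partial>lborel) = (\<integral>z. g (cis \<theta> * z) \<partial>lborel)" .
  moreover have "g (cis \<theta> * z) = - g z" for z
  proof -
    have "cis \<theta> ^ a * cnj (cis \<theta>) ^ b = cis (real a * \<theta> - real b * \<theta>)"
      by (simp add: cis_cnj Complex.DeMoivre cis_mult)
    also have "real a * \<theta> - real b * \<theta> = (real a - real b) * \<theta>" by (simp only: left_diff_distrib)
    also have "\<dots> = pi" using False by (simp add: \<theta>_def)
    finally have "cis \<theta> ^ a * cnj (cis \<theta>) ^ b = - 1" by simp
    then have "(cis \<theta> * z) ^ a * cnj (cis \<theta> * z) ^ b = - (z ^ a * cnj z ^ b)"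
      by (simp add: power_mult_distrib mult_ac)
    then show ?thesis by (simp add: g_def norm_mult)
  qed
  ultimately have "(\<integral>z. g z \<partial>lborel) = 0" by simp
  then show ?thesis using I False by simp
qed

end

section \<open>Counting Wick pairings\<close>

definition multiplicity_in :: "('k \<Rightarrow> 'i) \<Rightarrow> 'k set \<Rightarrow> 'i \<Rightarrow> nat" where
  "multiplicity_in t K i = card {k\<in>K. t k = i}"

text \<open>Source and target are separate sets so that the induction can delete a point and its
  image, which need not coincide.\<close>

definition matchings :: "'k set \<Rightarrow> 'l set \<Rightarrow> ('k \<Rightarrow> 'i) \<Rightarrow> ('l \<Rightarrow> 'i) \<Rightarrow> ('k \<Rightarrow> 'l) set" where
  "matchings K L s t = {\<alpha> \<in> K \<rightarrow>\<^sub>E L. bij_betw \<alpha> K L \<and> (\<forall>k\<in>K. t (\<alpha> k) = s k)}"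

lemma finite_matchings: "finite K \<Longrightarrow> finite L \<Longrightarrow> finite (matchings K L s t)"
  unfolding matchings_def by (rule finite_subset[of _ "K \<rightarrow>\<^sub>E L"]) (auto intro: finite_PiE)

lemma matchings_insert:
  assumes k: "k \<notin> K"
  shows "matchings (insert k K) L s t = (\<Union>l\<in>{l\<in>L. t l = s k}. (\<lambda>\<alpha>. \<alpha>(k := l)) ` matchings K (L - {l}) s t)"
proof (intro equalityI subsetI)
  fix \<alpha> assume \<alpha>: "\<alpha> \<in> matchings (insert k K) L s t"
  let ?l = "\<alpha> k" and ?\<beta> = "restrict \<alpha> K"
  have \<alpha>L: "\<alpha> \<in> insert k K \<rightarrow>\<^sub>E L" "bij_betw \<alpha> (insert k K) L" "\<forall>x\<in>insert k K. t (\<alpha> x) = s x"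
    using \<alpha> by (auto simp: matchings_def)
  have "bij_betw \<alpha> K (L - {?l})"
    using bij_betw_DiffI[OF \<alpha>L(2), of "{k}" "{?l}"] \<alpha>L(1) k by (auto simp: bij_betw_singletonI)
  then have b: "bij_betw ?\<beta> K (L - {?l})" by (simp cong: bij_betw_cong)
  then have "?\<beta> \<in> matchings K (L - {?l}) s t"
    using \<alpha>L(3) by (auto simp: matchings_def PiE_iff dest: bij_betwE)
  moreover have "\<alpha> = ?\<beta>(k := ?l)"
    using \<alpha>L(1) by (auto simp: fun_eq_iff PiE_iff extensional_def)
  ultimately show "\<alpha> \<in> (\<Union>l\<in>{l\<in>L. t l = s k}. (\<lambda>\<alpha>. \<alpha>(k := l)) ` matchings K (L - {l}) s t)"
    using \<alpha>L by (intro UN_I[of ?l]) (auto simp: PiE_iff)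
next
  fix \<alpha> assume "\<alpha> \<in> (\<Union>l\<in>{l\<in>L. t l = s k}. (\<lambda>\<alpha>. \<alpha>(k := l)) ` matchings K (L - {l}) s t)"
  then obtain l \<beta> where l: "l \<in> L" "t l = s k" and \<beta>: "\<beta> \<in> matchings K (L - {l}) s t" and \<alpha>: "\<alpha> = \<beta>(k := l)" by auto
  have "bij_betw \<beta> K (L - {l})" using \<beta> by (simp add: matchings_def)
  then have "bij_betw \<alpha> K (L - {l})" using k by (subst bij_betw_cong[of _ _ \<beta>]) (auto simp: \<alpha>)
  then have "bij_betw \<alpha> (insert k K) (insert l (L - {l}))"
    using notIn_Un_bij_betw3[of k K \<alpha> "L - {l}"] k by (simp add: \<alpha>)
  moreover have "insert l (L - {l}) = L" using l by auto
  ultimately show "\<alpha> \<in> matchings (insert k K) L s t"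
    using \<beta> l k by (auto simp: matchings_def \<alpha> PiE_iff extensional_def)
qed

text \<open>A matching restricts to a bijection between the points of \<open>K\<close> and those of
  \<open>L\<close> carrying the same label. The induction chooses the image of a new point among the
  points of its label.\<close>

lemma card_matchings:
  assumes "finite K" "finite L" "finite I" "s ` K \<subseteq> I" "t ` L \<subseteq> I" "card K = card L"
  shows "card (matchings K L s t) =
    (\<Prod>i\<in>I. if multiplicity_in t L i = multiplicity_in s K i then fact (multiplicity_in t L i) else 0)"
  using assms
proof (induction K arbitrary: L rule: finite_induct)
  case empty
  then have "matchings {} L s t = {\<lambda>_. undefined}" by (auto simp: matchings_def bij_betw_def)
  then show ?case using empty by (simp add: multiplicity_in_def)
next
  case (insert k K)
  let ?x = "s k" and ?A = "{l\<in>L. t l = s k}"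
  let ?T = "\<lambda>L K i. if multiplicity_in t L i = multiplicity_in s K i then fact (multiplicity_in t L i) else (0 :: nat)"
  have xI: "?x \<in> I" using insert.prems by auto
  have ms: "multiplicity_in s (insert k K) i = multiplicity_in s K i + (if i = ?x then 1 else 0)" for i
  proof -
    have "{j \<in> insert k K. s j = i} = (if i = ?x then insert k {j\<in>K. s j = i} else {j\<in>K. s j = i})" by auto
    then show ?thesis using insert.hyps by (simp add: multiplicity_in_def)
  qed
  have mt: "multiplicity_in t L i = multiplicity_in t (L - {l}) i + (if i = ?x then 1 else 0)" if "l \<in> ?A" for i l
  proof -
    have "{j \<in> L. t j = i} = (if i = ?x then insert l {j\<in>L - {l}. t j = i} else {j\<in>L - {l}. t j = i})"
      using that by auto
    then show ?thesis using insert.prems by (simp add: multiplicity_in_def)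
  qed
  have "card (matchings (insert k K) L s t) = (\<Sum>l\<in>?A. card ((\<lambda>\<alpha>. \<alpha>(k := l)) ` matchings K (L - {l}) s t))"
    unfolding matchings_insert[OF insert.hyps(2)]
  proof (rule card_UN_disjoint)
    show "finite ?A" using insert.prems by simp
    show "\<forall>l\<in>?A. finite ((\<lambda>\<alpha>. \<alpha>(k := l)) ` matchings K (L - {l}) s t)"
      using insert.prems insert.hyps by (simp add: finite_matchings)
    show "\<forall>l\<in>?A. \<forall>l'\<in>?A. l \<noteq> l' \<longrightarrow> (\<lambda>\<alpha>. \<alpha>(k := l)) ` matchings K (L - {l}) s t \<inter> (\<lambda>\<alpha>. \<alpha>(k := l')) ` matchings K (L - {l'}) s t = {}"
      by (auto dest: fun_cong[of _ _ k])
  qed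
  \<comment> \<open>If c points carry the label, each choice leaves \<open>fact c div c\<close>
    possibilities for that label; for c = 0 there is no choice and the sum is empty.\<close>
  also have "\<dots> = (\<Sum>l\<in>?A. ?T L (insert k K) ?x div multiplicity_in t L ?x * (\<Prod>i\<in>I - {?x}. ?T L (insert k K) i))"
  proof (rule sum.cong)
    fix l assume l: "l \<in> ?A"
    have "inj_on (\<lambda>\<alpha>. \<alpha>(k := l)) (matchings K (L - {l}) s t)"
    proof (rule inj_onI)
      fix \<alpha> \<beta> assume "\<alpha> \<in> matchings K (L - {l}) s t" "\<beta> \<in> matchings K (L - {l}) s t" and eq: "\<alpha>(k := l) = \<beta>(k := l)"
      then have "\<alpha> k = undefined" "\<beta> k = undefined" using insert.hyps(2) by (auto simp: matchings_def PiE_iff extensional_def)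
      then show "\<alpha> = \<beta>" using eq by (metis fun_upd_triv fun_upd_upd)
    qed
    then have "card ((\<lambda>\<alpha>. \<alpha>(k := l)) ` matchings K (L - {l}) s t) = card (matchings K (L - {l}) s t)"
      by (rule card_image)
    also have "\<dots> = (\<Prod>i\<in>I. ?T (L - {l}) K i)"
      using insert.prems insert.hyps l by (intro insert.IH) auto
    also have "\<dots> = ?T (L - {l}) K ?x * (\<Prod>i\<in>I - {?x}. ?T (L - {l}) K i)"
      by (rule prod.remove[OF insert.prems(2) xI])
    also have "(\<Prod>i\<in>I - {?x}. ?T (L - {l}) K i) = (\<Prod>i\<in>I - {?x}. ?T L (insert k K) i)"
      using ms mt[OF l] by (intro prod.cong refl) simp
    also have "?T (L - {l}) K ?x = ?T L (insert k K) ?x div multiplicity_in t L ?x"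
      using ms[of ?x] mt[OF l, of ?x] by (simp add: fact_Suc del: mult_Suc)
    finally show "card ((\<lambda>\<alpha>. \<alpha>(k := l)) ` matchings K (L - {l}) s t) =
      ?T L (insert k K) ?x div multiplicity_in t L ?x * (\<Prod>i\<in>I - {?x}. ?T L (insert k K) i)" .
  qed simp
  also have "\<dots> = card ?A * (?T L (insert k K) ?x div multiplicity_in t L ?x) * (\<Prod>i\<in>I - {?x}. ?T L (insert k K) i)"
    by (simp only: sum_constant of_nat_id mult.assoc)
  also have "card ?A * (?T L (insert k K) ?x div multiplicity_in t L ?x) = ?T L (insert k K) ?x"
  proof -
    have "card ?A = multiplicity_in t L ?x" by (simp add: multiplicity_in_def)
    moreover have "multiplicity_in t L ?x dvd ?T L (insert k K) ?x"
    proof (cases "multiplicity_in t L ?x = 0")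
      case True
      then show ?thesis using ms[of ?x] by simp
    next
      case False
      then show ?thesis by (auto intro: dvd_fact)
    qed
    ultimately show ?thesis by simp
  qed
  also have "?T L (insert k K) ?x * (\<Prod>i\<in>I - {?x}. ?T L (insert k K) i) = (\<Prod>i\<in>I. ?T L (insert k K) i)"
    by (rule prod.remove[OF insert.prems(2) xI, symmetric])
  finally show ?case .
qed

lemma card_permutes_matching:
  "finite V \<Longrightarrow> card {\<alpha>. \<alpha> permutes V \<and> (\<forall>k\<in>V. t (\<alpha> k) = s k)} = card (matchings V V s t)"
proof (rule bij_betw_same_card[of "\<lambda>\<alpha>. restrict \<alpha> V"], rule bij_betw_byWitness[where f' = "\<lambda>\<alpha> x. if x \<in> V then \<alpha> x else x"])
  show "(\<lambda>\<alpha>. restrict \<alpha> V) ` {\<alpha>. \<alpha> permutes V \<and> (\<forall>k\<in>V. t (\<alpha> k) = s k)} \<subseteq> matchings V V s t"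
  proof (rule image_subsetI)
    fix \<alpha> assume \<alpha>: "\<alpha> \<in> {\<alpha>. \<alpha> permutes V \<and> (\<forall>k\<in>V. t (\<alpha> k) = s k)}"
    then have "bij_betw \<alpha> V V" using permutes_imp_bij by blast
    then have "bij_betw (restrict \<alpha> V) V V" by (simp cong: bij_betw_cong)
    then show "restrict \<alpha> V \<in> matchings V V s t"
      using \<alpha> by (auto simp: matchings_def permutes_in_image)
  qed
  show "(\<lambda>\<alpha> x. if x \<in> V then \<alpha> x else x) ` matchings V V s t \<subseteq> {\<alpha>. \<alpha> permutes V \<and> (\<forall>k\<in>V. t (\<alpha> k) = s k)}"
  proof (rule image_subsetI)
    fix \<alpha> assume \<alpha>: "\<alpha> \<in> matchings V V s t"
    then have "bij_betw \<alpha> V V" by (simp add: matchings_def)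
    then have "bij_betw (\<lambda>x. if x \<in> V then \<alpha> x else x) V V" by (subst bij_betw_cong[of _ _ \<alpha>]) auto
    then have "(\<lambda>x. if x \<in> V then \<alpha> x else x) permutes V" by (rule bij_imp_permutes) simp
    then show "(\<lambda>x. if x \<in> V then \<alpha> x else x) \<in> {\<alpha>. \<alpha> permutes V \<and> (\<forall>k\<in>V. t (\<alpha> k) = s k)}"
      using \<alpha> by (simp add: matchings_def)
  qed
qed (auto simp: fun_eq_iff permutes_not_in matchings_def PiE_iff extensional_def)

lemma prod_eq_prod_multiplicity:
  fixes x :: "'i \<Rightarrow> 'a :: comm_monoid_mult"
  assumes "finite K" "finite I" "t ` K \<subseteq> I"
  shows "(\<Prod>k\<in>K. x (t k)) = (\<Prod>i\<in>I. x i ^ multiplicity_in t K i)"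
proof -
  have "(\<Prod>k\<in>K. x (t k)) = (\<Prod>i\<in>I. \<Prod>k\<in>{k\<in>K. t k = i}. x (t k))"
    by (rule prod.group[OF assms, symmetric])
  also have "\<dots> = (\<Prod>i\<in>I. \<Prod>k\<in>{k\<in>K. t k = i}. x i)" by (intro prod.cong) auto
  finally show ?thesis by (simp add: multiplicity_in_def)
qed

text \<open>Grouping equal indices and using independence reduces the expectation to a product of
  one-variable moments, which vanish unless the multiplicities agree and are factorials otherwise.
  The same product counts the pairings.\<close>

lemma wick_formula:
  assumes M: "prob_space M" and X: "prob_space.indep_vars M (\<lambda>_. borel) X I" and I: "finite I"
    and g: "\<And>i. i \<in> I \<Longrightarrow> standard_complex_gaussian M (X i)"
    and V: "finite V" "s ` V \<subseteq> I" "t ` V \<subseteq> I"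
  shows "integrable M (\<lambda>\<omega>. \<Prod>k\<in>V. X (t k) \<omega> * cnj (X (s k) \<omega>))"
    and "(\<integral>\<omega>. (\<Prod>k\<in>V. X (t k) \<omega> * cnj (X (s k) \<omega>)) \<partial>M) = of_nat (card {\<alpha>. \<alpha> permutes V \<and> (\<forall>k\<in>V. t (\<alpha> k) = s k)})"
proof -
  interpret prob_space M by fact
  let ?a = "multiplicity_in t V" and ?b = "multiplicity_in s V"
  let ?Y = "\<lambda>i \<omega>. X i \<omega> ^ ?a i * cnj (X i \<omega>) ^ ?b i"
  have eq: "(\<Prod>k\<in>V. X (t k) \<omega> * cnj (X (s k) \<omega>)) = (\<Prod>i\<in>I. ?Y i \<omega>)" for \<omega>
    using prod_eq_prod_multiplicity[OF V(1) I V(3), of "\<lambda>i. X i \<omega>"] prod_eq_prod_multiplicity[OF V(1) I V(2), of "\<lambda>i. cnj (X i \<omega>)"]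
    by (simp add: prod.distrib)
  have ind: "indep_vars (\<lambda>_. borel) ?Y I"
    by (rule indep_vars_compose2[OF X, where Y = "\<lambda>i z. z ^ ?a i * cnj z ^ ?b i"]) measurable
  have int: "integrable M (?Y i)" if "i \<in> I" for i by (rule gaussian_integrable[OF g[OF that]])
  show "integrable M (\<lambda>\<omega>. \<Prod>k\<in>V. X (t k) \<omega> * cnj (X (s k) \<omega>))"
    unfolding eq by (rule indep_vars_integrable[OF I ind int])
  have "(\<integral>\<omega>. (\<Prod>k\<in>V. X (t k) \<omega> * cnj (X (s k) \<omega>)) \<partial>M) = (\<Prod>i\<in>I. \<integral>\<omega>. ?Y i \<omega> \<partial>M)"
    unfolding eq by (rule indep_vars_lebesgue_integral[OF I ind int])
  also have "\<dots> = (\<Prod>i\<in>I. of_nat (if ?a i = ?b i then fact (?a i) else 0))"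
    by (intro prod.cong refl) (simp add: gaussian_moment[OF g])
  also have "\<dots> = of_nat (card (matchings V V s t))"
    unfolding card_matchings[OF V(1) V(1) I V(2,3) refl] by simp
  finally show "(\<integral>\<omega>. (\<Prod>k\<in>V. X (t k) \<omega> * cnj (X (s k) \<omega>)) \<partial>M) = of_nat (card {\<alpha>. \<alpha> permutes V \<and> (\<forall>k\<in>V. t (\<alpha> k) = s k)})"
    unfolding card_permutes_matching[OF V(1)] .
qed

section \<open>Traces of words in the marginals\<close>

text \<open>Conjugation by the permutation operator moves the tensor factor at position r of I to
  position \<pi> r, so this is the position of the index with slot \<open>s\<close> in the row or
  column multi-index.\<close>

definition slot_rank :: "nat set \<times> (nat \<Rightarrow> nat) \<Rightarrow> nat \<Rightarrow> nat" where
  "slot_rank l s = snd l (card {j\<in>fst l. j \<le> s})"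

definition slot :: "nat \<Rightarrow> nat set \<times> (nat \<Rightarrow> nat) \<Rightarrow> nat \<Rightarrow> nat" where
  "slot m l = restrict (inv_into (fst l) (slot_rank l)) {1..m}"

lemma rank_bij:
  fixes I :: "nat set"
  assumes "finite I"
  shows "bij_betw (\<lambda>s. card {j\<in>I. j \<le> s}) I {1..card I}"
proof -
  let ?r = "\<lambda>s. card {j\<in>I. j \<le> s}"
  have less: "?r s < ?r s'" if "s' \<in> I" "s < s'" for s s'
  proof (rule psubset_card_mono)
    show "{j\<in>I. j \<le> s} \<subset> {j\<in>I. j \<le> s'}"
    proof (rule psubsetI)
      show "{j\<in>I. j \<le> s} \<noteq> {j\<in>I. j \<le> s'}"
      proof
        assume eq: "{j\<in>I. j \<le> s} = {j\<in>I. j \<le> s'}"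
        have "s' \<in> {j\<in>I. j \<le> s}" unfolding eq using that by simp
        then show False using that by simp
      qed
    qed (use that in auto)
  qed (use assms in simp)
  have inj: "inj_on ?r I"
  proof (rule inj_onI)
    fix s s' assume "s \<in> I" "s' \<in> I" "?r s = ?r s'"
    then show "s = s'" using less[of s' s] less[of s s'] by (cases s s' rule: linorder_cases) auto
  qed
  have sub: "?r ` I \<subseteq> {1..card I}"
  proof (rule image_subsetI)
    fix s assume "s \<in> I"
    then have "{j\<in>I. j \<le> s} \<noteq> {}" "finite {j\<in>I. j \<le> s}" using assms by auto
    then have "0 < ?r s" unfolding card_gt_0_iff by (rule conjI)
    moreover have "?r s \<le> card I" using assms by (intro card_mono) auto
    ultimately show "?r s \<in> {1..card I}" by simp
  qed
  have "?r ` I = {1..card I}"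
    by (rule card_subset_eq[OF _ sub]) (use card_image[OF inj] in simp_all)
  then show ?thesis using inj by (simp add: bij_betw_def)
qed

lemma marginal_labelsD:
  assumes "l \<in> marginal_labels n"
  shows "fst l \<subseteq> {1..n}" "card (fst l) = n div 2" "snd l permutes {1..n div 2}" "finite (fst l)"
proof -
  show I: "fst l \<subseteq> {1..n}" and "card (fst l) = n div 2" and "snd l permutes {1..n div 2}"
    using assms by (auto simp: marginal_labels_def)
  show "finite (fst l)" by (rule finite_subset[OF I]) simp
qed

lemma slot_rank_bij:
  assumes l: "l \<in> marginal_labels n"
  shows "bij_betw (slot_rank l) (fst l) {1..n div 2}"
proof -
  have "bij_betw (snd l \<circ> (\<lambda>s. card {j\<in>fst l. j \<le> s})) (fst l) {1..n div 2}"
    using rank_bij[of "fst l"] marginal_labelsD[OF l] permutes_imp_bij[of "snd l"]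
    by (intro bij_betw_trans[of _ _ "{1..n div 2}"]) auto
  then show ?thesis by (simp add: slot_rank_def[abs_def] comp_def)
qed

lemma slot_bij:
  assumes l: "l \<in> marginal_labels n"
  shows "bij_betw (slot (n div 2) l) {1..n div 2} (fst l)"
  using bij_betw_inv_into[OF slot_rank_bij[OF l]]
  by (subst bij_betw_cong[of _ _ "inv_into (fst l) (slot_rank l)"]) (auto simp: slot_def)

lemma slot_slot_rank:
  assumes l: "l \<in> marginal_labels n"
  shows "s \<in> fst l \<Longrightarrow> slot (n div 2) l (slot_rank l s) = s" "s \<in> fst l \<Longrightarrow> slot_rank l s \<in> {1..n div 2}"
    and "i \<in> {1..n div 2} \<Longrightarrow> slot_rank l (slot (n div 2) l i) = i"
    and "i \<in> {1..n div 2} \<Longrightarrow> slot (n div 2) l i \<in> fst l"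
proof -
  note b = slot_rank_bij[OF l]
  show m: "slot_rank l s \<in> {1..n div 2}" if "s \<in> fst l" for s using bij_betwE[OF b] that by blast
  show "slot (n div 2) l (slot_rank l s) = s" if "s \<in> fst l"
    using m[OF that] bij_betw_inv_into_left[OF b that] by (simp add: slot_def)
  show "slot_rank l (slot (n div 2) l i) = i" if "i \<in> {1..n div 2}"
    using that bij_betw_inv_into_right[OF b that] by (simp add: slot_def)
  show "slot (n div 2) l i \<in> fst l" if "i \<in> {1..n div 2}" using bij_betwE[OF slot_bij[OF l]] that by blast
qed

text \<open>The range of the slot map recovers I, and comparison with the increasing listing of I
  recovers \<pi>. Equality of slots in the index equations thus becomes equality of both components
  of the label.\<close>

lemma slot_eq_iff:
  assumes l: "l \<in> marginal_labels n" and l': "l' \<in> marginal_labels n"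
  shows "(\<forall>i\<in>{1..n div 2}. slot (n div 2) l i = slot (n div 2) l' i) \<longleftrightarrow> l = l'"
proof
  assume eq: "\<forall>i\<in>{1..n div 2}. slot (n div 2) l i = slot (n div 2) l' i"
  have "fst l = slot (n div 2) l ` {1..n div 2}" using slot_bij[OF l] by (simp add: bij_betw_def)
  also have "\<dots> = slot (n div 2) l' ` {1..n div 2}" using eq by (intro image_cong) auto
  also have "\<dots> = fst l'" using slot_bij[OF l'] by (simp add: bij_betw_def)
  finally have f: "fst l = fst l'" .
  have "snd l x = snd l' x" for x
  proof (cases "x \<in> {1..n div 2}")
    case True
    then have "x \<in> (\<lambda>s. card {j\<in>fst l. j \<le> s}) ` fst l"
      using rank_bij[of "fst l"] marginal_labelsD[OF l] by (simp add: bij_betw_def)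
    then obtain s where s: "s \<in> fst l" "x = card {j\<in>fst l. j \<le> s}" by auto
    have "slot (n div 2) l' (slot_rank l s) = s"
      using eq slot_slot_rank(1,2)[OF l s(1)] by auto
    then have "slot_rank l' s = slot_rank l s"
      using slot_slot_rank(3)[OF l', of "slot_rank l s"] slot_slot_rank(2)[OF l s(1)] by simp
    then show ?thesis using s f by (simp add: slot_rank_def)
  next
    case False
    then show ?thesis using marginal_labelsD(3)[OF l] marginal_labelsD(3)[OF l'] by (simp add: permutes_not_in)
  qed
  then show "l = l'" using f by (simp add: prod_eq_iff fun_eq_iff)
qed auto

lemma finite_multi_indices: "finite S \<Longrightarrow> finite (multi_indices S N)"
  unfolding multi_indices_def by (intro finite_PiE) auto

lemma card_multi_indices: "finite S \<Longrightarrow> card (multi_indices S N) = N ^ card S"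
  unfolding multi_indices_def by (simp add: card_PiE)

text \<open>The multi-index of the unconjugated tensor entry: it shares the traced slots with the
  conjugated entry \<open>S\<close> and takes the others from the row \<open>a\<close>.\<close>

definition row_index :: "nat \<Rightarrow> nat set \<times> (nat \<Rightarrow> nat) \<Rightarrow> multi_index \<Rightarrow> multi_index \<Rightarrow> multi_index" where
  "row_index n l a S = (\<lambda>s\<in>{1..n}. if s \<in> fst l then a (slot_rank l s) else S s)"

lemma permuted_marginal_eq_marginal:
  assumes l: "l \<in> marginal_labels n" and a: "a \<in> multi_indices {1..n div 2} N" and b: "b \<in> multi_indices {1..n div 2} N"
  shows "permuted_marginal n N l x a b = marginal n N (fst l) x (a \<circ> snd l) (b \<circ> snd l)"
proof -
  let ?D = "multi_indices {1..n div 2} N" and ?\<pi> = "snd l"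
  have \<pi>: "?\<pi> permutes {1..n div 2}" by (rule marginal_labelsD[OF l])
  have fin: "finite ?D" by (rule finite_multi_indices) simp
  have mem: "c \<circ> ?\<pi> \<in> ?D" if "c \<in> ?D" for c by (rule comp_permutes_multi_indices[OF \<pi> that])
  have inv2: "inv (inv ?\<pi>) = ?\<pi>" using \<pi> by (simp add: permutes_inv_inv)
  have iff: "a = c \<circ> inv ?\<pi> \<longleftrightarrow> c = a \<circ> ?\<pi>" for a c
    using permutes_inv_o[OF \<pi>] by (metis comp_assoc comp_id)
  have 1: "mat_mult ?D (perm_op (inv ?\<pi>)) mat_one c b = perm_op (inv ?\<pi>) c b" for c
    using fin b by (simp add: mat_mult_def mat_one_def if_distrib cong: if_cong)
  have 2: "mat_mult ?D W (mat_mult ?D (perm_op (inv ?\<pi>)) mat_one) c b = W c (b \<circ> ?\<pi>)" for W c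
    unfolding mat_mult_def[of ?D W] 1
    using fin mem[OF b] by (simp add: perm_op_def inv2 if_distrib cong: if_cong)
  have "permuted_marginal n N l x a b =
    mat_mult ?D (perm_op ?\<pi>) (mat_mult ?D (marginal n N (fst l) x) (mat_mult ?D (perm_op (inv ?\<pi>)) mat_one)) a b"
    by (simp add: permuted_marginal_def mat_prod_def split_beta Let_def)
  also have "\<dots> = (\<Sum>c\<in>?D. perm_op ?\<pi> a c * marginal n N (fst l) x c (b \<circ> ?\<pi>))"
    unfolding mat_mult_def[of ?D "perm_op ?\<pi>"] 2 ..
  also have "\<dots> = (\<Sum>c\<in>?D. if c = a \<circ> ?\<pi> then marginal n N (fst l) x c (b \<circ> ?\<pi>) else 0)"
    by (intro sum.cong refl) (simp add: perm_op_def iff)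
  also have "\<dots> = marginal n N (fst l) x (a \<circ> ?\<pi>) (b \<circ> ?\<pi>)"
    using fin mem[OF a] by simp
  finally show ?thesis .
qed

text \<open>The sum runs over complete multi-indices of the conjugated entry, a range independent of
  the label, and the column index becomes a condition. In a product the columns can then be
  eliminated all at once.\<close>

lemma permuted_marginal_entry:
  assumes l: "l \<in> marginal_labels n" and a: "a \<in> multi_indices {1..n div 2} N" and b: "b \<in> multi_indices {1..n div 2} N"
  shows "permuted_marginal n N l x a b =
    (\<Sum>S\<in>multi_indices {1..n} N. if \<forall>i\<in>{1..n div 2}. S (slot (n div 2) l i) = b i
      then x (row_index n l a S) * cnj (x S) else 0)"
proof -
  let ?I = "fst l" and ?J = "{1..n} - fst l" and ?\<pi> = "snd l"
  let ?A = "{S \<in> multi_indices {1..n} N. \<forall>i\<in>{1..n div 2}. S (slot (n div 2) l i) = b i}"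
  have I: "?I \<subseteq> {1..n}" by (rule marginal_labelsD[OF l])
  have sp: "spread ?I (a \<circ> ?\<pi>) s = a (slot_rank l s)" if "s \<in> ?I" for a s
    using that by (simp add: spread_def slot_rank_def)
  let ?m = "\<lambda>c. merge ?I ?J (spread ?I (b \<circ> ?\<pi>), c)"
  have mI: "?m c s = b (slot_rank l s)" if "s \<in> ?I" for c s using sp that by (simp add: merge_def)
  have mJ: "?m c s = c s" if "s \<in> ?J" for c s using that by (simp add: merge_def)
  have bD: "b (slot_rank l s) \<in> {1..N}" if "s \<in> ?I" for s
    using b slot_slot_rank(2)[OF l that] by (auto simp: multi_indices_def PiE_iff)
  have "permuted_marginal n N l x a b = (\<Sum>c\<in>multi_indices ?J N. x (merge ?I ?J (spread ?I (a \<circ> ?\<pi>), c)) * cnj (x (?m c)))"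
    unfolding permuted_marginal_eq_marginal[OF l a b] marginal_def partial_trace_def rank_one_def ..
  also have "\<dots> = (\<Sum>S\<in>?A. x (row_index n l a S) * cnj (x S))"
  proof (rule sum.reindex_bij_witness[of _ "\<lambda>S. restrict S ?J" ?m])
    fix c assume c: "c \<in> multi_indices ?J N"
    show "restrict (?m c) ?J = c"
      using c mJ by (auto simp: fun_eq_iff multi_indices_def PiE_iff extensional_def)
    have "?m c s \<in> {1..N}" if "s \<in> {1..n}" for s
      using mI[of s c] mJ[of s c] bD[of s] c that by (cases "s \<in> ?I") (auto simp: multi_indices_def PiE_iff)
    moreover have "?m c \<in> extensional {1..n}" using I by (auto simp: merge_def extensional_def)
    moreover have "?m c (slot (n div 2) l i) = b i" if "i \<in> {1..n div 2}" for i
      using mI[OF slot_slot_rank(4)[OF l that]] slot_slot_rank(3)[OF l that] by simp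
    ultimately show "?m c \<in> ?A" by (simp add: multi_indices_def PiE_iff)
    have "row_index n l a (?m c) = merge ?I ?J (spread ?I (a \<circ> ?\<pi>), c)"
      using I sp by (auto simp: fun_eq_iff row_index_def merge_def)
    then show "x (row_index n l a (?m c)) * cnj (x (?m c)) = x (merge ?I ?J (spread ?I (a \<circ> ?\<pi>), c)) * cnj (x (?m c))"
      by simp
  next
    fix S assume S: "S \<in> ?A"
    then show "restrict S ?J \<in> multi_indices ?J N" by (auto simp: multi_indices_def PiE_iff)
    have "?m (restrict S ?J) s = S s" for s
    proof (cases "s \<in> ?I")
      case True
      have "S (slot (n div 2) l (slot_rank l s)) = b (slot_rank l s)"
        using S slot_slot_rank(2)[OF l True] by blast
      then show ?thesis using mI[OF True] slot_slot_rank(1)[OF l True] by simp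
    next
      case False
      then show ?thesis using S by (auto simp: merge_def multi_indices_def PiE_iff extensional_def)
    qed
    then show "?m (restrict S ?J) = S" by (simp add: fun_eq_iff)
  qed
  also have "\<dots> = (\<Sum>S\<in>multi_indices {1..n} N. if \<forall>i\<in>{1..n div 2}. S (slot (n div 2) l i) = b i
      then x (row_index n l a S) * cnj (x S) else 0)"
    by (rule sum.inter_filter) (simp add: finite_multi_indices)
  finally show ?thesis .
qed

section \<open>Expansion of the trace\<close>

text \<open>The value \<open>g k\<close> is the column of factor \<open>k\<close>. The factors stand
  in descending order, so the row of factor \<open>k\<close> is the column of factor
  \<open>Suc k\<close>, and the free row \<open>x\<close> belongs to factor \<open>p\<close>; taking
  the trace closes this chain to the cycle \<gamma>.\<close>

lemma mat_prod_path_sum: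
  assumes D: "finite D" and p: "p \<ge> 1" and y: "y \<in> D"
  shows "mat_prod D (map A (rev [1..<Suc p])) x y =
    (\<Sum>g\<in>{1..p} \<rightarrow>\<^sub>E D. if g 1 = y then \<Prod>k\<in>{1..p}. A k (if k = p then x else g (Suc k)) (g k) else 0)"
  using p
proof (induction p arbitrary: x rule: nat_induct_at_least)
  case base
  have "mat_prod D (map A (rev [1..<Suc 1])) x y = A 1 x y"
    using D y by (simp add: mat_prod_def mat_mult_def mat_one_def if_distrib cong: if_cong)
  also have "\<dots> = (\<Sum>g\<in>{1..1 :: nat} \<rightarrow>\<^sub>E D. if g = (\<lambda>k\<in>{1}. y) then A 1 x (g 1) else 0)"
  proof -
    have fin: "finite ({1..1 :: nat} \<rightarrow>\<^sub>E D)" by (intro finite_PiE) (use D in auto)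
    have mem: "(\<lambda>k\<in>{1}. y) \<in> {1..1 :: nat} \<rightarrow>\<^sub>E D" using y by (auto simp: PiE_iff extensional_def)
    have "(\<Sum>g\<in>{1..1 :: nat} \<rightarrow>\<^sub>E D. if g = (\<lambda>k\<in>{1}. y) then A 1 x (g 1) else 0) = A 1 x ((\<lambda>k\<in>{1 :: nat}. y) 1)"
      by (rule trans[OF sum.delta[OF fin] if_P[OF mem]])
    then show ?thesis by simp
  qed
  also have "\<dots> = (\<Sum>g\<in>{1..1} \<rightarrow>\<^sub>E D. if g 1 = y then \<Prod>k\<in>{1..1}. A k (if k = 1 then x else g (Suc k)) (g k) else 0)"
  proof (intro sum.cong refl)
    fix g assume "g \<in> {1..1 :: nat} \<rightarrow>\<^sub>E D"
    then have "g = (\<lambda>k\<in>{1}. y) \<longleftrightarrow> g 1 = y"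
      by (auto simp: fun_eq_iff PiE_iff extensional_def)
    then show "(if g = (\<lambda>k\<in>{1}. y) then A 1 x (g 1) else 0) =
      (if g 1 = y then \<Prod>k\<in>{1..1}. A k (if k = 1 then x else g (Suc k)) (g k) else 0)" by simp
  qed
  finally show ?case .
next
  case (Suc p)
  let ?F = "\<lambda>p x g. if g 1 = y then \<Prod>k\<in>{1..p}. A k (if k = p then x else g (Suc k)) (g k) else 0"
  have "mat_prod D (map A (rev [1..<Suc (Suc p)])) x y = (\<Sum>c\<in>D. A (Suc p) x c * mat_prod D (map A (rev [1..<Suc p])) c y)"
    using Suc.hyps by (simp add: mat_prod_def mat_mult_def)
  also have "\<dots> = (\<Sum>c\<in>D. \<Sum>g\<in>{1..p} \<rightarrow>\<^sub>E D. A (Suc p) x c * ?F p c g)"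
    unfolding Suc.IH sum_distrib_left ..
  also have "\<dots> = (\<Sum>(c, g)\<in>D \<times> ({1..p} \<rightarrow>\<^sub>E D). A (Suc p) x c * ?F p c g)"
    by (simp add: sum.cartesian_product)
  also have "\<dots> = (\<Sum>(c, g)\<in>D \<times> ({1..p} \<rightarrow>\<^sub>E D). ?F (Suc p) x (g(Suc p := c)))"
  proof (intro sum.cong refl, clarify)
    fix c g
    have "(\<Prod>k\<in>{1..Suc p}. A k (if k = Suc p then x else (g(Suc p := c)) (Suc k)) ((g(Suc p := c)) k)) =
      A (Suc p) x c * (\<Prod>k\<in>{1..p}. A k (if k = p then c else g (Suc k)) (g k))"
    proof -
      have "(\<Prod>k\<in>{1..p}. A k (if k = Suc p then x else (g(Suc p := c)) (Suc k)) ((g(Suc p := c)) k)) =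
        (\<Prod>k\<in>{1..p}. A k (if k = p then c else g (Suc k)) (g k))"
        by (intro prod.cong) auto
      then show ?thesis by (simp add: mult.commute)
    qed
    then show "A (Suc p) x c * ?F p c g = ?F (Suc p) x (g(Suc p := c))"
      using Suc.hyps by simp
  qed
  also have "\<dots> = (\<Sum>g\<in>insert (Suc p) {1..p} \<rightarrow>\<^sub>E D. ?F (Suc p) x g)"
    unfolding PiE_insert_eq
    by (subst sum.reindex[OF inj_combinator]) (simp, rule sum.cong, simp, clarsimp simp del: fun_upd_apply)
  also have "insert (Suc p) {1..p} = {1..Suc p}" by auto
  finally show ?case .
qed

lemma mat_trace_path_sum:
  assumes D: "finite D" and p: "p \<ge> 1"
  shows "mat_trace D (mat_prod D (map A (rev [1..<Suc p]))) =
    (\<Sum>g\<in>{1..p} \<rightarrow>\<^sub>E D. \<Prod>k\<in>{1..p}. A k (g (rot 1 (Suc p) k)) (g k))"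
proof -
  have "mat_trace D (mat_prod D (map A (rev [1..<Suc p]))) =
    (\<Sum>x\<in>D. \<Sum>g\<in>{1..p} \<rightarrow>\<^sub>E D. if g 1 = x then \<Prod>k\<in>{1..p}. A k (if k = p then x else g (Suc k)) (g k) else 0)"
    unfolding mat_trace_def by (intro sum.cong refl mat_prod_path_sum[OF D p])
  also have "\<dots> = (\<Sum>g\<in>{1..p} \<rightarrow>\<^sub>E D. \<Sum>x\<in>D. if g 1 = x then \<Prod>k\<in>{1..p}. A k (if k = p then x else g (Suc k)) (g k) else 0)"
    by (rule sum.swap)
  also have "\<dots> = (\<Sum>g\<in>{1..p} \<rightarrow>\<^sub>E D. \<Prod>k\<in>{1..p}. A k (g (rot 1 (Suc p) k)) (g k))"
  proof (intro sum.cong refl)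
    fix g assume "g \<in> {1..p} \<rightarrow>\<^sub>E D"
    then have "g 1 \<in> D" using p by (auto simp: PiE_iff)
    then have "(\<Sum>x\<in>D. if g 1 = x then \<Prod>k\<in>{1..p}. A k (if k = p then x else g (Suc k)) (g k) else 0) =
      (\<Prod>k\<in>{1..p}. A k (if k = p then g 1 else g (Suc k)) (g k))"
      using D by (simp cong: if_cong)
    also have "\<dots> = (\<Prod>k\<in>{1..p}. A k (g (rot 1 (Suc p) k)) (g k))"
      by (intro prod.cong) (auto simp: rot_def)
    finally show "(\<Sum>x\<in>D. if g 1 = x then \<Prod>k\<in>{1..p}. A k (if k = p then x else g (Suc k)) (g k) else 0) =
      (\<Prod>k\<in>{1..p}. A k (g (rot 1 (Suc p) k)) (g k))" .
  qed
  finally show ?thesis .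
qed

lemma rot_mem: "k \<in> {1..p} \<Longrightarrow> rot 1 (Suc p) k \<in> {1..p}"
  by (auto simp: rot_def)

text \<open>The index of the unconjugated tensor entry of factor \<open>k\<close>, given the indices \<open>S\<close> of the conjugated ones.\<close>

definition left_index :: "nat \<Rightarrow> nat \<Rightarrow> (nat \<Rightarrow> nat set \<times> (nat \<Rightarrow> nat)) \<Rightarrow> (nat \<Rightarrow> multi_index) \<Rightarrow> nat \<Rightarrow> multi_index" where
  "left_index n p L S k = row_index n (L k)
     (\<lambda>i\<in>{1..n div 2}. S (rot 1 (Suc p) k) (slot (n div 2) (L (rot 1 (Suc p) k)) i)) (S k)"

text \<open>The column indices are functions of the conjugated entries and disappear from the sum;
  what remains is a sum of monomials to which Wick's formula applies.\<close>

lemma trace_marginals: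
  assumes p: "p \<ge> 1" and L: "\<And>k. k \<in> {1..p} \<Longrightarrow> L k \<in> marginal_labels n"
  shows "mat_trace (multi_indices {1..n div 2} N)
      (mat_prod (multi_indices {1..n div 2} N) (map (\<lambda>k. permuted_marginal n N (L k) x) (rev [1..<Suc p]))) =
    (\<Sum>S\<in>{1..p} \<rightarrow>\<^sub>E multi_indices {1..n} N. \<Prod>k\<in>{1..p}. x (left_index n p L S k) * cnj (x (S k)))"
proof -
  let ?m = "n div 2" and ?D = "multi_indices {1..n div 2} N" and ?E = "multi_indices {1..n} N"
  let ?\<gamma> = "rot 1 (Suc p)"
  define F where "F k a S = x (row_index n (L k) a S) * cnj (x S)" for k a S
  define h where "h S k = (\<lambda>i\<in>{1..?m}. S k (slot ?m (L k) i))" for S :: "nat \<Rightarrow> multi_index" and k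
  define c where "c S g k \<longleftrightarrow> (\<forall>i\<in>{1..?m}. S k (slot ?m (L k) i) = g k i)" for S g :: "nat \<Rightarrow> multi_index" and k
  have fin: "finite ?D" "finite ?E" by (simp_all add: finite_multi_indices)
  have "mat_trace ?D (mat_prod ?D (map (\<lambda>k. permuted_marginal n N (L k) x) (rev [1..<Suc p]))) =
    (\<Sum>g\<in>{1..p} \<rightarrow>\<^sub>E ?D. \<Prod>k\<in>{1..p}. permuted_marginal n N (L k) x (g (?\<gamma> k)) (g k))"
    by (rule mat_trace_path_sum[OF fin(1) p])
  also have "\<dots> = (\<Sum>g\<in>{1..p} \<rightarrow>\<^sub>E ?D. \<Prod>k\<in>{1..p}. \<Sum>s\<in>?E. if \<forall>i\<in>{1..?m}. s (slot ?m (L k) i) = g k i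
      then F k (g (?\<gamma> k)) s else 0)"
  proof (intro sum.cong prod.cong refl)
    fix g k assume g: "g \<in> {1..p} \<rightarrow>\<^sub>E ?D" and k: "k \<in> {1..p}"
    have "g k \<in> ?D" "g (?\<gamma> k) \<in> ?D" using g k rot_mem[OF k] by (auto simp: PiE_iff)
    then show "permuted_marginal n N (L k) x (g (?\<gamma> k)) (g k) = (\<Sum>s\<in>?E. if \<forall>i\<in>{1..?m}. s (slot ?m (L k) i) = g k i
      then F k (g (?\<gamma> k)) s else 0)"
      unfolding F_def by (intro permuted_marginal_entry L k)
  qed
  also have "\<dots> = (\<Sum>g\<in>{1..p} \<rightarrow>\<^sub>E ?D. \<Sum>S\<in>{1..p} \<rightarrow>\<^sub>E ?E. \<Prod>k\<in>{1..p}. if c S g k then F k (g (?\<gamma> k)) (S k) else 0)"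
    unfolding c_def using fin by (subst prod_sum_PiE) auto
  also have "\<dots> = (\<Sum>S\<in>{1..p} \<rightarrow>\<^sub>E ?E. \<Sum>g\<in>{1..p} \<rightarrow>\<^sub>E ?D. \<Prod>k\<in>{1..p}. if c S g k then F k (g (?\<gamma> k)) (S k) else 0)"
    by (rule sum.swap)
  also have "\<dots> = (\<Sum>S\<in>{1..p} \<rightarrow>\<^sub>E ?E. \<Prod>k\<in>{1..p}. F k (h S (?\<gamma> k)) (S k))"
  proof (intro sum.cong refl)
    fix S assume S: "S \<in> {1..p} \<rightarrow>\<^sub>E ?E"
    let ?h = "restrict (h S) {1..p}"
    have "slot ?m (L k) i \<in> {1..n}" if "k \<in> {1..p}" "i \<in> {1..?m}" for k i
      using slot_slot_rank(4)[OF L[OF that(1)] that(2)] marginal_labelsD(1)[OF L[OF that(1)]] by blast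
    then have "h S k \<in> ?D" if "k \<in> {1..p}" for k
      using S that unfolding h_def multi_indices_def PiE_iff by auto
    then have hD: "?h \<in> {1..p} \<rightarrow>\<^sub>E ?D" by auto
    \<comment> \<open>The column conditions leave exactly one family \<open>g\<close>, the one read
      off from \<open>S\<close>.\<close>
    have iff: "(\<forall>k\<in>{1..p}. c S g k) \<longleftrightarrow> g = ?h" if g: "g \<in> {1..p} \<rightarrow>\<^sub>E ?D" for g
    proof
      assume c: "\<forall>k\<in>{1..p}. c S g k"
      show "g = ?h"
      proof (rule PiE_ext[OF g hD])
        fix k assume k: "k \<in> {1..p}"
        have "g k i = h S k i" for i
        proof (cases "i \<in> {1..?m}")
          case True
          then show ?thesis using bspec[OF c k] by (simp add: c_def h_def)
        next
          case False
          have "g k \<in> extensional {1..?m}" using g k by (auto simp: PiE_iff multi_indices_def)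
          then show ?thesis using False by (auto simp: extensional_def h_def)
        qed
        then show "g k = ?h k" using k by (simp add: fun_eq_iff)
      qed
    next
      assume "g = ?h"
      then show "\<forall>k\<in>{1..p}. c S g k" unfolding c_def h_def by simp
    qed
    have "(\<Sum>g\<in>{1..p} \<rightarrow>\<^sub>E ?D. \<Prod>k\<in>{1..p}. if c S g k then F k (g (?\<gamma> k)) (S k) else 0) =
      (\<Sum>g\<in>{1..p} \<rightarrow>\<^sub>E ?D. if g = ?h then \<Prod>k\<in>{1..p}. F k (h S (?\<gamma> k)) (S k) else 0)"
    proof (intro sum.cong refl)
      fix g assume g: "g \<in> {1..p} \<rightarrow>\<^sub>E ?D"
      show "(\<Prod>k\<in>{1..p}. if c S g k then F k (g (?\<gamma> k)) (S k) else 0) =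
        (if g = ?h then \<Prod>k\<in>{1..p}. F k (h S (?\<gamma> k)) (S k) else 0)"
      proof (cases "g = ?h")
        case True
        have "(\<Prod>k\<in>{1..p}. if c S g k then F k (g (?\<gamma> k)) (S k) else 0) = (\<Prod>k\<in>{1..p}. F k (h S (?\<gamma> k)) (S k))"
        proof (intro prod.cong refl)
          fix k assume k: "k \<in> {1..p}"
          then show "(if c S g k then F k (g (?\<gamma> k)) (S k) else 0) = F k (h S (?\<gamma> k)) (S k)"
            using iff[OF g] True rot_mem[OF k] by simp
        qed
        then show ?thesis using True by simp
      next
        case False
        then obtain k where "k \<in> {1..p}" "\<not> c S g k" using iff[OF g] by blast
        then have "(\<Prod>k\<in>{1..p}. if c S g k then F k (g (?\<gamma> k)) (S k) else 0) = 0"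
          by (intro prod_zero) auto
        then show ?thesis using False by simp
      qed
    qed
    also have "\<dots> = (\<Prod>k\<in>{1..p}. F k (h S (?\<gamma> k)) (S k))"
      using hD fin by (simp add: finite_PiE)
    finally show "(\<Sum>g\<in>{1..p} \<rightarrow>\<^sub>E ?D. \<Prod>k\<in>{1..p}. if c S g k then F k (g (?\<gamma> k)) (S k) else 0) =
      (\<Prod>k\<in>{1..p}. F k (h S (?\<gamma> k)) (S k))" .
  qed
  finally show ?thesis unfolding F_def h_def left_index_def .
qed

text \<open>Pairing the unconjugated entry of factor \<alpha> k with the conjugated one of factor k
  gives one equation per slot. The marginal slots refer to the next factor of the cyclic product,
  which is why \<beta> = \<gamma> \<alpha> enters.\<close>

lemma card_left_index_eq_card_solutions:
  assumes L: "\<And>k. k \<in> {1..p} \<Longrightarrow> L k \<in> marginal_labels n" and \<alpha>: "\<alpha> permutes {1..p}"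
    and e: "slot_labels {1..n div 2} {1..n} m N e" and eL: "\<And>k. k \<in> {1..p} \<Longrightarrow> e k = slot (n div 2) (L k)"
  shows "card {S \<in> {1..p} \<rightarrow>\<^sub>E multi_indices {1..n} N. \<forall>k\<in>{1..p}. left_index n p L S (\<alpha> k) = S k} =
    card (slot_labels.solutions {1..n div 2} {1..n} N e {1..p} \<alpha> (rot 1 (Suc p) \<circ> \<alpha>))"
proof -
  interpret slot_labels "{1..n div 2}" "{1..n}" m N e by fact
  let ?V = "{1..p}" and ?J = "{1..n}" and ?\<beta> = "rot 1 (Suc p) \<circ> \<alpha>" and ?m = "n div 2"
  let ?A = "{S \<in> ?V \<rightarrow>\<^sub>E multi_indices ?J N. \<forall>k\<in>?V. left_index n p L S (\<alpha> k) = S k}"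
  let ?u = "\<lambda>S. \<lambda>(k, s)\<in>?V \<times> ?J. S k s" and ?c = "\<lambda>S. \<lambda>k\<in>?V. \<lambda>s\<in>?J. S (k, s)"
  have \<alpha>V: "\<alpha> k \<in> ?V" "?\<beta> k \<in> ?V" if "k \<in> ?V" for k
    using that \<alpha> rot_mem by (simp_all add: permutes_in_image del: atLeastAtMost_iff)
  have iff: "left_index n p L S (\<alpha> k) = S k \<longleftrightarrow>
      (\<forall>s\<in>?J - e (\<alpha> k) ` {1..?m}. S k s = S (\<alpha> k) s) \<and> (\<forall>i\<in>{1..?m}. S k (e (\<alpha> k) i) = S (?\<beta> k) (e (?\<beta> k) i))"
    if S: "S \<in> ?V \<rightarrow>\<^sub>E multi_indices ?J N" and k: "k \<in> ?V" for S k
  proof -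
    note La = L[OF \<alpha>V(1)[OF k]]
    have im: "e (\<alpha> k) ` {1..?m} = fst (L (\<alpha> k))"
      using slot_bij[OF La] eL[OF \<alpha>V(1)[OF k]] by (simp add: bij_betw_def)
    have ext: "S k \<in> extensional ?J" using S k by (auto simp: multi_indices_def PiE_iff)
    have lo: "left_index n p L S (\<alpha> k) (e (\<alpha> k) i) = S (?\<beta> k) (e (?\<beta> k) i)" "e (\<alpha> k) i \<in> ?J" if i: "i \<in> {1..?m}" for i
    proof -
      have "e (\<alpha> k) i \<in> fst (L (\<alpha> k))" using i im by blast
      moreover show J: "e (\<alpha> k) i \<in> ?J" using e_J i by blast
      moreover have "slot_rank (L (\<alpha> k)) (e (\<alpha> k) i) = i"
        using slot_slot_rank(3)[OF La i] eL[OF \<alpha>V(1)[OF k]] by simp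
      ultimately show "left_index n p L S (\<alpha> k) (e (\<alpha> k) i) = S (?\<beta> k) (e (?\<beta> k) i)"
        using i eL[OF \<alpha>V(2)[OF k]] by (simp add: left_index_def row_index_def)
    qed
    have hi: "left_index n p L S (\<alpha> k) s = S (\<alpha> k) s" if "s \<in> ?J - e (\<alpha> k) ` {1..?m}" for s
      using that im by (simp add: left_index_def row_index_def)
    have out: "left_index n p L S (\<alpha> k) s = S k s" if "s \<notin> ?J" for s
      using that ext by (auto simp: left_index_def row_index_def extensional_def)
    show ?thesis
    proof
      assume eq: "left_index n p L S (\<alpha> k) = S k"
      show "(\<forall>s\<in>?J - e (\<alpha> k) ` {1..?m}. S k s = S (\<alpha> k) s) \<and> (\<forall>i\<in>{1..?m}. S k (e (\<alpha> k) i) = S (?\<beta> k) (e (?\<beta> k) i))"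
        using hi lo(1) unfolding eq by blast
    next
      assume r: "(\<forall>s\<in>?J - e (\<alpha> k) ` {1..?m}. S k s = S (\<alpha> k) s) \<and> (\<forall>i\<in>{1..?m}. S k (e (\<alpha> k) i) = S (?\<beta> k) (e (?\<beta> k) i))"
      show "left_index n p L S (\<alpha> k) = S k"
      proof
        fix s
        consider "s \<notin> ?J" | "s \<in> ?J - e (\<alpha> k) ` {1..?m}" | i where "i \<in> {1..?m}" "s = e (\<alpha> k) i" by blast
        then show "left_index n p L S (\<alpha> k) s = S k s"
        proof cases
          case 1 then show ?thesis by (rule out)
        next
          case 2 then show ?thesis using hi[OF 2] bspec[OF conjunct1[OF r] 2] by simp
        next
          case (3 i) then show ?thesis using lo(1)[OF 3(1)] bspec[OF conjunct2[OF r] 3(1)] by simp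
        qed
      qed
    qed
  qed
  have eJ: "e k i \<in> ?J" if "i \<in> {1..?m}" for k i using e_J that by blast
  have "bij_betw ?u ?A (solutions ?V \<alpha> ?\<beta>)"
  proof (rule bij_betw_byWitness[where f' = ?c])
    show "\<forall>S\<in>?A. ?c (?u S) = S"
    proof
      fix S assume "S \<in> ?A"
      then have S: "S \<in> ?V \<rightarrow>\<^sub>E multi_indices ?J N" by simp
      show "?c (?u S) = S"
      proof (rule PiE_ext[of _ ?V "\<lambda>_. multi_indices ?J N"])
        show "?c (?u S) k = S k" if "k \<in> ?V" for k
          using S that by (auto simp: fun_eq_iff PiE_iff multi_indices_def extensional_def)
        then show "?c (?u S) \<in> ?V \<rightarrow>\<^sub>E multi_indices ?J N" using S by (auto simp: PiE_iff)
      qed (rule S)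
    qed
    show "\<forall>S\<in>solutions ?V \<alpha> ?\<beta>. ?u (?c S) = S"
    proof
      fix S assume S: "S \<in> solutions ?V \<alpha> ?\<beta>"
      have "S \<in> extensional (?V \<times> ?J)" using solutionsD(1)[OF S] by (simp add: PiE_iff)
      then show "?u (?c S) = S" by (auto simp: fun_eq_iff extensional_def)
    qed
    show "?u ` ?A \<subseteq> solutions ?V \<alpha> ?\<beta>"
    proof (rule image_subsetI)
      fix S assume A: "S \<in> ?A"
      then have S: "S \<in> ?V \<rightarrow>\<^sub>E multi_indices ?J N" by simp
      have r: "(\<forall>s\<in>?J - e (\<alpha> k) ` {1..?m}. S k s = S (\<alpha> k) s) \<and> (\<forall>i\<in>{1..?m}. S k (e (\<alpha> k) i) = S (?\<beta> k) (e (?\<beta> k) i))"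
        if "k \<in> ?V" for k using iff[OF S that] A that by simp
      show "?u S \<in> solutions ?V \<alpha> ?\<beta>"
      proof (rule solutionsI)
        show "?u S \<in> ?V \<times> ?J \<rightarrow>\<^sub>E {1..N}" using S by (auto simp: PiE_iff multi_indices_def)
        show "?u S (k, s) = ?u S (\<alpha> k, s)" if "k \<in> ?V" "s \<in> ?J" "s \<notin> e (\<alpha> k) ` {1..?m}" for k s
          using bspec[OF conjunct1[OF r[OF that(1)]], of s] that \<alpha>V(1)[OF that(1)] by simp
        show "?u S (k, e (\<alpha> k) i) = ?u S (?\<beta> k, e (?\<beta> k) i)" if "k \<in> ?V" "i \<in> {1..?m}" for k i
          using bspec[OF conjunct2[OF r[OF that(1)]] that(2)] that(1) \<alpha>V(2)[OF that(1)] eJ[OF that(2)]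
          by (simp del: atLeastAtMost_iff)
      qed
    qed
    show "?c ` solutions ?V \<alpha> ?\<beta> \<subseteq> ?A"
    proof (rule image_subsetI)
      fix T assume T: "T \<in> solutions ?V \<alpha> ?\<beta>"
      have S: "?c T \<in> ?V \<rightarrow>\<^sub>E multi_indices ?J N"
        using solutionsD(1)[OF T] by (auto simp: PiE_iff multi_indices_def)
      have "left_index n p L (?c T) (\<alpha> k) = ?c T k" if k: "k \<in> ?V" for k
        unfolding iff[OF S k]
      proof (intro conjI ballI)
        show "?c T k s = ?c T (\<alpha> k) s" if "s \<in> ?J - e (\<alpha> k) ` {1..?m}" for s
          using solutionsD(2)[OF T k, of s] that k \<alpha>V(1)[OF k] by (simp del: atLeastAtMost_iff)
        show "?c T k (e (\<alpha> k) i) = ?c T (?\<beta> k) (e (?\<beta> k) i)" if "i \<in> {1..?m}" for i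
          using solutionsD(3)[OF T k that] k \<alpha>V(2)[OF k] eJ[OF that] by (simp del: atLeastAtMost_iff)
      qed
      then show "?c T \<in> ?A" using S by simp
    qed
  qed
  then show ?thesis by (rule bij_betw_same_card)
qed

section \<open>The limit of the moments\<close>

text \<open>Constancy on cycles is equivalent to invariance under one step of \<alpha>, and genus 0
  is the equality case of the cycle bound.\<close>

lemma balanced_maps_eq:
  "balanced_maps p f \<pi> = (\<lambda>\<alpha>. (rot 1 (Suc p), \<alpha>)) ` {\<alpha>. \<alpha> permutes {1..p} \<and>
     cycle_count {1..p} \<alpha> + cycle_count {1..p} (rot 1 (Suc p) \<circ> \<alpha>) = p + 1 \<and>
     (\<forall>k\<in>{1..p}. (f (\<alpha> k), \<pi> (\<alpha> k)) = (f k, \<pi> k))}"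
proof -
  have g: "genus p (rot 1 (Suc p), \<alpha>) = 0 \<longleftrightarrow> cycle_count {1..p} \<alpha> + cycle_count {1..p} (rot 1 (Suc p) \<circ> \<alpha>) = p + 1" for \<alpha>
    unfolding genus_def cycles_of_def cycle_count_def prod.case by (simp add: algebra_simps) linarith
  have c: "(\<forall>C\<in>cycles_of p \<alpha>. \<forall>a\<in>C. \<forall>b\<in>C. f a = f b \<and> \<pi> a = \<pi> b) \<longleftrightarrow> (\<forall>k\<in>{1..p}. (f (\<alpha> k), \<pi> (\<alpha> k)) = (f k, \<pi> k))"
    if \<alpha>: "\<alpha> permutes {1..p}" for \<alpha>
  proof
    assume a: "\<forall>C\<in>cycles_of p \<alpha>. \<forall>a\<in>C. \<forall>b\<in>C. f a = f b \<and> \<pi> a = \<pi> b"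
    show "\<forall>k\<in>{1..p}. (f (\<alpha> k), \<pi> (\<alpha> k)) = (f k, \<pi> k)"
    proof
      fix k assume k: "k \<in> {1..p}"
      have "orbit \<alpha> k \<in> cycles_of p \<alpha>" using k by (simp add: cycles_of_def)
      moreover have "\<alpha> k \<in> orbit \<alpha> k" by (rule orbit.base)
      moreover have "k \<in> orbit \<alpha> k" by (rule orbit_self[OF \<alpha>]) simp
      ultimately show "(f (\<alpha> k), \<pi> (\<alpha> k)) = (f k, \<pi> k)" using a by blast
    qed
  next
    assume a: "\<forall>k\<in>{1..p}. (f (\<alpha> k), \<pi> (\<alpha> k)) = (f k, \<pi> k)"
    have o: "y \<in> {1..p} \<and> f y = f x \<and> \<pi> y = \<pi> x" if "y \<in> orbit \<alpha> x" "x \<in> {1..p}" for x y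
      using that
    proof induct
      case base
      then show ?case using a \<alpha> by (simp add: permutes_in_image del: atLeastAtMost_iff)
    next
      case (step y)
      then show ?case using a \<alpha> by (simp add: permutes_in_image del: atLeastAtMost_iff)
    qed
    show "\<forall>C\<in>cycles_of p \<alpha>. \<forall>a\<in>C. \<forall>b\<in>C. f a = f b \<and> \<pi> a = \<pi> b"
    proof (intro ballI)
      fix C x y assume "C \<in> cycles_of p \<alpha>" "x \<in> C" "y \<in> C"
      then obtain z where z: "z \<in> {1..p}" "x \<in> orbit \<alpha> z" "y \<in> orbit \<alpha> z" by (auto simp: cycles_of_def)
      show "f x = f y \<and> \<pi> x = \<pi> y" using o[OF z(2,1)] o[OF z(3,1)] by simp
    qed
  qed
  show ?thesis
  proof (rule set_eqI)
    fix x :: "(nat \<Rightarrow> nat) \<times> (nat \<Rightarrow> nat)"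
    obtain \<gamma> \<alpha> where x: "x = (\<gamma>, \<alpha>)" by (cases x)
    let ?A = "{\<alpha>. \<alpha> permutes {1..p} \<and>
      cycle_count {1..p} \<alpha> + cycle_count {1..p} (rot 1 (Suc p) \<circ> \<alpha>) = p + 1 \<and>
      (\<forall>k\<in>{1..p}. (f (\<alpha> k), \<pi> (\<alpha> k)) = (f k, \<pi> k))}"
    have "x \<in> balanced_maps p f \<pi> \<longleftrightarrow> \<gamma> = rot 1 (Suc p) \<and> \<alpha> permutes {1..p} \<and> genus p (\<gamma>, \<alpha>) = 0 \<and>
      (\<forall>C\<in>cycles_of p \<alpha>. \<forall>a\<in>C. \<forall>b\<in>C. f a = f b \<and> \<pi> a = \<pi> b)"
      unfolding x balanced_maps_def combinatorial_maps_def cycle_of_list_upt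
      by (simp only: mem_Collect_eq prod.case conj_assoc)
    also have "\<dots> \<longleftrightarrow> \<gamma> = rot 1 (Suc p) \<and> \<alpha> \<in> ?A"
      unfolding mem_Collect_eq using g[of \<alpha>] c[of \<alpha>] by (intro conj_cong refl) simp_all
    also have "\<dots> \<longleftrightarrow> x \<in> (\<lambda>\<alpha>. (rot 1 (Suc p), \<alpha>)) ` ?A"
      unfolding x image_iff prod.inject by blast
    finally show "x \<in> balanced_maps p f \<pi> \<longleftrightarrow> x \<in> (\<lambda>\<alpha>. (rot 1 (Suc p), \<alpha>)) ` ?A" .
  qed
qed

lemma card_balanced_maps:
  assumes "p \<ge> 1"
  shows "card (balanced_maps p f \<pi>) = card (planar_maps 1 (Suc p) (\<lambda>k. (f k, \<pi> k)))"
proof -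
  have inj: "inj_on (\<lambda>\<alpha>. (rot 1 (Suc p), \<alpha>)) A" for A by (auto simp: inj_on_def)
  have V: "{1..<Suc p} = {1..p}" by auto
  show ?thesis
    unfolding balanced_maps_eq card_image[OF inj] planar_maps_def planar_def V using assms
    by (intro arg_cong[of _ _ card]) auto
qed

lemma sum_card_swap:
  assumes "finite A" "finite B"
  shows "(\<Sum>x\<in>A. card {y\<in>B. R x y}) = (\<Sum>y\<in>B. card {x\<in>A. R x y})"
proof -
  have "(\<Sum>x\<in>A. card {y\<in>B. R x y}) = (\<Sum>x\<in>A. \<Sum>y\<in>B. if R x y then 1 else 0)"
    using assms by (intro sum.cong refl) (simp add: sum.inter_filter[symmetric])
  also have "\<dots> = (\<Sum>y\<in>B. \<Sum>x\<in>A. if R x y then 1 else 0)" by (rule sum.swap)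
  also have "\<dots> = (\<Sum>y\<in>B. card {x\<in>A. R x y})"
    using assms by (intro sum.cong refl) (simp add: sum.inter_filter[symmetric])
  finally show ?thesis .
qed

lemma integral_trace_marginals:
  assumes g: "gaussian_tensor M n N X" and p: "p \<ge> 1" and L: "\<And>k. k \<in> {1..p} \<Longrightarrow> L k \<in> marginal_labels n"
  shows "(\<integral>\<omega>. mat_trace (multi_indices {1..n div 2} N)
      (mat_prod (multi_indices {1..n div 2} N) (map (\<lambda>k. permuted_marginal n N (L k) (\<lambda>i. X i \<omega>)) (rev [1..<Suc p]))) \<partial>M) =
    of_nat (\<Sum>\<alpha>\<in>{\<alpha>. \<alpha> permutes {1..p}}. card {S \<in> {1..p} \<rightarrow>\<^sub>E multi_indices {1..n} N. \<forall>k\<in>{1..p}. left_index n p L S (\<alpha> k) = S k})"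
proof -
  let ?E = "{1..p} \<rightarrow>\<^sub>E multi_indices {1..n} N" and ?I = "multi_indices {1..n} N"
  have M: "prob_space M" "prob_space.indep_vars M (\<lambda>_. borel) X ?I" "\<And>t. t \<in> ?I \<Longrightarrow> standard_complex_gaussian M (X t)"
    using g by (auto simp: gaussian_tensor_def)
  have I: "finite ?I" by (simp add: finite_multi_indices)
  have E: "finite ?E" by (rule finite_PiE[OF finite_atLeastAtMost I])
  have im: "S ` {1..p} \<subseteq> ?I" "left_index n p L S ` {1..p} \<subseteq> ?I" if S: "S \<in> ?E" for S
  proof -
    show "S ` {1..p} \<subseteq> ?I" using S by auto
    show "left_index n p L S ` {1..p} \<subseteq> ?I"
    proof (rule image_subsetI)
      fix k assume k: "k \<in> {1..p}"
      let ?j = "rot 1 (Suc p) k"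
      have j: "?j \<in> {1..p}" by (rule rot_mem[OF k])
      have Sk: "S k \<in> ?I" "S ?j \<in> ?I" using S k j by (auto simp: PiE_iff)
      have "left_index n p L S k s \<in> {1..N}" if s: "s \<in> {1..n}" for s
      proof (cases "s \<in> fst (L k)")
        case True
        let ?i = "slot_rank (L k) s"
        have i: "?i \<in> {1..n div 2}" by (rule slot_slot_rank(2)[OF L[OF k] True])
        have "slot (n div 2) (L ?j) ?i \<in> {1..n}"
          using slot_slot_rank(4)[OF L[OF j] i] marginal_labelsD(1)[OF L[OF j]] by blast
        then have "S ?j (slot (n div 2) (L ?j) ?i) \<in> {1..N}" using Sk(2) by (auto simp: multi_indices_def PiE_iff)
        then show ?thesis using True s i by (simp add: left_index_def row_index_def)
      next
        case False
        then show ?thesis using s Sk(1) by (auto simp: left_index_def row_index_def multi_indices_def PiE_iff)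
      qed
      moreover have "left_index n p L S k \<in> extensional {1..n}" by (simp add: left_index_def row_index_def)
      ultimately show "left_index n p L S k \<in> ?I" by (simp add: multi_indices_def PiE_iff)
    qed
  qed
  note W = wick_formula[OF M(1,2) I M(3) finite_atLeastAtMost]
  have "(\<integral>\<omega>. mat_trace (multi_indices {1..n div 2} N)
      (mat_prod (multi_indices {1..n div 2} N) (map (\<lambda>k. permuted_marginal n N (L k) (\<lambda>i. X i \<omega>)) (rev [1..<Suc p]))) \<partial>M) =
    (\<integral>\<omega>. (\<Sum>S\<in>?E. \<Prod>k\<in>{1..p}. X (left_index n p L S k) \<omega> * cnj (X (S k) \<omega>)) \<partial>M)"
    by (intro Bochner_Integration.integral_cong refl trace_marginals p L)
  also have "\<dots> = (\<Sum>S\<in>?E. \<integral>\<omega>. (\<Prod>k\<in>{1..p}. X (left_index n p L S k) \<omega> * cnj (X (S k) \<omega>)) \<partial>M)"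
    by (rule Bochner_Integration.integral_sum) (rule W(1)[OF _ im])
  also have "\<dots> = (\<Sum>S\<in>?E. of_nat (card {\<alpha>. \<alpha> permutes {1..p} \<and> (\<forall>k\<in>{1..p}. left_index n p L S (\<alpha> k) = S k)}))"
    by (intro sum.cong refl W(2) im)
  also have "\<dots> = of_nat (\<Sum>S\<in>?E. card {\<alpha> \<in> {\<alpha>. \<alpha> permutes {1..p}}. \<forall>k\<in>{1..p}. left_index n p L S (\<alpha> k) = S k})"
    by simp
  also have "(\<Sum>S\<in>?E. card {\<alpha> \<in> {\<alpha>. \<alpha> permutes {1..p}}. \<forall>k\<in>{1..p}. left_index n p L S (\<alpha> k) = S k}) =
    (\<Sum>\<alpha>\<in>{\<alpha>. \<alpha> permutes {1..p}}. card {S \<in> ?E. \<forall>k\<in>{1..p}. left_index n p L S (\<alpha> k) = S k})"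
    by (rule sum_card_swap[OF E]) (simp add: finite_permutations)
  finally show ?thesis .
qed

text \<open>The pair of \<alpha> and \<gamma> \<alpha> is transitive because \<gamma> is a full
  cycle, so the general count applies. Its conditions for equality say that \<alpha> is planar and
  preserves the labels.\<close>

lemma card_left_index_bounds:
  assumes n: "n \<ge> 2" "even n" and p: "p \<ge> 1" and N: "N \<ge> 1"
    and L: "\<And>k. k \<in> {1..p} \<Longrightarrow> L k \<in> marginal_labels n" and \<alpha>: "\<alpha> permutes {1..p}"
  shows "if \<alpha> \<in> planar_maps 1 (Suc p) L
    then card {S \<in> {1..p} \<rightarrow>\<^sub>E multi_indices {1..n} N. \<forall>k\<in>{1..p}. left_index n p L S (\<alpha> k) = S k} = N ^ (n div 2 * (p + 1))
    else card {S \<in> {1..p} \<rightarrow>\<^sub>E multi_indices {1..n} N. \<forall>k\<in>{1..p}. left_index n p L S (\<alpha> k) = S k} \<le> N ^ (n div 2 * (p + 1) - 1)"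
proof -
  let ?m = "n div 2"
  \<comment> \<open>The locale constrains \<open>e\<close> at every natural number; outside {1..p}
    the identity serves as a default.\<close>
  define e where "e k = (if k \<in> {1..p} then slot ?m (L k) else id)" for k
  have nm: "n = 2 * ?m" using n by simp
  interpret slot_labels "{1..?m}" "{1..n}" ?m N e
  proof
    show "inj_on (e k) {1..?m}" for k
      using slot_bij[OF L, of k] by (auto simp: e_def bij_betw_def)
    show "e k ` {1..?m} \<subseteq> {1..n}" for k
    proof (cases "k \<in> {1..p}")
      case True
      then show ?thesis using slot_bij[OF L[OF True]] marginal_labelsD(1)[OF L[OF True]] by (simp add: e_def bij_betw_def)
    qed (auto simp: e_def)
  qed (use n N nm in auto)
  have V: "{1..<Suc p} = {1..p}" by auto
  have \<beta>: "rot 1 (Suc p) \<circ> \<alpha> permutes {1..p}" using permutes_compose[OF \<alpha> rot_permutes[of 1 "Suc p", unfolded V]] .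
  have t: "transitive_pair {1..p} \<alpha> (rot 1 (Suc p) \<circ> \<alpha>)" using transitive_pair_rot[of \<alpha> 1 "Suc p"] \<alpha> V by simp
  have c: "card {S \<in> {1..p} \<rightarrow>\<^sub>E multi_indices {1..n} N. \<forall>k\<in>{1..p}. left_index n p L S (\<alpha> k) = S k} =
    card (solutions {1..p} \<alpha> (rot 1 (Suc p) \<circ> \<alpha>))"
    by (rule card_left_index_eq_card_solutions[where L = L, OF L \<alpha> slot_labels_axioms]) (simp_all add: e_def)
  have cp: "card {1..p} = p" by simp
  have bal: "(\<forall>i\<in>{1..?m}. e (\<alpha> k) i = e k i) \<longleftrightarrow> L (\<alpha> k) = L k" if k: "k \<in> {1..p}" for k
  proof -
    have ak: "\<alpha> k \<in> {1..p}" using k \<alpha> by (simp add: permutes_in_image del: atLeastAtMost_iff)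
    show ?thesis using slot_eq_iff[OF L[OF ak] L[OF k]] ak k by (simp only: e_def if_True)
  qed
  have pl: "\<alpha> \<in> planar_maps 1 (Suc p) L \<longleftrightarrow>
    cycle_count {1..p} \<alpha> + cycle_count {1..p} (rot 1 (Suc p) \<circ> \<alpha>) = p + 1 \<and> (\<forall>k\<in>{1..p}. \<forall>i\<in>{1..?m}. e (\<alpha> k) i = e k i)"
    unfolding planar_maps_def planar_def V using \<alpha> p bal by simp
  have "if cycle_count {1..p} \<alpha> + cycle_count {1..p} (rot 1 (Suc p) \<circ> \<alpha>) = card {1..p} + 1 \<and> (\<forall>k\<in>{1..p}. \<forall>i\<in>{1..?m}. e (\<alpha> k) i = e k i)
    then card (solutions {1..p} \<alpha> (rot 1 (Suc p) \<circ> \<alpha>)) = N ^ (?m * (card {1..p} + 1))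
    else card (solutions {1..p} \<alpha> (rot 1 (Suc p) \<circ> \<alpha>)) \<le> N ^ (?m * (card {1..p} + 1) - 1)"
    by (rule card_solutions[OF \<alpha> \<beta> _ _ t]) (use p in auto)
  then show ?thesis unfolding cp pl[symmetric] c[symmetric] .
qed

text \<open>The number of permutations is fixed while N grows. The planar label-preserving ones each
  contribute 1 to the normalised sum, all others at most 1 / N.\<close>

lemma trace_limit:
  fixes M :: "nat \<Rightarrow> 'w measure"
  assumes n: "n \<ge> 2" "even n" and g: "\<And>N. N \<ge> 1 \<Longrightarrow> gaussian_tensor (M N) n N (X N)" and p: "p \<ge> 1"
    and L: "\<And>k. k \<in> {1..p} \<Longrightarrow> L k \<in> marginal_labels n"
  shows "(\<lambda>N. (\<integral>\<omega>. mat_trace (multi_indices {1..n div 2} N)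
      (mat_prod (multi_indices {1..n div 2} N) (map (\<lambda>k. permuted_marginal n N (L k) (\<lambda>i. X N i \<omega>)) (rev [1..<Suc p]))) \<partial>M N)
        / of_nat (N ^ (n div 2 * (p + 1)))) \<longlonglongrightarrow> of_nat (card (planar_maps 1 (Suc p) L))"
proof -
  let ?P = "{\<alpha>. \<alpha> permutes {1..p}}" and ?m = "n div 2"
  define C where "C N \<alpha> = card {S \<in> {1..p} \<rightarrow>\<^sub>E multi_indices {1..n} N. \<forall>k\<in>{1..p}. left_index n p L S (\<alpha> k) = S k}" for N \<alpha>
  have m: "?m \<ge> 1" using n by auto
  have lim: "(\<lambda>N. of_nat (C N \<alpha>) / of_nat (N ^ (?m * (p + 1))) :: complex) \<longlonglongrightarrow> (if \<alpha> \<in> planar_maps 1 (Suc p) L then 1 else 0)"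
    if \<alpha>: "\<alpha> permutes {1..p}" for \<alpha>
  proof (cases "\<alpha> \<in> planar_maps 1 (Suc p) L")
    case True
    have "\<forall>\<^sub>F N in sequentially. of_nat (C N \<alpha>) / of_nat (N ^ (?m * (p + 1))) = (1 :: complex)"
      using eventually_ge_at_top[of 1]
    proof eventually_elim
      case (elim N)
      then have "C N \<alpha> = N ^ (?m * (p + 1))" using card_left_index_bounds[of n p N L \<alpha>, OF n p elim L \<alpha>] by (simp only: C_def True if_True)
      then show ?case using elim by simp
    qed
    then show ?thesis using True by (simp add: tendsto_eventually)
  next
    case False
    have "(\<lambda>N. of_nat (C N \<alpha>) / of_nat (N ^ (?m * (p + 1))) :: complex) \<longlonglongrightarrow> 0"
    proof (rule Lim_null_comparison)
      show "\<forall>\<^sub>F N in sequentially. norm (of_nat (C N \<alpha>) / of_nat (N ^ (?m * (p + 1))) :: complex) \<le> 1 / real N"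
        using eventually_ge_at_top[of 1]
      proof eventually_elim
        case (elim N)
        define q where "q = ?m * (p + 1) - 1"
        have q: "?m * (p + 1) = Suc q" using m by (simp add: q_def)
        have "C N \<alpha> \<le> N ^ q" using card_left_index_bounds[of n p N L \<alpha>, OF n p elim L \<alpha>] by (simp only: C_def False if_False q_def)
        then have "real (C N \<alpha>) \<le> real N ^ q" by (metis of_nat_le_iff of_nat_power)
        then have "real (C N \<alpha>) / real N ^ Suc q \<le> real N ^ q / real N ^ Suc q"
          by (intro divide_right_mono) auto
        also have "\<dots> = 1 / real N" using elim by (simp add: field_simps)
        finally show ?case unfolding q by (simp add: norm_divide norm_mult norm_power)
      qed
      show "(\<lambda>N. 1 / real N) \<longlonglongrightarrow> 0" by (rule lim_1_over_n)
    qed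
    then show ?thesis using False by simp
  qed
  have sub: "planar_maps 1 (Suc p) L \<subseteq> ?P"
    by (auto simp: planar_maps_def planar_def atLeastLessThanSuc_atLeastAtMost)
  have "(\<lambda>N. \<Sum>\<alpha>\<in>?P. of_nat (C N \<alpha>) / of_nat (N ^ (?m * (p + 1))) :: complex)
      \<longlonglongrightarrow> (\<Sum>\<alpha>\<in>?P. if \<alpha> \<in> planar_maps 1 (Suc p) L then 1 else 0)"
    by (intro tendsto_sum lim) simp
  also have "(\<Sum>\<alpha>\<in>?P. if \<alpha> \<in> planar_maps 1 (Suc p) L then 1 else 0) = (of_nat (card (?P \<inter> planar_maps 1 (Suc p) L)) :: complex)"
    by (simp add: sum.inter_restrict[symmetric] finite_permutations)
  also have "?P \<inter> planar_maps 1 (Suc p) L = planar_maps 1 (Suc p) L" using sub by blast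
  finally have lim': "(\<lambda>N. \<Sum>\<alpha>\<in>?P. of_nat (C N \<alpha>) / of_nat (N ^ (?m * (p + 1))) :: complex)
      \<longlonglongrightarrow> of_nat (card (planar_maps 1 (Suc p) L))" .
  have "\<forall>\<^sub>F N in sequentially. (\<Sum>\<alpha>\<in>?P. of_nat (C N \<alpha>) / of_nat (N ^ (?m * (p + 1))) :: complex) =
    (\<integral>\<omega>. mat_trace (multi_indices {1..n div 2} N)
      (mat_prod (multi_indices {1..n div 2} N) (map (\<lambda>k. permuted_marginal n N (L k) (\<lambda>i. X N i \<omega>)) (rev [1..<Suc p]))) \<partial>M N)
        / of_nat (N ^ (?m * (p + 1)))"
    using eventually_ge_at_top[of 1]
  proof eventually_elim
    case (elim N)
    note I = integral_trace_marginals[where L = L, OF g[OF elim] p L]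
    show ?case by (subst I) (simp_all only: C_def of_nat_sum sum_divide_distrib)
  qed
  then show ?thesis using lim' by (rule Lim_transform_eventually[rotated])
qed

lemma card_marginal_labels: "card (marginal_labels n) = (n choose (n div 2)) * fact (n div 2)"
  unfolding marginal_labels_def card_cartesian_product
  using n_subsets[of "{1..n}" "n div 2"] card_permutations[of "{1..n div 2}" "n div 2"] by simp

lemma converges_in_moments_marginals:
  fixes M :: "nat \<Rightarrow> 'w measure"
  assumes n: "n \<ge> 2" "even n" and g: "\<And>N. N \<ge> 1 \<Longrightarrow> gaussian_tensor (M N) n N (X N)"
  shows "converges_in_moments M (\<lambda>N. multi_indices {1..n div 2} N) (marginal_labels n)
     (\<lambda>N j \<omega> s t. permuted_marginal n N j (\<lambda>i. X N i \<omega>) s t / of_nat (N ^ (n div 2))) vacuum_state free_generator"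
  unfolding converges_in_moments_def
proof
  fix js assume js: "js \<in> lists (marginal_labels n)"
  let ?D = "\<lambda>N. multi_indices {1..n div 2} N" and ?m = "n div 2"
  have card: "card (?D N) = N ^ ?m" for N by (simp add: card_multi_indices)
  let ?A = "\<lambda>N \<omega> j s t. permuted_marginal n N j (\<lambda>i. X N i \<omega>) s t / of_nat (N ^ ?m)"
  show "(\<lambda>N. \<integral>\<omega>. mat_trace (?D N) (mat_prod (?D N) (map (?A N \<omega>) js)) / of_nat (card (?D N)) \<partial>M N)
     \<longlonglongrightarrow> vacuum_state (prod_list (map free_generator js))"
  proof (cases "js = []")
    case True
    \<comment> \<open>The empty word is the normalised trace of the identity, equal to 1 as soon as
      the index set is nonempty.\<close>
    have "\<forall>\<^sub>F N in sequentially. (\<integral>\<omega>. mat_trace (?D N) (mat_prod (?D N) (map (?A N \<omega>) js)) / of_nat (card (?D N)) \<partial>M N) = 1"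
      using eventually_ge_at_top[of 1]
    proof eventually_elim
      case (elim N)
      interpret prob_space "M N" using g[OF elim] by (simp add: gaussian_tensor_def)
      show ?case using elim True card[of N] by (simp add: mat_trace_def mat_prod_def mat_one_def prob_space)
    qed
    then show ?thesis using True
      by (simp add: vacuum_state_prod[of "[]", simplified] tendsto_eventually)
  next
    case False
    define p where "p = length js"
    \<comment> \<open>The leftmost factor of a word carries the number p, so the list is read
      backwards.\<close>
    define L where "L k = js ! (p - k)" for k
    have p: "p \<ge> 1" using False by (simp add: p_def Suc_le_eq)
    have L: "L k \<in> marginal_labels n" if "k \<in> {1..p}" for k
      using js that unfolding L_def p_def in_lists_conv_set by auto
    have map: "map h js = map (\<lambda>k. h (L k)) (rev [1..<Suc p])" for h :: "_ \<Rightarrow> 'z"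
      by (rule nth_equalityI) (auto simp: p_def L_def rev_nth simp del: upt_Suc)
    have fin: "finite (?D N)" for N by (simp add: finite_multi_indices)
    \<comment> \<open>The p factors contribute \<open>N ^ ?m\<close> each to the denominator, and
      the normalisation of the trace contributes it once more.\<close>
    have scale: "mat_trace (?D N) (mat_prod (?D N) (map (?A N \<omega>) js)) / of_nat (card (?D N)) =
      mat_trace (?D N) (mat_prod (?D N) (map (\<lambda>k. permuted_marginal n N (L k) (\<lambda>i. X N i \<omega>)) (rev [1..<Suc p])))
        / of_nat (N ^ (?m * (p + 1)))" for N \<omega>
    proof -
      have "mat_trace (?D N) (mat_prod (?D N) (map (?A N \<omega>) js)) =
        (\<Sum>h\<in>{1..p} \<rightarrow>\<^sub>E ?D N. \<Prod>k\<in>{1..p}. permuted_marginal n N (L k) (\<lambda>i. X N i \<omega>) (h (rot 1 (Suc p) k)) (h k) / of_nat (N ^ ?m))"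
        unfolding map by (rule mat_trace_path_sum[OF fin p])
      also have "\<dots> = (\<Sum>h\<in>{1..p} \<rightarrow>\<^sub>E ?D N. \<Prod>k\<in>{1..p}. permuted_marginal n N (L k) (\<lambda>i. X N i \<omega>) (h (rot 1 (Suc p) k)) (h k)) / of_nat (N ^ ?m) ^ p"
        by (simp add: prod_dividef sum_divide_distrib)
      also have "(\<Sum>h\<in>{1..p} \<rightarrow>\<^sub>E ?D N. \<Prod>k\<in>{1..p}. permuted_marginal n N (L k) (\<lambda>i. X N i \<omega>) (h (rot 1 (Suc p) k)) (h k)) =
        mat_trace (?D N) (mat_prod (?D N) (map (\<lambda>k. permuted_marginal n N (L k) (\<lambda>i. X N i \<omega>)) (rev [1..<Suc p])))"
        by (rule mat_trace_path_sum[OF fin p, symmetric])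
      finally have e: "mat_trace (?D N) (mat_prod (?D N) (map (?A N \<omega>) js)) =
        mat_trace (?D N) (mat_prod (?D N) (map (\<lambda>k. permuted_marginal n N (L k) (\<lambda>i. X N i \<omega>)) (rev [1..<Suc p])))
          / of_nat (N ^ ?m) ^ p" .
      have "(of_nat (N ^ ?m) ^ p * of_nat (N ^ ?m) :: complex) = of_nat (N ^ (?m * (p + 1)))"
        by (simp only: power_mult power_add power_one_right of_nat_mult of_nat_power)
      then show ?thesis unfolding card e by (simp only: divide_divide_eq_left)
    qed
    have "vacuum_state (prod_list (map free_generator js)) = word_moment (map L (rev [1..<Suc p]))"
      using vacuum_state_prod[of js] map[of id] by simp
    also have "\<dots> = of_nat (card (planar_maps 1 (Suc p) L))"
      by (rule word_moment_eq_card_planar_maps) simp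
    finally have v: "vacuum_state (prod_list (map free_generator js)) = of_nat (card (planar_maps 1 (Suc p) L))" .
    show ?thesis
      unfolding v scale integral_divide_zero by (rule trace_limit[where L = L, OF n g p L])
  qed
qed

theorem theorem4p13:
  fixes n :: nat
    and M :: "nat \<Rightarrow> 'w measure"
    and X :: "nat \<Rightarrow> multi_index \<Rightarrow> 'w \<Rightarrow> complex"
  assumes "n \<ge> 2" and "even n"
    and "\<And>N. N \<ge> 1 \<Longrightarrow> gaussian_tensor (M N) n N (X N)"
  shows
    "(card (marginal_labels n) = (n choose (n div 2)) * fact (n div 2) \<and>
      (\<exists>(\<phi> :: (nat set \<times> (nat \<Rightarrow> nat)) free_algebra \<Rightarrow> complex) a.
         nc_probability_space free_algebra_scale \<phi> \<and>
         free_family free_algebra_scale \<phi> (marginal_labels n) a \<and>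
         (\<forall>j\<in>marginal_labels n. \<exists>\<mu>. marchenko_pastur 1 \<mu> \<and> has_distribution \<phi> (a j) \<mu>) \<and>
         converges_in_moments M (\<lambda>N. multi_indices {1..n div 2} N) (marginal_labels n)
           (\<lambda>N j \<omega> s t. permuted_marginal n N j (\<lambda>i. X N i \<omega>) s t / of_nat (N ^ (n div 2)))
           \<phi> a)) \<and>
     (\<forall>p\<ge>1. \<forall>(f :: nat \<Rightarrow> nat set) (\<pi> :: nat \<Rightarrow> nat \<Rightarrow> nat).
        (\<forall>k\<in>{1..p}. f k \<subseteq> {1..n} \<and> card (f k) = n div 2 \<and> \<pi> k permutes {1..n div 2}) \<longrightarrow>
        (\<lambda>N. \<integral>\<omega>. mat_trace (multi_indices {1..n div 2} N)
                   (mat_prod (multi_indices {1..n div 2} N)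
                     (map (\<lambda>k. permuted_marginal n N (f k, \<pi> k) (\<lambda>i. X N i \<omega>)) (rev [1..<Suc p])))
                 / of_nat (N ^ (n * (p + 1) div 2)) \<partial>M N)
          \<longlonglongrightarrow> of_nat (card (balanced_maps p f \<pi>)))"
proof (intro conjI exI[of _ vacuum_state] exI[of _ free_generator] allI impI ballI exI[of _ mp_measure])
  show "card (marginal_labels n) = (n choose (n div 2)) * fact (n div 2)" by (rule card_marginal_labels)
  show "nc_probability_space free_algebra_scale vacuum_state" by (rule nc_probability_space_vacuum)
  show "free_family free_algebra_scale vacuum_state (marginal_labels n) free_generator"
    by (rule free_family_generators)
  show "marchenko_pastur 1 mp_measure" by (rule marchenko_pastur_mp_measure)
  show "has_distribution vacuum_state (free_generator j) mp_measure" for j :: "nat set \<times> (nat \<Rightarrow> nat)"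
    by (rule has_distribution_generator)
  show "converges_in_moments M (\<lambda>N. multi_indices {1..n div 2} N) (marginal_labels n)
     (\<lambda>N j \<omega> s t. permuted_marginal n N j (\<lambda>i. X N i \<omega>) s t / of_nat (N ^ (n div 2))) vacuum_state free_generator"
    by (rule converges_in_moments_marginals[OF assms])
next
  fix p :: nat and f :: "nat \<Rightarrow> nat set" and \<pi> :: "nat \<Rightarrow> nat \<Rightarrow> nat"
  assume p: "1 \<le> p" and L: "\<forall>k\<in>{1..p}. f k \<subseteq> {1..n} \<and> card (f k) = n div 2 \<and> \<pi> k permutes {1..n div 2}"
  \<comment> \<open>Evenness of \<open>n\<close> makes the integer division exact.\<close>
  have e: "n * (p + 1) div 2 = n div 2 * (p + 1)" using assms(2) by (metis dvd_div_mult)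
  show "(\<lambda>N. \<integral>\<omega>. mat_trace (multi_indices {1..n div 2} N)
                   (mat_prod (multi_indices {1..n div 2} N)
                     (map (\<lambda>k. permuted_marginal n N (f k, \<pi> k) (\<lambda>i. X N i \<omega>)) (rev [1..<Suc p])))
                 / of_nat (N ^ (n * (p + 1) div 2)) \<partial>M N)
          \<longlonglongrightarrow> of_nat (card (balanced_maps p f \<pi>))"
    unfolding e integral_divide_zero card_balanced_maps[OF p]
    by (rule trace_limit[OF assms p]) (use L in \<open>auto simp: marginal_labels_def\<close>)
qed

end
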